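(* Let $q$ be transcendental over $\mathbb{Q}$, let $n,r$ be positive integers, and let $\underline{V}$ be the $(n+1)$-dimensional $\mathbb{Q}(q)$-vector space with basis $\eta_1,\dots,\eta_{n+1}$. Let $\mathcal{D}(n,r)=\Xi(\mathfrak{HH}_r)\subset \mathrm{End}_{\mathbb{Q}(q)}(\underline{V}^{\otimes r})$ be the image of the duplex Hecke algebra $\mathfrak{HH}_r$, and let $\Phi$ be the natural representation of the Levi quantum group $L_q(\mathfrak{gl}_{n+1})$ on $\underline{V}^{\otimes r}$. Then the following double centralizer property holds: $$\mathrm{End}_{\mathcal{D}(n,r)}(\underline{V}^{\otimes r})=\Phi(L_q(\mathfrak{gl}_{n+1})),$$ $$\mathrm{End}_{L_q(\mathfrak{gl}_{n+1})}(\underline{V}^{\otimes r})=\mathcal{D}(n,r).$$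
   Context: Ground field: $\mathscr{A}=\mathbb{Q}(q)$, with $q$ transcendental over $\mathbb{Q}$. Quantum group. For $m\ge 1$, $\mathbf{U}_q(\mathfrak{gl}_m)$ is the associative unital $\mathbb{Q}(q)$-algebra generated by $E_i,F_i$ ($1\le i\le m-1$) and $H_a,H_a^{-1}$ ($1\le a\le m$), with $K_i:=H_iH_{i+1}^{-1}$, subject to: $H_aH_a^{-1}=H_a^{-1}H_a=1$, $H_aH_b=H_bH_a$; $H_iE_iH_i^{-1}=qE_i$, $H_iF_iH_i^{-1}=q^{-1}F_i$; $H_{i+1}E_iH_{i+1}^{-1}=q^{-1}E_i$, $H_{i+1}F_iH_{i+1}^{-1}=qF_i$; $H_kE_iH_k^{-1}=E_i$, $H_kF_iH_k^{-1}=F_i$ for $k\ne i,i+1$; $E_iF_j-F_jE_i=\delta_{ij}\frac{K_i-K_i^{-1}}{q-q^{-1}}$; $E_iE_j=E_jE_i$, $F_iF_j=F_jF_i$ if $|i-j|>1$; $E_i^2E_j-(q+q^{-1})E_iE_jE_i+E_jE_i^2=0$ and $F_i^2F_j-(q+q^{-1})F_iF_jF_i+F_jF_i^2=0$ if $|i-j|=1$. Its comultiplication $\Delta$ is $H_a\mapsto H_a\otimes H_a$, $E_i\mapsto 1\otimes E_i+E_i\otimes K_i^{-1}$, $F_i\mapsto F_i\otimes 1+K_i\otimes F_i$. Natural module. $V$ has basis $\eta_1,\dots,\eta_n$ and $\underline{V}=V\oplus\mathbb{Q}(q)\eta_{n+1}$. $\mathbf{U}_q(\mathfrak{gl}_{n+1})$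 acts on $\underline{V}$ by $H_i\eta_i=q\eta_i$, $H_i\eta_j=\eta_j$ ($j\ne i$); $F_i\eta_i=\eta_{i+1}$, $F_i\eta_j=0$ ($j\neq i$); $E_i\eta_{i+1}=\eta_i$, $E_i\eta_j=0$ ($j\ne i+1$); it acts on $\underline{V}^{\otimes r}$ through the iterated comultiplication. This representation is denoted $\Phi$. Levi quantum group. $L_q(\mathfrak{gl}_{n+1})$ is the subalgebra of $\mathbf{U}_q(\mathfrak{gl}_{n+1})$ generated by $E_i,F_i$ ($1\le i\le n-1$) and $H_j,H_j^{-1}$ ($1\le j\le n+1$). It acts on $\underline{V}^{\otimes r}$ by restriction of $\Phi$. Hecke algebra. $\mathbf{H}(\mathfrak{S}_m)$ is the unital $\mathbb{Q}(q)$-algebra generated by $T_{s_i}$ ($1\le i\le m-1$, $s_i=(i,i+1)$) with $(T_{s_i}+q)(T_{s_i}-q^{-1})=0$, $T_{s_i}T_{s_{i+1}}T_{s_i}=T_{s_{i+1}}T_{s_i}T_{s_{i+1}}$, $T_{s_i}T_{s_j}=T_{s_j}T_{s_i}$ for $|i-j|>1$; $T_\sigma=T_{s_{i_1}}\cdots T_{s_{i_k}}$ for a reduced expression $\sigma=s_{i_1}\cdots s_{i_k}$. The length function is $\ell$. For a vector space with ordered basis $\eta_1,\eta_2,\dots$, the generator $T_{s_i}$ acts on the $m$-th tensor power by the operator sending $M_f=\eta_{f(1)}\otimes\cdots\otimes\eta_{f(m)}$ to $M_{fs_i}$ if $f(i)<f(i+1)$, to $M_{fs_i}+(q^{-1}-q)M_f$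 if $f(i)>f(i+1)$, and to $q^{-1}M_f$ if $f(i)=f(i+1)$, where $(fs_i)(j)=f(s_i(j))$. The resulting representation (product of generators going to composition of operators) is denoted $\Psi$ on $\underline{V}^{\otimes r}$ and $\Psi^V_l$ for $\mathbf{H}(\mathfrak{S}_l)$ on $V^{\otimes l}$. Duplex Hecke algebra. $\mathfrak{HH}_r$ is the unital associative $\mathbb{Q}(q)$-algebra with generators $\mathrm{T}_{s_i}$ ($1\le i\le r-1$) and $x^{(l)}_\sigma$ ($\sigma\in\mathfrak{S}_l$, $1\le l\le r$) and relations: the $\mathrm{T}_{s_i}$ satisfy the defining relations of $\mathbf{H}(\mathfrak{S}_r)$; for each $l$ and each $1\le i<l$, each of the two products $x^{(l)}_\sigma x^{(l)}_{s_i}$ and $x^{(l)}_\sigma \mathrm{T}_{s_i}$ equals $x^{(l)}_{\sigma s_i}$ if $\ell(\sigma s_i)=\ell(\sigma)+1$ and $x^{(l)}_{\sigma s_i}+(q^{-1}-q)x^{(l)}_\sigma$ if $\ell(\sigma s_i)=\ell(\sigma)-1$; each of the two products $x^{(l)}_{s_i}x^{(l)}_\sigma$ and $\mathrm{T}_{s_i}x^{(l)}_\sigma$ equals $x^{(l)}_{s_i\sigma}$ if $\ell(s_i\sigma)=\ell(\sigma)+1$ and $x^{(l)}_{s_i\sigma}+(q^{-1}-q)x^{(l)}_\sigma$ if $\ell(s_i\sigma)=\ell(\sigma)-1$; $\mathrm{T}_{s_i}x^{(l)}_\sigma=q^{-1}x^{(l)}_\sigma=x^{(l)}_\sigma\mathrm{T}_{s_i}$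 for $l<i\le r-1$; and $x^{(l)}_\sigma x^{(k)}_\gamma=0$ for $\sigma\in\mathfrak{S}_l$, $\gamma\in\mathfrak{S}_k$, $k\neq l$. Representation $\Xi$. For $I\subseteq\{1,\dots,r\}$ let $\underline{V}^{\otimes r}_I$ be the span of the $\eta_{j_1}\otimes\cdots\otimes\eta_{j_r}$ with $1\le j_k\le n$ for $k\in I$ and $j_k=n+1$ for $k\notin I$. Then $\underline{V}^{\otimes r}=\bigoplus_I\underline{V}^{\otimes r}_I$. Let $\underline{l}=\{1,\dots,l\}$, so $\underline{V}^{\otimes r}_{\underline{l}}=V^{\otimes l}\otimes\eta_{n+1}^{\otimes (r-l)}$. The representation $\Xi:\mathfrak{HH}_r\to\mathrm{End}_{\mathscr{A}}(\underline{V}^{\otimes r})$ sends $\mathrm{T}_{s_i}$ to $\Psi(T_{s_i})$, and sends $x^{(l)}_\sigma$ to the operator that equals $\Psi^V_l(T_\sigma)\otimes\mathrm{id}^{\otimes(r-l)}$ on $\underline{V}^{\otimes r}_{\underline{l}}$ and is $0$ on $\underline{V}^{\otimes r}_I$ for all $I\ne\underline{l}$. *)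

theory Defs
  imports
    "HOL-Algebra.Generated_Rings"
    "HOL-Combinatorics.Permutations"
    "HOL-Library.Poly_Mapping"
    "HOL-Library.FuncSet"
    "HOL-Computational_Algebra.Polynomial"
    "HOL-Computational_Algebra.Fraction_Field"
begin

section \<open>The ground field\<close>

text \<open>The field of rational functions over the rationals; its indeterminate \<open>qq\<close> is the
  transcendental parameter.\<close>

type_synonym Qq = "rat poly fract"

definition qq :: "Qq" where
  "qq = Fract [:0, 1:] 1"


section \<open>Algebras given by generators and relations\<close>

text \<open>The free monoid is a type of its own (rather than the type of lists), because the
  multiplication on \<^typ>\<open>'m \<Rightarrow>\<^sub>0 'k\<close> is the convolution product for an additively written
  monoid \<^typ>\<open>'m\<close>. Hence \<open>'g falg\<close> is the free associative algebra on \<^typ>\<open>'g\<close>.\<close>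

datatype 'g free_monoid = FM (letters: "'g list")

instantiation free_monoid :: (type) monoid_add
begin

definition zero_free_monoid :: "'a free_monoid" where
  "zero_free_monoid = FM []"

definition plus_free_monoid :: "'a free_monoid \<Rightarrow> 'a free_monoid \<Rightarrow> 'a free_monoid" where
  "plus_free_monoid u v = FM (letters u @ letters v)"

instance
  by standard (simp_all add: zero_free_monoid_def plus_free_monoid_def)

end

type_synonym 'g falg = "'g free_monoid \<Rightarrow>\<^sub>0 Qq"

definition gen :: "'g \<Rightarrow> 'g falg" where
  "gen g = Poly_Mapping.single (FM [g]) 1"

definition scal :: "Qq \<Rightarrow> 'g falg" where
  "scal c = Poly_Mapping.single 0 c"

text \<open>The free algebra on a set \<open>S\<close> of generators. A scalar \<open>c\<close> is embedded as \<open>scal c\<close>;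
  these elements are central, so ring ideals are the same as algebra ideals.\<close>

definition free_alg :: "'g set \<Rightarrow> 'g falg ring" where
  "free_alg S = \<lparr>carrier = {p. \<forall>w\<in>Poly_Mapping.keys p. set (letters w) \<subseteq> S},
     monoid.mult = (*), monoid.one = 1, ring.zero = 0, add = (+)\<rparr>"

text \<open>The algebra with generators \<open>S\<close> and relations \<open>p = 0\<close> for \<open>p \<in> R\<close>, and the class
  of an element of the free algebra in it.\<close>

definition pres_alg :: "'g set \<Rightarrow> 'g falg set \<Rightarrow> 'g falg set ring" where
  "pres_alg S R = free_alg S Quot (Idl\<^bsub>free_alg S\<^esub> R)"

definition pres_class :: "'g set \<Rightarrow> 'g falg set \<Rightarrow> 'g falg \<Rightarrow> 'g falg set" where
  "pres_class S R p = Idl\<^bsub>free_alg S\<^esub> R +>\<^bsub>free_alg S\<^esub> p"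


section \<open>Tensor powers and their endomorphisms\<close>

text \<open>A tensor is a finite linear combination of basis tensors
  \<open>Mb [j\<^sub>1, \<dots>, j\<^sub>m] = \<eta>\<^bsub>j\<^sub>1\<^esub> \<otimes> \<dots> \<otimes> \<eta>\<^bsub>j\<^sub>m\<^esub>\<close>. For a list \<open>f\<close>, the value \<open>f(i)\<close> is
  \<open>f ! (i - 1)\<close>.\<close>

type_synonym vec = "nat list \<Rightarrow>\<^sub>0 Qq"

definition Mb :: "nat list \<Rightarrow> vec" where
  "Mb f = Poly_Mapping.single f 1"

definition smul :: "Qq \<Rightarrow> vec \<Rightarrow> vec" where
  "smul c v = Poly_Mapping.map (\<lambda>x. c * x) v"

text \<open>The \<open>m\<close>-th tensor power of the space with basis \<open>\<eta>\<^sub>1, \<dots>, \<eta>\<^sub>N\<close>.\<close>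

definition tpow :: "nat \<Rightarrow> nat \<Rightarrow> vec set" where
  "tpow N m = {v. \<forall>f\<in>Poly_Mapping.keys v. length f = m \<and> set f \<subseteq> {1..N}}"

definition lin_ext :: "(nat list \<Rightarrow> vec) \<Rightarrow> vec \<Rightarrow> vec" where
  "lin_ext b v = (\<Sum>f\<in>Poly_Mapping.keys v. smul (Poly_Mapping.lookup v f) (b f))"

definition tensor :: "vec \<Rightarrow> vec \<Rightarrow> vec" where
  "tensor u v = lin_ext (\<lambda>f. lin_ext (\<lambda>g. Mb (f @ g)) v) u"

text \<open>The operator \<open>A \<otimes> B\<close>, the first tensor factor being the one of the first \<open>k\<close> places.\<close>

definition tensor_op :: "nat \<Rightarrow> (vec \<Rightarrow> vec) \<Rightarrow> (vec \<Rightarrow> vec) \<Rightarrow> vec \<Rightarrow> vec" where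
  "tensor_op k A B = lin_ext (\<lambda>f. tensor (A (Mb (take k f))) (B (Mb (drop k f))))"

text \<open>Endomorphisms of a subspace \<open>W\<close> are extensional functions (undefined outside \<open>W\<close>), so that
  equality of functions is equality of endomorphisms of \<open>W\<close>.\<close>

definition End :: "vec set \<Rightarrow> (vec \<Rightarrow> vec) set" where
  "End W = {A \<in> W \<rightarrow>\<^sub>E W. (\<forall>u\<in>W. \<forall>v\<in>W. A (u + v) = A u + A v) \<and>
                        (\<forall>c. \<forall>v\<in>W. A (smul c v) = smul c (A v))}"

text \<open>The endomorphisms of \<open>W\<close> commuting with the action \<open>\<rho>\<close> of all elements of \<open>Y\<close>.\<close>

definition End_over :: "vec set \<Rightarrow> ('x \<Rightarrow> vec \<Rightarrow> vec) \<Rightarrow> 'x set \<Rightarrow> (vec \<Rightarrow> vec) set" where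
  "End_over W \<rho> Y = {A \<in> End W. \<forall>y\<in>Y. \<forall>v\<in>W. A (\<rho> y v) = \<rho> y (A v)}"

text \<open>The operator on \<open>W\<close> by which an element of a free algebra acts if the generators act
  through \<open>\<rho>\<close>, and the resulting representation of a presented algebra, whose value at a class
  is the common value of \<open>free_rep W \<rho>\<close> at the members of that class.\<close>

definition free_rep :: "vec set \<Rightarrow> ('g \<Rightarrow> vec \<Rightarrow> vec) \<Rightarrow> 'g falg \<Rightarrow> vec \<Rightarrow> vec" where
  "free_rep W \<rho> p =
     (\<lambda>v\<in>W. \<Sum>w\<in>Poly_Mapping.keys p. smul (Poly_Mapping.lookup p w) (foldr \<rho> (letters w) v))"

definition pres_rep :: "vec set \<Rightarrow> ('g \<Rightarrow> vec \<Rightarrow> vec) \<Rightarrow> 'g falg set \<Rightarrow> vec \<Rightarrow> vec" where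
  "pres_rep W \<rho> C = the_elem (free_rep W \<rho> ` C)"


section \<open>The quantum group and its Levi subalgebra\<close>

text \<open>\<open>Hi a\<close> is the generator \<open>H\<^sub>a\<^sup>-\<^sup>1\<close>.\<close>

datatype ugen = E nat | F nat | H nat | Hi nat

definition ugens :: "nat \<Rightarrow> ugen set" where
  "ugens m = E ` {1..<m} \<union> F ` {1..<m} \<union> H ` {1..m} \<union> Hi ` {1..m}"

abbreviation "eE i \<equiv> gen (E i)"
abbreviation "eF i \<equiv> gen (F i)"
abbreviation "eH a \<equiv> gen (H a)"
abbreviation "eHi a \<equiv> gen (Hi a)"
abbreviation "eK i \<equiv> eH i * eHi (i + 1)"
abbreviation "eKi i \<equiv> eH (i + 1) * eHi i"

definition urels :: "nat \<Rightarrow> ugen falg set" where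
  "urels m =
     {eH a * eHi a - 1 | a. a \<in> {1..m}} \<union>
     {eHi a * eH a - 1 | a. a \<in> {1..m}} \<union>
     {eH a * eH b - eH b * eH a | a b. a \<in> {1..m} \<and> b \<in> {1..m}} \<union>
     {eH i * eE i * eHi i - scal qq * eE i | i. i \<in> {1..<m}} \<union>
     {eH i * eF i * eHi i - scal (inverse qq) * eF i | i. i \<in> {1..<m}} \<union>
     {eH (i + 1) * eE i * eHi (i + 1) - scal (inverse qq) * eE i | i. i \<in> {1..<m}} \<union>
     {eH (i + 1) * eF i * eHi (i + 1) - scal qq * eF i | i. i \<in> {1..<m}} \<union>
     {eH k * eE i * eHi k - eE i | i k. i \<in> {1..<m} \<and> k \<in> {1..m} - {i, i + 1}} \<union>
     {eH k * eF i * eHi k - eF i | i k. i \<in> {1..<m} \<and> k \<in> {1..m} - {i, i + 1}} \<union>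
     {eE i * eF i - eF i * eE i - scal (inverse (qq - inverse qq)) * (eK i - eKi i) | i.
        i \<in> {1..<m}} \<union>
     {eE i * eF j - eF j * eE i | i j. i \<in> {1..<m} \<and> j \<in> {1..<m} \<and> i \<noteq> j} \<union>
     {eE i * eE j - eE j * eE i | i j.
        i \<in> {1..<m} \<and> j \<in> {1..<m} \<and> \<bar>int i - int j\<bar> > 1} \<union>
     {eF i * eF j - eF j * eF i | i j.
        i \<in> {1..<m} \<and> j \<in> {1..<m} \<and> \<bar>int i - int j\<bar> > 1} \<union>
     {eE i ^ 2 * eE j - scal (qq + inverse qq) * eE i * eE j * eE i + eE j * eE i ^ 2 | i j.
        i \<in> {1..<m} \<and> j \<in> {1..<m} \<and> \<bar>int i - int j\<bar> = 1} \<union>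
     {eF i ^ 2 * eF j - scal (qq + inverse qq) * eF i * eF j * eF i + eF j * eF i ^ 2 | i j.
        i \<in> {1..<m} \<and> j \<in> {1..<m} \<and> \<bar>int i - int j\<bar> = 1}"

definition Uq :: "nat \<Rightarrow> ugen falg set ring" where
  "Uq m = pres_alg (ugens m) (urels m)"

definition Uq_class :: "nat \<Rightarrow> ugen falg \<Rightarrow> ugen falg set" where
  "Uq_class m p = pres_class (ugens m) (urels m) p"

text \<open>The unital subalgebra of \<open>Uq (n + 1)\<close> generated by the given elements: the subring
  generated by them and the scalars.\<close>

definition Levi :: "nat \<Rightarrow> ugen falg set set" where
  "Levi n = generate_ring (Uq (n + 1)) (Uq_class (n + 1) `
     (range scal \<union> eE ` {1..<n} \<union> eF ` {1..<n} \<union> eH ` {1..n + 1} \<union> eHi ` {1..n + 1}))"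

text \<open>The comultiplication on generators: the list of pairs \<open>(u, v)\<close> stands for the sum of the
  \<open>u \<otimes> v\<close>, where words \<open>u\<close>, \<open>v\<close> stand for products of generators.\<close>

fun comult :: "ugen \<Rightarrow> (ugen list \<times> ugen list) list" where
  "comult (E i) = [([], [E i]), ([E i], [H (i + 1), Hi i])]"
| "comult (F i) = [([F i], []), ([H i, Hi (i + 1)], [F i])]"
| "comult (H a) = [([H a], [H a])]"
| "comult (Hi a) = [([Hi a], [Hi a])]"

text \<open>The natural module, identified with the first tensor power; \<open>\<eta>\<^sub>j\<close> is \<open>Mb [j]\<close>.\<close>

fun nat_act :: "ugen \<Rightarrow> nat \<Rightarrow> vec" where
  "nat_act (E i) j = (if j = i + 1 then Mb [i] else 0)"
| "nat_act (F i) j = (if j = i then Mb [i + 1] else 0)"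
| "nat_act (H i) j = (if j = i then smul qq (Mb [i]) else Mb [j])"
| "nat_act (Hi i) j = (if j = i then smul (inverse qq) (Mb [i]) else Mb [j])"

definition nat_op :: "ugen \<Rightarrow> vec \<Rightarrow> vec" where
  "nat_op g = lin_ext (\<lambda>f. nat_act g (hd f))"

text \<open>\<open>tensor_act k g\<close> is the action of \<open>g\<close> on the tensor power with exponent \<open>k + 1\<close> by the
  \<open>k\<close>-fold iterated comultiplication.\<close>

primrec tensor_act :: "nat \<Rightarrow> ugen \<Rightarrow> vec \<Rightarrow> vec" where
  "tensor_act 0 = nat_op"
| "tensor_act (Suc k) = (\<lambda>g v. \<Sum>(u, w)\<leftarrow>comult g.
      tensor_op 1 (foldr nat_op u) (foldr (tensor_act k) w) v)"

text \<open>The representation of \<open>Uq (n + 1)\<close> on the \<open>r\<close>-th tensor power, for \<open>r \<ge> 1\<close>.\<close>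

definition Phi :: "nat \<Rightarrow> nat \<Rightarrow> ugen falg set \<Rightarrow> vec \<Rightarrow> vec" where
  "Phi n r = pres_rep (tpow (n + 1) r) (tensor_act (r - 1))"


section \<open>The Hecke algebra\<close>

text \<open>The symmetric group of degree \<open>l\<close> is \<^term>\<open>{\<sigma>. \<sigma> permutes {1..l}}\<close>, with composition of
  functions as product.\<close>

definition s_gen :: "nat \<Rightarrow> nat \<Rightarrow> nat" where
  "s_gen i = transpose i (i + 1)"

definition word_perm :: "nat list \<Rightarrow> nat \<Rightarrow> nat" where
  "word_perm w = foldr (\<lambda>i \<sigma>. s_gen i \<circ> \<sigma>) w id"

definition expressions :: "nat \<Rightarrow> (nat \<Rightarrow> nat) \<Rightarrow> nat list set" where
  "expressions l \<sigma> = {w. set w \<subseteq> {1..<l} \<and> word_perm w = \<sigma>}"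

definition perm_length :: "nat \<Rightarrow> (nat \<Rightarrow> nat) \<Rightarrow> nat" where
  "perm_length l \<sigma> = (LEAST k. \<exists>w\<in>expressions l \<sigma>. length w = k)"

definition reduced_expr :: "nat \<Rightarrow> (nat \<Rightarrow> nat) \<Rightarrow> nat list" where
  "reduced_expr l \<sigma> = (SOME w. w \<in> expressions l \<sigma> \<and> length w = perm_length l \<sigma>)"

text \<open>The Hecke relations of degree \<open>m\<close> for elements \<open>t 1, \<dots>, t (m - 1)\<close> of a free algebra.\<close>

definition hecke_rels :: "(nat \<Rightarrow> 'g falg) \<Rightarrow> nat \<Rightarrow> 'g falg set" where
  "hecke_rels t m =
     {(t i + scal qq) * (t i - scal (inverse qq)) | i. i \<in> {1..<m}} \<union>
     {t i * t (i + 1) * t i - t (i + 1) * t i * t (i + 1) | i. i \<in> {1..<m} \<and> i + 1 \<in> {1..<m}} \<union>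
     {t i * t j - t j * t i | i j. i \<in> {1..<m} \<and> j \<in> {1..<m} \<and> \<bar>int i - int j\<bar> > 1}"

text \<open>The generator \<open>i\<close> of the Hecke algebra is \<open>T\<^bsub>s\<^sub>i\<^esub>\<close>.\<close>

definition Hecke_class :: "nat \<Rightarrow> nat falg \<Rightarrow> nat falg set" where
  "Hecke_class m p = pres_class {1..<m} (hecke_rels gen m) p"

definition T_perm :: "nat \<Rightarrow> (nat \<Rightarrow> nat) \<Rightarrow> nat falg set" where
  "T_perm m \<sigma> = Hecke_class m (prod_list (map gen (reduced_expr m \<sigma>)))"

text \<open>The list \<open>permute_list (transpose (i - 1) i) f\<close> is \<open>f s\<^sub>i\<close>, the positions of a list being
  counted from \<open>0\<close>.\<close>

definition hecke_op :: "nat \<Rightarrow> vec \<Rightarrow> vec" where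
  "hecke_op i = lin_ext (\<lambda>f. let f' = permute_list (transpose (i - 1) i) f in
     if f ! (i - 1) < f ! i then Mb f'
     else if f ! (i - 1) > f ! i then Mb f' + smul (inverse qq - qq) (Mb f)
     else smul (inverse qq) (Mb f))"

text \<open>The representation of the Hecke algebra of degree \<open>m\<close> on the \<open>m\<close>-th tensor power of the
  \<open>N\<close>-dimensional space.\<close>

definition Psi :: "nat \<Rightarrow> nat \<Rightarrow> nat falg set \<Rightarrow> vec \<Rightarrow> vec" where
  "Psi N m = pres_rep (tpow N m) hecke_op"


section \<open>The duplex Hecke algebra\<close>

text \<open>\<open>XX l \<sigma>\<close> is the generator \<open>x\<^sup>(\<^sup>l\<^sup>)\<^sub>\<sigma>\<close>.\<close>

datatype dgen = TT nat | XX nat "nat \<Rightarrow> nat"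

definition dgens :: "nat \<Rightarrow> dgen set" where
  "dgens r = TT ` {1..<r} \<union> {XX l \<sigma> | l \<sigma>. l \<in> {1..r} \<and> \<sigma> permutes {1..l}}"

abbreviation "tt i \<equiv> gen (TT i)"
abbreviation "xx l \<sigma> \<equiv> gen (XX l \<sigma>)"

definition x_right :: "nat \<Rightarrow> (nat \<Rightarrow> nat) \<Rightarrow> nat \<Rightarrow> dgen falg" where
  "x_right l \<sigma> i =
     (if perm_length l (\<sigma> \<circ> s_gen i) = perm_length l \<sigma> + 1 then xx l (\<sigma> \<circ> s_gen i)
      else xx l (\<sigma> \<circ> s_gen i) + scal (inverse qq - qq) * xx l \<sigma>)"

definition x_left :: "nat \<Rightarrow> nat \<Rightarrow> (nat \<Rightarrow> nat) \<Rightarrow> dgen falg" where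
  "x_left l i \<sigma> =
     (if perm_length l (s_gen i \<circ> \<sigma>) = perm_length l \<sigma> + 1 then xx l (s_gen i \<circ> \<sigma>)
      else xx l (s_gen i \<circ> \<sigma>) + scal (inverse qq - qq) * xx l \<sigma>)"

definition drels :: "nat \<Rightarrow> dgen falg set" where
  "drels r =
     hecke_rels tt r \<union>
     (\<Union>l\<in>{1..r}. \<Union>\<sigma>\<in>{\<sigma>. \<sigma> permutes {1..l}}.
        (\<Union>i\<in>{1..<l}.
           {xx l \<sigma> * xx l (s_gen i) - x_right l \<sigma> i, xx l \<sigma> * tt i - x_right l \<sigma> i,
            xx l (s_gen i) * xx l \<sigma> - x_left l i \<sigma>, tt i * xx l \<sigma> - x_left l i \<sigma>}) \<union>
        (\<Union>i\<in>{l<..<r}.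
           {tt i * xx l \<sigma> - scal (inverse qq) * xx l \<sigma>,
            xx l \<sigma> * tt i - scal (inverse qq) * xx l \<sigma>})) \<union>
     {xx l \<sigma> * xx k \<gamma> | l k \<sigma> \<gamma>. l \<in> {1..r} \<and> k \<in> {1..r} \<and> k \<noteq> l \<and>
        \<sigma> permutes {1..l} \<and> \<gamma> permutes {1..k}}"

definition HH :: "nat \<Rightarrow> dgen falg set ring" where
  "HH r = pres_alg (dgens r) (drels r)"

text \<open>The set \<open>I\<close> for which the basis tensor \<open>Mb f\<close> lies in the summand indexed by \<open>I\<close>.\<close>

definition block :: "nat \<Rightarrow> nat list \<Rightarrow> nat set" where
  "block n f = {k \<in> {1..length f}. f ! (k - 1) \<le> n}"

fun duplex_op :: "nat \<Rightarrow> nat \<Rightarrow> dgen \<Rightarrow> vec \<Rightarrow> vec" where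
  "duplex_op n r (TT i) = Psi (n + 1) r (Hecke_class r (gen i))"
| "duplex_op n r (XX l \<sigma>) = lin_ext (\<lambda>f.
     if block n f = {1..l} then tensor_op l (Psi n l (T_perm l \<sigma>)) id (Mb f) else 0)"

definition Xi :: "nat \<Rightarrow> nat \<Rightarrow> dgen falg set \<Rightarrow> vec \<Rightarrow> vec" where
  "Xi n r = pres_rep (tpow (n + 1) r) (duplex_op n r)"

definition duplex_image :: "nat \<Rightarrow> nat \<Rightarrow> (vec \<Rightarrow> vec) set" where
  "duplex_image n r = Xi n r ` carrier (HH r)"

end

theory Submission
  imports Defs
begin

text \<open>The image of the Levi quantum group visibly commutes with the duplex Hecke algebra. The field
  \<open>\<rat>(q)\<close> can be ordered, so \<open>tr (X\<^sup>T Y)\<close> is positive definite over it and orthogonal projections onto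
  spaces of matrices exist. Suppose that a matrix \<open>X\<close> commutes with the duplex Hecke algebra but is
  not in the image of the Levi quantum group. Subtracting its projection and rescaling, one may assume
  that \<open>X\<close> is orthogonal to that image, regular at \<open>q = 1\<close> and nonzero there. At \<open>q = 1\<close> it becomes a
  symmetric tensor over the block diagonal matrices \<open>gl\<^sub>n \<times> gl\<^sub>1\<close>. The specializations of \<open>E\<^sub>i\<close>, \<open>F\<^sub>i\<close>
  and \<open>(H\<^sub>a - 1) / (q - 1)\<close> generate all such tensors, so \<open>X\<close> is orthogonal to itself at \<open>q = 1\<close>, a
  contradiction. This is the first equality; the second one follows from the double commutant theorem
  for the transposition-closed duplex Hecke algebra.\<close>

section \<open>Linear operators on tensors\<close>

text \<open>Projecting replaces a comparison of dimensions: neither semisimplicity of the images nor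
  semicontinuity of their dimensions under specialization enters. A single matrix orthogonal to the
  Levi image is rescaled and sent to q = 1, and its orthogonality to every member of that image that
  is regular at q = 1 survives. The order on the field comes from the sign of leading coefficients
  of rational polynomials. Since H_a itself becomes the identity at q = 1, the quotient (H_a - 1) /
  (q - 1) has to take its place; its eigenvalues tend to the weights. The duplex Hecke algebra
  contains projections only onto the summands with I = {1, ..., l} and l \<ge> 1. This still forces
  block diagonality at q = 1: there the T_(s_i) act as place permutations, so the index pairs of an
  entry can be sorted until one side has the shape {1, ..., l}. Closure under transposition holds
  because, in the basis \<open>Mb f\<close>, the T_(s_i) have symmetric matrices and the projections
  diagonal ones.\<close>

abbreviation lookup :: "('a \<Rightarrow>\<^sub>0 'b::zero) \<Rightarrow> 'a \<Rightarrow> 'b" where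
  "lookup \<equiv> Poly_Mapping.lookup"

abbreviation keys :: "('a \<Rightarrow>\<^sub>0 'b::zero) \<Rightarrow> 'a set" where
  "keys \<equiv> Poly_Mapping.keys"

lemma lookup_smul [simp]: "lookup (smul c v) f = c * lookup v f"
  unfolding smul_def by (simp add: Poly_Mapping.map.rep_eq when_def)

interpretation vec: vector_space smul
  by unfold_locales (auto intro!: poly_mapping_eqI simp: lookup_add algebra_simps)

lemma lookup_Mb: "lookup (Mb f) g = (if f = g then 1 else 0)"
  by (simp add: Mb_def lookup_single when_def)

text \<open>Linearity on the space of all finitely supported tensors, of every length. Operators are
  kept total and linear and are restricted to a tensor power only when members of \<open>End\<close>
  are formed.\<close>

definition lin :: "(vec \<Rightarrow> vec) \<Rightarrow> bool" where
  "lin A \<longleftrightarrow> (\<forall>u v. A (u + v) = A u + A v) \<and> (\<forall>c v. A (smul c v) = smul c (A v))"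

lemma lin_add: "lin A \<Longrightarrow> A (u + v) = A u + A v"
  and lin_smul: "lin A \<Longrightarrow> A (smul c v) = smul c (A v)"
  by (auto simp: lin_def)

lemma lin_zero: "lin A \<Longrightarrow> A 0 = 0"
  using lin_smul[of A 0 0] by simp

lemma lin_minus: "lin A \<Longrightarrow> A (- v) = - A v"
  using lin_smul[of A "-1" v] by simp

lemma lin_diff: "lin A \<Longrightarrow> A (u - v) = A u - A v"
  using lin_add[of A u "-v"] lin_minus[of A v] by simp

lemma lin_sum: "lin A \<Longrightarrow> A (sum h I) = (\<Sum>i\<in>I. A (h i))"
  by (induction I rule: infinite_finite_induct) (auto simp: lin_zero lin_add)

lemmas lin_simps = lin_add lin_smul lin_zero lin_minus lin_diff

lemma vec_expand:
  assumes "finite S" "keys v \<subseteq> S"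
  shows "v = (\<Sum>f\<in>S. smul (lookup v f) (Mb f))"
proof (rule poly_mapping_eqI)
  fix k
  have "(\<Sum>f\<in>S. lookup v f * (if f = k then 1 else 0))
      = (if k \<in> S then lookup v k else 0)"
    using assms(1) by (simp add: if_distrib cong: if_cong)
  also have "\<dots> = lookup v k"
    using assms(2) by (auto simp: in_keys_iff)
  finally show "lookup v k
      = lookup (\<Sum>f\<in>S. smul (lookup v f) (Mb f)) k"
    by (simp add: lookup_sum lookup_Mb)
qed

lemma lin_ext_superset:
  assumes "finite S" "keys v \<subseteq> S"
  shows "lin_ext b v = (\<Sum>f\<in>S. smul (lookup v f) (b f))"
  unfolding lin_ext_def using assms
  by (intro sum.mono_neutral_left) (auto simp: in_keys_iff)

lemma lin_lin_ext [simp]: "lin (lin_ext b)"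
proof -
  have "lin_ext b (u + v) = lin_ext b u + lin_ext b v" for u v
  proof -
    let ?S = "keys u \<union> keys v"
    have "keys (u + v) \<subseteq> ?S" by (rule Poly_Mapping.keys_add)
    then show ?thesis
      by (simp add: lin_ext_superset[of ?S] lookup_add vec.scale_left_distrib sum.distrib)
  qed
  moreover have "lin_ext b (smul c v) = smul c (lin_ext b v)" for c v
  proof -
    have "keys (smul c v) \<subseteq> keys v" by (auto simp: in_keys_iff)
    then show ?thesis
      by (simp add: lin_ext_superset[of "keys v"] vec.scale_sum_right)
  qed
  ultimately show ?thesis by (simp add: lin_def)
qed

lemma lin_ext_Mb [simp]: "lin_ext b (Mb f) = b f"
  by (simp add: lin_ext_superset[of "{f}"] lookup_Mb Mb_def)

lemma lin_id [simp]: "lin (\<lambda>v. v)" "lin id"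
  by (auto simp: lin_def)

lemma lin_comp: "lin A \<Longrightarrow> lin A' \<Longrightarrow> lin (\<lambda>v. A (A' v))"
  by (simp add: lin_def)

lemma lin_plus: "lin A \<Longrightarrow> lin A' \<Longrightarrow> lin (\<lambda>v. A v + A' v)"
  by (simp add: lin_def vec.scale_right_distrib)

lemma lin_scale: "lin A \<Longrightarrow> lin (\<lambda>v. smul c (A v))"
  by (simp add: lin_def vec.scale_right_distrib mult.commute)

lemma lin_sum': "(\<And>i. i \<in> I \<Longrightarrow> lin (A i)) \<Longrightarrow> lin (\<lambda>v. \<Sum>i\<in>I. A i v)"
  by (simp add: lin_def sum.distrib vec.scale_sum_right)

lemma lin_foldr: "(\<And>i. lin (A i)) \<Longrightarrow> lin (foldr A w)"
  by (induction w) (auto simp: lin_def id_def)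

lemma lin_eq_on:
  assumes "lin A" "lin A'" "\<And>f. f \<in> keys v \<Longrightarrow> A (Mb f) = A' (Mb f)"
  shows "A v = A' v"
proof -
  let ?S = "keys v"
  let ?v = "\<Sum>f\<in>?S. smul (lookup v f) (Mb f)"
  have v: "v = ?v" by (rule vec_expand) auto
  have "A ?v = A' ?v"
    using assms by (simp add: lin_sum lin_smul)
  with v show ?thesis by metis
qed

lemma lin_eqI:
  assumes "lin A" "lin A'" "\<And>f. A (Mb f) = A' (Mb f)"
  shows "A v = A' v"
  using lin_eq_on assms by blast

text \<open>Tensoring with \<eta>_a on the left. Most identities between operators are proved by
  induction on the number of tensor factors, with rules that move an operator past
  \<open>cons\<close>.\<close>

definition cons :: "nat \<Rightarrow> vec \<Rightarrow> vec" where
  "cons a = lin_ext (\<lambda>f. Mb (a # f))"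

lemma lin_cons [simp]: "lin (cons a)"
  by (simp add: cons_def)

lemma cons_Mb [simp]: "cons a (Mb f) = Mb (a # f)"
  by (simp add: cons_def)

lemmas cons_lin [simp] = lin_simps[OF lin_cons]

lemma lookup_cons: "lookup (cons a v) (b # f) = (if a = b then lookup v f else 0)"
proof -
  have "lookup (cons a v) g = (\<Sum>f\<in>keys v. lookup v f * (if a # f = g then 1 else 0))" for g
    by (simp add: cons_def lin_ext_def lookup_sum lookup_Mb)
  then show "lookup (cons a v) (b # f) = (if a = b then lookup v f else 0)"
    by (auto simp: if_distrib in_keys_iff cong: if_cong)
qed

text \<open>Induction on the basis tensor. The step speaks of \<open>cons a (Mb f)\<close> and not
  of \<open>Mb (a # f)\<close>, since this is the form to which the rules for operators apply; hence
  \<open>cons_Mb\<close> is switched off in its uses.\<close>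

lemma lin_eqI_cons:
  assumes "lin A" "lin A'" "A (Mb []) = A' (Mb [])"
    and "\<And>a f. A (Mb f) = A' (Mb f) \<Longrightarrow> A (cons a (Mb f)) = A' (cons a (Mb f))"
  shows "A v = A' v"
proof (rule lin_eqI[OF assms(1,2)])
  show "A (Mb f) = A' (Mb f)" for f
    using assms(3,4) by (induction f) auto
qed

section \<open>Tensor powers and their bases\<close>

definition bas :: "nat \<Rightarrow> nat \<Rightarrow> nat list set" where
  "bas N m = {f. length f = m \<and> set f \<subseteq> {1..N}}"

lemma finite_bas [simp]: "finite (bas N m)"
  using finite_lists_length_eq[of "{1..N}" m] by (auto simp: bas_def conj_commute)

lemma tpow_bas: "v \<in> tpow N m \<longleftrightarrow> keys v \<subseteq> bas N m"
  by (auto simp: tpow_def bas_def)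

lemma Mb_tpow [simp]: "Mb f \<in> tpow N m \<longleftrightarrow> f \<in> bas N m"
  by (auto simp: tpow_bas Mb_def)

lemma tpow_zero [simp]: "0 \<in> tpow N m"
  by (simp add: tpow_bas)

lemma tpow_add: "u \<in> tpow N m \<Longrightarrow> v \<in> tpow N m \<Longrightarrow> u + v \<in> tpow N m"
  unfolding tpow_bas by (rule order_trans[OF Poly_Mapping.keys_add Un_least])

lemma tpow_smul: "v \<in> tpow N m \<Longrightarrow> smul c v \<in> tpow N m"
  unfolding tpow_bas by (auto simp: in_keys_iff)

lemma tpow_sum: "(\<And>i. i \<in> I \<Longrightarrow> h i \<in> tpow N m) \<Longrightarrow> sum h I \<in> tpow N m"
  by (induction I rule: infinite_finite_induct) (auto intro: tpow_add)

lemma lin_tpow: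
  assumes "lin A" "\<And>f. f \<in> bas N m \<Longrightarrow> A (Mb f) \<in> tpow N m'" "v \<in> tpow N m"
  shows "A v \<in> tpow N m'"
proof -
  let ?S = "keys v"
  let ?v = "\<Sum>f\<in>?S. smul (lookup v f) (Mb f)"
  have v: "v = ?v" by (rule vec_expand) auto
  have "A ?v \<in> tpow N m'"
    using assms(2,3) by (auto simp: lin_sum[OF assms(1)] lin_smul[OF assms(1)] tpow_bas[of v]
        intro!: tpow_sum tpow_smul)
  then show ?thesis by (simp only: v[symmetric])
qed

lemma lin_eq_tpow:
  assumes "lin A" "lin A'" "\<And>f. f \<in> bas N m \<Longrightarrow> A (Mb f) = A' (Mb f)" "v \<in> tpow N m"
  shows "A v = A' v"
  using lin_eq_on[OF assms(1,2)] assms(3,4) by (auto simp: tpow_bas)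

lemma bas_Cons [simp]: "a # f \<in> bas N (Suc m) \<longleftrightarrow> a \<in> {1..N} \<and> f \<in> bas N m"
  by (auto simp: bas_def)

lemma cons_tpow: "v \<in> tpow N m \<Longrightarrow> a \<in> {1..N} \<Longrightarrow> cons a v \<in> tpow N (Suc m)"
  by (rule lin_tpow[of _ N m]) auto

lemma bas_Suc: "bas N (Suc m) = (\<lambda>(a, f). a # f) ` ({1..N} \<times> bas N m)"
  by (auto simp: bas_def image_iff length_Suc_conv)

lemma sum_bas_Suc: "(\<Sum>f\<in>bas N (Suc m). h f) = (\<Sum>a\<in>{1..N}. \<Sum>f\<in>bas N m. h (a # f))"
  unfolding bas_Suc by (subst sum.reindex) (auto simp: inj_on_def sum.cartesian_product case_prod_unfold)

lemma bas_0: "bas N 0 = {[]}"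
  by (auto simp: bas_def)

section \<open>Representations of presented algebras\<close>

text \<open>The same sum as in \<open>free_rep\<close>, but not cut down to a subspace, so that
  additivity and multiplicativity hold for all tensors.\<close>

definition frep :: "('g \<Rightarrow> vec \<Rightarrow> vec) \<Rightarrow> 'g falg \<Rightarrow> vec \<Rightarrow> vec" where
  "frep \<rho> p v = (\<Sum>w\<in>keys p. smul (lookup p w) (foldr \<rho> (letters w) v))"

lemma frep_superset:
  assumes "finite T" "keys p \<subseteq> T"
  shows "frep \<rho> p v = (\<Sum>w\<in>T. smul (lookup p w) (foldr \<rho> (letters w) v))"
  unfolding frep_def using assms by (intro sum.mono_neutral_left) (auto simp: in_keys_iff)

lemma frep_add: "frep \<rho> (p + q) v = frep \<rho> p v + frep \<rho> q v"
proof -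
  let ?T = "keys p \<union> keys q"
  have "keys (p + q) \<subseteq> ?T" by (rule Poly_Mapping.keys_add)
  then show ?thesis
    by (simp add: frep_superset[of ?T] lookup_add vec.scale_left_distrib sum.distrib)
qed

lemma frep_zero [simp]: "frep \<rho> 0 v = 0"
  by (simp add: frep_def)

lemma frep_uminus: "frep \<rho> (- p) v = - frep \<rho> p v"
  using frep_add[of \<rho> p "-p" v] by (simp add: eq_neg_iff_add_eq_0 add.commute)

lemma frep_diff: "frep \<rho> (p - q) v = frep \<rho> p v - frep \<rho> q v"
  using frep_add[of \<rho> p "-q" v] by (simp add: frep_uminus)

lemma frep_single: "frep \<rho> (Poly_Mapping.single w c) v = smul c (foldr \<rho> (letters w) v)"
  by (simp add: frep_superset[of "{w}"])

lemma frep_one [simp]: "frep \<rho> 1 v = v"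
proof -
  have "letters (0 :: 'a free_monoid) = []" by (simp add: zero_free_monoid_def)
  then show ?thesis by (simp add: frep_def)
qed

lemma frep_gen [simp]: "frep \<rho> (gen g) v = \<rho> g v"
  by (simp add: gen_def frep_single)

lemma frep_scal [simp]: "frep \<rho> (scal c) v = smul c v"
  by (simp add: scal_def frep_single zero_free_monoid_def)

lemma frep_lin: "(\<And>g. lin (\<rho> g)) \<Longrightarrow> lin (frep \<rho> p)"
  unfolding frep_def by (intro lin_sum' lin_scale lin_foldr)

lemma poly_mapping_single_induct [case_names zero single add]:
  assumes "P 0" "\<And>k c. P (Poly_Mapping.single k c)" "\<And>p q. P p \<Longrightarrow> P q \<Longrightarrow> P (p + q)"
  shows "P p"
proof (induction p rule: update_induct)
  case (update f a b)
  then have "Poly_Mapping.update a b f = f + Poly_Mapping.single a b"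
    by (intro poly_mapping_eqI)
       (auto simp: lookup_update lookup_add lookup_single when_def in_keys_iff)
  with update assms show ?case by simp
qed (use assms in simp)

text \<open>On words the product is concatenation, which \<open>foldr\<close> turns into
  composition; the rest is bilinearity, and there the linearity of the generators enters.\<close>

lemma frep_mult:
  assumes "\<And>g. lin (\<rho> g)"
  shows "frep \<rho> (p * q) v = frep \<rho> p (frep \<rho> q v)"
proof (induction p rule: poly_mapping_single_induct)
  case (single u c)
  note L = lin_foldr[of \<rho> "letters u", OF assms]
  show ?case
  proof (induction q rule: poly_mapping_single_induct)
    case (single w d)
    then show ?case
      by (simp add: mult_single frep_single plus_free_monoid_def lin_smul[OF L])
  next
    case (add q q')
    then show ?case
      by (simp add: ring_distribs frep_add frep_single lin_add[OF L] vec.scale_right_distrib)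
  qed (simp add: frep_single lin_zero[OF L])
next
  case (add p p')
  then show ?case by (simp add: ring_distribs frep_add)
qed simp

lemma frep_power2: "(\<And>g. lin (\<rho> g)) \<Longrightarrow> frep \<rho> (p ^ 2) v = frep \<rho> p (frep \<rho> p v)"
  by (simp add: power2_eq_square frep_mult)

lemmas frep_simps = frep_add frep_diff frep_uminus frep_mult frep_power2

section \<open>The free algebra as a ring, and presented algebras acting on a tensor power\<close>

lemma free_alg_simps [simp]:
  "monoid.mult (free_alg S) = (*)" "monoid.one (free_alg S) = 1"
  "ring.zero (free_alg S) = 0" "ring.add (free_alg S) = (+)"
  by (simp_all add: free_alg_def)

lemma carrier_free_alg: "p \<in> carrier (free_alg S) \<longleftrightarrow> (\<forall>w\<in>keys p. set (letters w) \<subseteq> S)"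
  by (simp add: free_alg_def)

lemma carrier_free_alg_intros:
  shows "0 \<in> carrier (free_alg S)" "1 \<in> carrier (free_alg S)" "scal c \<in> carrier (free_alg S)"
    and "g \<in> S \<Longrightarrow> gen g \<in> carrier (free_alg S)"
    and "p \<in> carrier (free_alg S) \<Longrightarrow> q \<in> carrier (free_alg S) \<Longrightarrow> p + q \<in> carrier (free_alg S)"
    and "p \<in> carrier (free_alg S) \<Longrightarrow> - p \<in> carrier (free_alg S)"
    and "p \<in> carrier (free_alg S) \<Longrightarrow> q \<in> carrier (free_alg S) \<Longrightarrow> p * q \<in> carrier (free_alg S)"
    and "p \<in> carrier (free_alg S) \<Longrightarrow> q \<in> carrier (free_alg S) \<Longrightarrow> p - q \<in> carrier (free_alg S)"
    and "p \<in> carrier (free_alg S) \<Longrightarrow> p ^ k \<in> carrier (free_alg S)"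
proof -
  show one: "1 \<in> carrier (free_alg S)"
    by (simp add: carrier_free_alg zero_free_monoid_def)
  show plus: "p + q \<in> carrier (free_alg S)"
    if "p \<in> carrier (free_alg S)" "q \<in> carrier (free_alg S)" for p q :: "'a falg"
    using that Poly_Mapping.keys_add[of p q] unfolding carrier_free_alg by blast
  show um: "- p \<in> carrier (free_alg S)" if "p \<in> carrier (free_alg S)" for p :: "'a falg"
    using that by (simp add: carrier_free_alg in_keys_iff)
  show "p - q \<in> carrier (free_alg S)"
    if "p \<in> carrier (free_alg S)" "q \<in> carrier (free_alg S)" for p q :: "'a falg"
    using plus[OF that(1) um[OF that(2)]] by simp
  show times: "p * q \<in> carrier (free_alg S)"
    if "p \<in> carrier (free_alg S)" "q \<in> carrier (free_alg S)" for p q :: "'a falg"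
  proof -
    have "set (letters w) \<subseteq> S" if w: "w \<in> keys (p * q)" for w
    proof -
      obtain a b where ab: "w = a + b" "a \<in> keys p" "b \<in> keys q"
        using w Poly_Mapping.keys_mult[of p q] by blast
      then show ?thesis
        using that(1) \<open>p \<in> carrier (free_alg S)\<close> \<open>q \<in> carrier (free_alg S)\<close>
        by (auto simp: carrier_free_alg plus_free_monoid_def)
    qed
    then show ?thesis by (simp add: carrier_free_alg)
  qed
  show "p ^ k \<in> carrier (free_alg S)" if "p \<in> carrier (free_alg S)" for p :: "'a falg"
    using that one times by (induction k) auto
qed (auto simp: carrier_free_alg scal_def gen_def zero_free_monoid_def)

lemma ring_free_alg: "ring (free_alg S)"
proof (rule ringI)
  show "abelian_group (free_alg S)"
  proof (rule abelian_groupI)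
    fix x assume "x \<in> carrier (free_alg S)"
    then show "\<exists>y\<in>carrier (free_alg S). y \<oplus>\<^bsub>free_alg S\<^esub> x = \<zero>\<^bsub>free_alg S\<^esub>"
      using carrier_free_alg_intros(6) by (intro bexI[of _ "-x"]) auto
  qed (auto simp: carrier_free_alg_intros add_ac)
  show "monoid (free_alg S)"
    by (rule monoidI) (auto simp: carrier_free_alg_intros mult.assoc)
qed (auto simp: algebra_simps)

text \<open>Two actions of the generators: \<open>\<rho>\<close> is the given one, controlled only
  on \<open>tpow N m\<close>, and \<open>\<rho>'\<close> is a globally linear substitute that agrees
  with it there. The relations are then verified for \<open>\<rho>'\<close>.\<close>

locale presented_rep =
  fixes S :: "'g set" and R :: "'g falg set" and N m :: nat
    and \<rho> \<rho>' :: "'g \<Rightarrow> vec \<Rightarrow> vec"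
  assumes lin: "lin (\<rho>' g)"
    and closed: "g \<in> S \<Longrightarrow> v \<in> tpow N m \<Longrightarrow> \<rho>' g v \<in> tpow N m"
    and agree: "g \<in> S \<Longrightarrow> v \<in> tpow N m \<Longrightarrow> \<rho> g v = \<rho>' g v"
    and rels_carrier: "R \<subseteq> carrier (free_alg S)"
    and rels_zero: "p \<in> R \<Longrightarrow> v \<in> tpow N m \<Longrightarrow> frep \<rho>' p v = 0"
begin

lemma foldr_agree:
  "set w \<subseteq> S \<Longrightarrow> v \<in> tpow N m \<Longrightarrow> foldr \<rho>' w v \<in> tpow N m \<and> foldr \<rho> w v = foldr \<rho>' w v"
  by (induction w) (auto simp: closed agree)

lemma frep_closed:
  assumes "p \<in> carrier (free_alg S)" "v \<in> tpow N m"
  shows "frep \<rho>' p v \<in> tpow N m"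
  using assms unfolding frep_def
  by (intro tpow_sum tpow_smul) (auto simp: carrier_free_alg foldr_agree)

lemma free_rep_eq: "p \<in> carrier (free_alg S) \<Longrightarrow> free_rep (tpow N m) \<rho> p = restrict (frep \<rho>' p) (tpow N m)"
  unfolding free_rep_def frep_def
  by (intro ext) (auto simp: restrict_def carrier_free_alg foldr_agree intro!: sum.cong)

text \<open>An ideal that contains \<open>R\<close> contains the ideal generated by
  \<open>R\<close>; this is why congruent elements act by the same operator.\<close>

lemma ideal_annihilator:
  "ideal {p \<in> carrier (free_alg S). \<forall>v\<in>tpow N m. frep \<rho>' p v = 0} (free_alg S)"
proof -
  interpret ring "free_alg S" by (rule ring_free_alg)
  have inv_eq: "\<ominus>\<^bsub>free_alg S\<^esub> x = - x" if "x \<in> carrier (free_alg S)" for x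
    using that minus_equality[of "-x" x] carrier_free_alg_intros(6) by auto
  show ?thesis
  proof (rule idealI[OF ring_axioms])
    show "subgroup {p \<in> carrier (free_alg S). \<forall>v\<in>tpow N m. frep \<rho>' p v = 0} (add_monoid (free_alg S))"
      by (rule add.subgroupI)
         (auto simp: carrier_free_alg_intros frep_add frep_uminus inv_eq a_inv_def[symmetric]
           intro!: exI[of _ 0])
  qed (auto simp: carrier_free_alg_intros frep_mult[OF lin] frep_closed lin_zero[OF frep_lin[of \<rho>', OF lin]])
qed

lemma pres_rep_class:
  assumes "p \<in> carrier (free_alg S)"
  shows "pres_rep (tpow N m) \<rho> (pres_class S R p) = restrict (frep \<rho>' p) (tpow N m)"
proof -
  interpret ring "free_alg S" by (rule ring_free_alg)
  let ?I = "Idl\<^bsub>free_alg S\<^esub> R"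
  interpret I: ideal ?I "free_alg S"
    by (rule genideal_ideal) (rule rels_carrier)
  have sub: "?I \<subseteq> {p \<in> carrier (free_alg S). \<forall>v\<in>tpow N m. frep \<rho>' p v = 0}"
    using rels_carrier rels_zero by (intro genideal_minimal ideal_annihilator) auto
  have "free_rep (tpow N m) \<rho> x = restrict (frep \<rho>' p) (tpow N m)" if "x \<in> pres_class S R p" for x
  proof -
    from that obtain i where i: "i \<in> ?I" "x = i + p"
      by (auto simp: pres_class_def a_r_coset_def')
    then have "x \<in> carrier (free_alg S)"
      using assms sub by (auto intro: carrier_free_alg_intros)
    then show ?thesis
      using i sub by (auto simp: free_rep_eq frep_add fun_eq_iff restrict_def)
  qed
  \<comment> \<open>The class is inhabited and the operator is constant on it, so the image is a
    singleton, as \<open>the_elem\<close> requires.\<close>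
  moreover have "p \<in> pres_class S R p"
    unfolding pres_class_def using I.a_rcos_self[OF assms] .
  ultimately have "free_rep (tpow N m) \<rho> ` pres_class S R p = {restrict (frep \<rho>' p) (tpow N m)}"
    by (auto simp: image_iff intro!: bexI[of _ p])
  then show ?thesis by (simp add: pres_rep_def)
qed

lemma pres_class_hom: "pres_class S R \<in> ring_hom (free_alg S) (pres_alg S R)"
proof -
  interpret ring "free_alg S" by (rule ring_free_alg)
  interpret I: ideal "Idl\<^bsub>free_alg S\<^esub> R" "free_alg S"
    by (rule genideal_ideal) (rule rels_carrier)
  show ?thesis
    using I.rcos_ring_hom unfolding pres_class_def pres_alg_def by (simp add: fun_eq_iff[symmetric])
qed

lemma ring_pres_alg: "ring (pres_alg S R)"
proof -
  interpret ring "free_alg S" by (rule ring_free_alg)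
  interpret I: ideal "Idl\<^bsub>free_alg S\<^esub> R" "free_alg S"
    by (rule genideal_ideal) (rule rels_carrier)
  show ?thesis
    unfolding pres_alg_def by (rule I.quotient_is_ring)
qed

lemma carrier_pres_alg: "carrier (pres_alg S R) = pres_class S R ` carrier (free_alg S)"
  unfolding pres_alg_def pres_class_def by (auto simp: FactRing_def A_RCOSETS_def')

lemma pres_class_ops:
  assumes "p \<in> carrier (free_alg S)" "q \<in> carrier (free_alg S)"
  shows "pres_class S R p \<otimes>\<^bsub>pres_alg S R\<^esub> pres_class S R q = pres_class S R (p * q)"
    and "pres_class S R p \<oplus>\<^bsub>pres_alg S R\<^esub> pres_class S R q = pres_class S R (p + q)"
    and "\<ominus>\<^bsub>pres_alg S R\<^esub> pres_class S R p = pres_class S R (- p)"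
    and "\<one>\<^bsub>pres_alg S R\<^esub> = pres_class S R 1"
proof -
  note h = pres_class_hom
  show "pres_class S R p \<otimes>\<^bsub>pres_alg S R\<^esub> pres_class S R q = pres_class S R (p * q)"
    using ring_hom_mult[OF h assms] by simp
  show plus: "pres_class S R p \<oplus>\<^bsub>pres_alg S R\<^esub> pres_class S R q = pres_class S R (p + q)"
    using ring_hom_add[OF h assms] by simp
  show "\<one>\<^bsub>pres_alg S R\<^esub> = pres_class S R 1"
    using ring_hom_one[OF h] by simp
  interpret A: ring "pres_alg S R" by (rule ring_pres_alg)
  have mp: "- p \<in> carrier (free_alg S)" using assms(1) by (rule carrier_free_alg_intros(6))
  have cl: "pres_class S R p \<in> carrier (pres_alg S R)" "pres_class S R (- p) \<in> carrier (pres_alg S R)"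
    using ring_hom_closed[OF h] assms mp by auto
  have z: "pres_class S R 0 = \<zero>\<^bsub>pres_alg S R\<^esub>"
    using ring_hom_zero[OF h ring_free_alg ring_pres_alg] by simp
  have "pres_class S R (- p) \<oplus>\<^bsub>pres_alg S R\<^esub> pres_class S R p = \<zero>\<^bsub>pres_alg S R\<^esub>"
    using ring_hom_add[OF h mp assms(1)] z by simp
  then show "\<ominus>\<^bsub>pres_alg S R\<^esub> pres_class S R p = pres_class S R (- p)"
    using A.minus_equality cl by blast
qed

end

section \<open>The quantum group on tensor powers\<close>

lemma qq_nonzero [simp]: "qq \<noteq> 0"
  by (simp add: qq_def Zero_fract_def eq_fract)

lemma qq_square [simp]: "qq * qq \<noteq> 1"
  by (simp add: qq_def One_fract_def eq_fract one_pCons)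

text \<open>H_a is group-like, so its eigenvalues on the tensor factors multiply: one q for each
  occurrence of \<eta>_a.\<close>

definition hop :: "nat \<Rightarrow> vec \<Rightarrow> vec" where
  "hop a = lin_ext (\<lambda>f. smul (qq ^ count_list f a) (Mb f))"

definition hiop :: "nat \<Rightarrow> vec \<Rightarrow> vec" where
  "hiop a = lin_ext (\<lambda>f. smul (inverse qq ^ count_list f a) (Mb f))"

abbreviation "kop i v \<equiv> hop i (hiop (Suc i) v)"
abbreviation "kiop i v \<equiv> hop (Suc i) (hiop i v)"

text \<open>The comultiplication 1 \<otimes> E_i + E_i \<otimes> K_i^-1, split off at the first
  factor \<eta>_a; E_i \<eta>_a is nonzero only for a = i + 1.\<close>

primrec eB :: "nat \<Rightarrow> nat list \<Rightarrow> vec" where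
  "eB i [] = 0"
| "eB i (a # f) = cons a (eB i f) + (if a = Suc i then cons i (kiop i (Mb f)) else 0)"

text \<open>Likewise for F_i \<otimes> 1 + K_i \<otimes> F_i; the scalar is the eigenvalue of K_i on
  \<eta>_a.\<close>

primrec fB :: "nat \<Rightarrow> nat list \<Rightarrow> vec" where
  "fB i [] = 0"
| "fB i (a # f) = (if a = i then Mb (Suc i # f) else 0) +
     smul (if a = i then qq else if a = Suc i then inverse qq else 1) (cons a (fB i f))"

definition "eop i = lin_ext (eB i)"
definition "fop i = lin_ext (fB i)"

lemma lin_uops [simp]: "lin (hop a)" "lin (hiop a)" "lin (eop i)" "lin (fop i)"
  by (simp_all add: hop_def hiop_def eop_def fop_def)

lemmas uops_lin [simp] = lin_uops[THEN lin_add] lin_uops[THEN lin_smul] lin_uops[THEN lin_zero]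
  lin_uops[THEN lin_minus] lin_uops[THEN lin_diff]

lemma uops_Nil [simp]: "hop a (Mb []) = Mb []" "hiop a (Mb []) = Mb []" "eop i (Mb []) = 0" "fop i (Mb []) = 0"
  by (simp_all add: hop_def hiop_def eop_def fop_def)

lemmas vec_norm = vec.scale_right_distrib vec.scale_right_diff_distrib

lemma hop_Mb: "hop a (Mb f) = smul (qq ^ count_list f a) (Mb f)"
  and hiop_Mb: "hiop a (Mb f) = smul (inverse qq ^ count_list f a) (Mb f)"
  and eop_Mb: "eop i (Mb f) = eB i f"
  and fop_Mb: "fop i (Mb f) = fB i f"
  by (simp_all add: hop_def hiop_def eop_def fop_def)

lemma hop_cons [simp]: "hop a (cons b v) = smul (if b = a then qq else 1) (cons b (hop a v))"
  by (rule lin_eqI[of _ _ v]) (auto simp: lin_def vec_norm mult_ac hop_Mb)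

lemma hiop_cons [simp]: "hiop a (cons b v) = smul (if b = a then inverse qq else 1) (cons b (hiop a v))"
  by (rule lin_eqI[of _ _ v]) (auto simp: lin_def vec_norm mult_ac hiop_Mb)

lemma eop_cons [simp]:
  "eop i (cons a v) = cons a (eop i v) + (if a = Suc i then cons i (kiop i v) else 0)"
  by (rule lin_eqI[of _ _ v]) (auto simp: lin_def vec_norm mult_ac eop_Mb)

lemma fop_cons [simp]:
  "fop i (cons a v) = (if a = i then cons (Suc i) v else 0) +
     smul (if a = i then qq else if a = Suc i then inverse qq else 1) (cons a (fop i v))"
  by (rule lin_eqI[of _ _ v]) (auto simp: lin_def vec_norm mult_ac fop_Mb)

lemma hop_hiop [simp]: "hop a (hiop a v) = v" and hiop_hop [simp]: "hiop a (hop a v) = v"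
  by (rule lin_eqI[of _ _ v]; auto simp: lin_def vec_norm mult_ac hop_Mb hiop_Mb power_mult_distrib[symmetric])+

lemma hop_commute: "hop a (hop b v) = hop b (hop a v)"
  and hiop_commute: "hiop a (hiop b v) = hiop b (hiop a v)"
  and hiop_hop_commute: "hiop a (hop b v) = hop b (hiop a v)"
  by (rule lin_eqI[of _ _ v]; auto simp: lin_def vec_norm mult_ac hop_Mb hiop_Mb mult.commute)+

lemmas h_commutes = hop_commute hiop_commute hiop_hop_commute

lemma q_cancel: "qq * (inverse qq * x) = x" "inverse qq * (qq * x) = x" "qq * inverse qq = 1"
    "inverse qq * qq = 1"
  by (simp_all add: mult.assoc[symmetric])

text \<open>E_i turns one factor \<eta>_(i+1) into \<eta>_i, up to scalars; this multiplies the
  eigenvalue of H_a by q for a = i and by q^-1 for a = i + 1.\<close>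

lemma hop_eop: "hop a (eop i v) = smul (if a = i then qq else if a = Suc i then inverse qq else 1) (eop i (hop a v))"
proof (rule lin_eqI_cons[of _ _ v])
  fix b f
  assume "hop a (eop i (Mb f)) = smul (if a = i then qq else if a = Suc i then inverse qq else 1) (eop i (hop a (Mb f)))"
  then show "hop a (eop i (cons b (Mb f))) = smul (if a = i then qq else if a = Suc i then inverse qq else 1) (eop i (hop a (cons b (Mb f))))"
    by (auto simp: vec_norm h_commutes simp del: cons_Mb)
qed (auto simp: lin_def vec_norm mult_ac)

lemma hiop_eop: "hiop a (eop i v) = smul (if a = i then inverse qq else if a = Suc i then qq else 1) (eop i (hiop a v))"
proof (rule lin_eqI_cons[of _ _ v])
  fix b f
  assume "hiop a (eop i (Mb f)) = smul (if a = i then inverse qq else if a = Suc i then qq else 1) (eop i (hiop a (Mb f)))"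
  then show "hiop a (eop i (cons b (Mb f))) = smul (if a = i then inverse qq else if a = Suc i then qq else 1) (eop i (hiop a (cons b (Mb f))))"
    by (auto simp: vec_norm h_commutes simp del: cons_Mb)
qed (auto simp: lin_def vec_norm mult_ac)

lemma hop_fop: "hop a (fop i v) = smul (if a = i then inverse qq else if a = Suc i then qq else 1) (fop i (hop a v))"
proof (rule lin_eqI_cons[of _ _ v])
  fix b f
  assume "hop a (fop i (Mb f)) = smul (if a = i then inverse qq else if a = Suc i then qq else 1) (fop i (hop a (Mb f)))"
  then show "hop a (fop i (cons b (Mb f))) = smul (if a = i then inverse qq else if a = Suc i then qq else 1) (fop i (hop a (cons b (Mb f))))"
    by (auto simp: vec_norm h_commutes mult_ac simp del: cons_Mb)
qed (auto simp: lin_def vec_norm mult_ac)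

lemma hiop_fop: "hiop a (fop i v) = smul (if a = i then qq else if a = Suc i then inverse qq else 1) (fop i (hiop a v))"
proof (rule lin_eqI_cons[of _ _ v])
  fix b f
  assume "hiop a (fop i (Mb f)) = smul (if a = i then qq else if a = Suc i then inverse qq else 1) (fop i (hiop a (Mb f)))"
  then show "hiop a (fop i (cons b (Mb f))) = smul (if a = i then qq else if a = Suc i then inverse qq else 1) (fop i (hiop a (cons b (Mb f))))"
    by (auto simp: vec_norm h_commutes mult_ac simp del: cons_Mb)
qed (auto simp: lin_def vec_norm mult_ac)

lemmas h_through = hop_eop hiop_eop hop_fop hiop_fop

text \<open>The cross terms match because moving K_j past E_i on the first factor and moving K_i^-1
  past F_j on the remaining ones produce the same power of q.\<close>

lemma eop_fop:
  "i \<noteq> j \<Longrightarrow> eop i (fop j v) = fop j (eop i v)"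
proof (rule lin_eqI_cons[of _ _ v])
  fix b f
  assume "i \<noteq> j" "eop i (fop j (Mb f)) = fop j (eop i (Mb f))"
  then show "eop i (fop j (cons b (Mb f))) = fop j (eop i (cons b (Mb f)))"
    by (auto simp: vec_norm h_commutes h_through mult_ac simp del: cons_Mb)
qed (auto simp: lin_def vec_norm mult_ac)

lemma eop_fop_same:
  "eop i (fop i v) = fop i (eop i v) + smul (inverse (qq - inverse qq)) (kop i v - kiop i v)"
proof (rule lin_eqI_cons[of _ _ v])
  fix b f
  let ?x = "Mb f"
  assume IH: "eop i (fop i ?x) = fop i (eop i ?x) + smul (inverse (qq - inverse qq)) (kop i ?x - kiop i ?x)"
  have q: "qq - inverse qq \<noteq> 0"
    by (metis qq_nonzero qq_square right_inverse eq_iff_diff_eq_0)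
  \<comment> \<open>For a first factor \<eta>_i the commutator is K_i^-1 + q [E_i, F_i] on the
    remaining factors. This identity absorbs the summand K_i^-1 into the quotient by q -
    q^-1.\<close>
  then have r: "qq * inverse (qq - inverse qq) = 1 + inverse qq * inverse (qq - inverse qq)"
    by (simp add: field_simps)
  show "eop i (fop i (cons b ?x)) = fop i (eop i (cons b ?x)) +
      smul (inverse (qq - inverse qq)) (kop i (cons b ?x) - kiop i (cons b ?x))"
    using q r
    by (auto simp: IH vec_norm h_commutes h_through mult_ac simp del: cons_Mb; simp add: q_cancel vec.scale_left_distrib vec.scale_left_diff_distrib algebra_simps)
qed (auto simp: lin_def vec_norm mult_ac)

lemma eop_far: "Suc i < j \<or> Suc j < i \<Longrightarrow> eop i (eop j v) = eop j (eop i v)"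
proof (rule lin_eqI_cons[of _ _ v])
  fix b f
  assume "Suc i < j \<or> Suc j < i" "eop i (eop j (Mb f)) = eop j (eop i (Mb f))"
  then show "eop i (eop j (cons b (Mb f))) = eop j (eop i (cons b (Mb f)))"
    by (auto simp: vec_norm h_commutes h_through mult_ac simp del: cons_Mb)
qed (auto simp: lin_def vec_norm mult_ac)

lemma fop_far: "Suc i < j \<or> Suc j < i \<Longrightarrow> fop i (fop j v) = fop j (fop i v)"
proof (rule lin_eqI_cons[of _ _ v])
  fix b f
  assume "Suc i < j \<or> Suc j < i" "fop i (fop j (Mb f)) = fop j (fop i (Mb f))"
  then show "fop i (fop j (cons b (Mb f))) = fop j (fop i (cons b (Mb f)))"
    by (auto simp: vec_norm h_commutes h_through mult_ac simp del: cons_Mb)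
qed (auto simp: lin_def vec_norm mult_ac)

text \<open>The quantum Serre relation solved for the word E_i E_i E_j, so that it works as a
  rewrite rule both as induction hypothesis and when the defining relations are checked.\<close>

lemma eop_serre:
  assumes ij: "j = Suc i \<or> i = Suc j"
  shows "eop i (eop i (eop j v)) = smul (qq + inverse qq) (eop i (eop j (eop i v))) - eop j (eop i (eop i v))"
proof (rule lin_eqI_cons[of _ _ v])
  fix b f
  let ?x = "Mb f"
  assume IH: "eop i (eop i (eop j ?x)) = smul (qq + inverse qq) (eop i (eop j (eop i ?x))) - eop j (eop i (eop i ?x))"
  show "eop i (eop i (eop j (cons b ?x))) = smul (qq + inverse qq) (eop i (eop j (eop i (cons b ?x)))) - eop j (eop i (eop i (cons b ?x)))"
    using ij
    by (auto simp: IH vec_norm h_commutes h_through mult_ac simp del: cons_Mb; simp add: q_cancel vec.scale_left_distrib vec.scale_left_diff_distrib algebra_simps)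
qed (use ij in \<open>auto simp: lin_def vec_norm mult_ac algebra_simps\<close>)

lemma fop_serre:
  assumes ij: "j = Suc i \<or> i = Suc j"
  shows "fop i (fop i (fop j v)) = smul (qq + inverse qq) (fop i (fop j (fop i v))) - fop j (fop i (fop i v))"
proof (rule lin_eqI_cons[of _ _ v])
  fix b f
  let ?x = "Mb f"
  assume IH: "fop i (fop i (fop j ?x)) = smul (qq + inverse qq) (fop i (fop j (fop i ?x))) - fop j (fop i (fop i ?x))"
  show "fop i (fop i (fop j (cons b ?x))) = smul (qq + inverse qq) (fop i (fop j (fop i (cons b ?x)))) - fop j (fop i (fop i (cons b ?x)))"
    using ij
    by (auto simp: IH vec_norm h_commutes h_through mult_ac simp del: cons_Mb; simp add: q_cancel vec.scale_left_distrib vec.scale_left_diff_distrib algebra_simps)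
qed (use ij in \<open>auto simp: lin_def vec_norm mult_ac algebra_simps\<close>)

primrec uop :: "ugen \<Rightarrow> vec \<Rightarrow> vec" where
  "uop (E i) = eop i"
| "uop (F i) = fop i"
| "uop (H a) = hop a"
| "uop (Hi a) = hiop a"

lemma lin_uop [simp]: "lin (uop g)"
  by (cases g) auto

lemma urels_zero: "p \<in> urels m \<Longrightarrow> frep uop p v = 0"
  unfolding urels_def
  by (auto simp: frep_simps h_commutes h_through eop_fop eop_fop_same vec_norm abs_if
      eop_far fop_far eop_serre fop_serre q_cancel vec.scale_left_distrib split: if_splits)

lemma urels_carrier: "urels m \<subseteq> carrier (free_alg (ugens m))"
  unfolding urels_def
  by (auto intro!: carrier_free_alg_intros simp: ugens_def)

section \<open>Comparison with the iterated comultiplication\<close>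

lemma tensor_lin: "lin (\<lambda>u. tensor u v)"
  by (simp add: tensor_def)

lemma tensor_Mb: "tensor (Mb f) v = lin_ext (\<lambda>g. Mb (f @ g)) v"
  by (simp add: tensor_def)

lemma tensor_Mb_single: "tensor (Mb [a]) v = cons a v"
  by (simp add: tensor_Mb cons_def)

lemma tensor_Mb_Mb: "tensor (Mb f) (Mb g) = Mb (f @ g)"
  by (simp add: tensor_Mb)

lemma tensor_op_Mb: "tensor_op k A B' (Mb f) = tensor (A (Mb (take k f))) (B' (Mb (drop k f)))"
  by (simp add: tensor_op_def)

lemma tensor_smul: "tensor (smul c u) v = smul c (tensor u v)" and tensor_zero: "tensor 0 v = 0"
  using lin_smul[OF tensor_lin] lin_zero[OF tensor_lin] by auto

lemma lin_nat_op: "lin (nat_op g)"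
  by (simp add: nat_op_def)

text \<open>\<open>tensor_act\<close> peels off the first factor just as \<open>eB\<close> and
  \<open>fB\<close> do, but its recursion ends at one factor and not at the empty tensor; hence the
  length \<open>Suc k\<close>.\<close>

lemma tensor_act_agree: "length f = Suc k \<Longrightarrow> tensor_act k g (Mb f) = uop g (Mb f)"
proof (induction k arbitrary: f g)
  case 0
  then obtain a where "f = [a]" by (cases f) auto
  then show ?case
    by (cases g) (auto simp: nat_op_def eop_Mb fop_Mb hop_Mb hiop_Mb)
next
  case (Suc k)
  then obtain a f' where f: "f = a # f'" and l: "length f' = Suc k" by (cases f) auto
  note IH = Suc.IH[OF l]
  have t: "tensor_act k g (smul c (Mb f')) = smul c (tensor_act k g (Mb f'))" for g c
    by (rule lin_smul) (cases k; cases g; simp add: lin_nat_op tensor_op_def lin_plus)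
  have n: "nat_op g (Mb [a]) = nat_act g a" "nat_op g (smul c v) = smul c (nat_op g v)" for g a c v
    using lin_smul[OF lin_nat_op] by (simp_all add: nat_op_def)
  show ?case
    by (cases g) (auto simp: f tensor_op_Mb IH t n tensor_Mb_single tensor_smul tensor_zero hop_Mb hiop_Mb eop_Mb fop_Mb mult_ac)
qed

lemma lin_tensor_act: "lin (tensor_act k g)"
  by (cases k; cases g; simp add: lin_nat_op tensor_op_def lin_plus)

lemma tensor_act_uop: "1 \<le> r \<Longrightarrow> v \<in> tpow N r \<Longrightarrow> tensor_act (r - 1) g v = uop g v"
  by (rule lin_eq_tpow[of _ _ N r]) (auto simp: lin_tensor_act bas_def intro!: tensor_act_agree)

lemma hop_tpow: "v \<in> tpow N m \<Longrightarrow> hop a v \<in> tpow N m" and hiop_tpow: "v \<in> tpow N m \<Longrightarrow> hiop a v \<in> tpow N m"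
  by (rule lin_tpow[of _ N m]; simp add: hop_Mb hiop_Mb tpow_smul)+

lemma eop_tpow:
  assumes "v \<in> tpow N m" "i \<in> {1..<N}"
  shows "eop i v \<in> tpow N m"
proof (rule lin_tpow[of _ N m, OF _ _ assms(1)])
  show "eop i (Mb f) \<in> tpow N m" if "f \<in> bas N m" for f
    using that
  proof (induction f arbitrary: m)
    case (Cons a f)
    then obtain m' where m: "m = Suc m'" by (cases m) (auto simp: bas_def)
    with Cons assms(2) show ?case
      by (auto simp flip: cons_Mb intro!: tpow_add cons_tpow hop_tpow hiop_tpow)
  qed auto
qed simp

lemma fop_tpow:
  assumes "v \<in> tpow N m" "i \<in> {1..<N}"
  shows "fop i v \<in> tpow N m"
proof (rule lin_tpow[of _ N m, OF _ _ assms(1)])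
  show "fop i (Mb f) \<in> tpow N m" if "f \<in> bas N m" for f
    using that
  proof (induction f arbitrary: m)
    case (Cons a f)
    then obtain m' where m: "m = Suc m'" by (cases m) (auto simp: bas_def)
    with Cons assms(2) show ?case
      by (auto simp flip: cons_Mb intro!: tpow_add tpow_smul cons_tpow)
  qed auto
qed simp

lemma uop_tpow: "g \<in> ugens N \<Longrightarrow> v \<in> tpow N m \<Longrightarrow> uop g v \<in> tpow N m"
  by (auto simp: ugens_def hop_tpow hiop_tpow eop_tpow fop_tpow)

lemma presented_Uq: "1 \<le> r \<Longrightarrow> presented_rep (ugens N) (urels N) N r (tensor_act (r - 1)) uop"
  by unfold_locales (auto simp: uop_tpow tensor_act_uop urels_zero simp del: One_nat_def intro: subsetD[OF urels_carrier])

section \<open>Hecke operators\<close>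

lemma lin_hecke_op [simp]: "lin (hecke_op i)"
  by (simp add: hecke_op_def)

lemmas hecke_lin [simp] = lin_hecke_op[THEN lin_add] lin_hecke_op[THEN lin_smul]
  lin_hecke_op[THEN lin_zero] lin_hecke_op[THEN lin_minus] lin_hecke_op[THEN lin_diff]

lemma permute_list_transpose_0: "permute_list (transpose 0 (Suc 0)) (a # b # f) = b # a # f"
  by (rule nth_equalityI) (auto simp: permute_list_def nth_Cons' transpose_def simp del: upt_Suc)

lemma permute_list_transpose_Suc:
  "permute_list (transpose (Suc j) (Suc (Suc j))) (a # f) = a # permute_list (transpose j (Suc j)) f"
proof (rule nth_equalityI)
  fix k
  assume "k < length (permute_list (transpose (Suc j) (Suc (Suc j))) (a # f))"
  then show "permute_list (transpose (Suc j) (Suc (Suc j))) (a # f) ! k =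
      (a # permute_list (transpose j (Suc j)) f) ! k"
    by (cases k) (auto simp: permute_list_def transpose_def simp del: upt_Suc)
qed (simp add: permute_list_def)

lemma hecke_Mb: "hecke_op (Suc i) (Mb f) =
    (let f' = permute_list (transpose i (Suc i)) f in
     if f ! i < f ! Suc i then Mb f'
     else if f ! i > f ! Suc i then Mb f' + smul (inverse qq - qq) (Mb f)
     else smul (inverse qq) (Mb f))"
  by (auto simp: hecke_op_def Let_def)

text \<open>One linear formula for the three cases of the definition. Together with
  \<open>hecke_Suc\<close> it lets identities be proved by stripping leading factors until only the
  first two or three matter.\<close>

lemma hecke_1 [simp]: "hecke_op (Suc 0) (cons a (cons b v)) =
    smul (if a = b then inverse qq else 1) (cons b (cons a v)) +
    smul (if b < a then inverse qq - qq else 0) (cons a (cons b v))"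
  by (rule lin_eqI[of _ _ v]) (auto simp: lin_def vec_norm mult_ac hecke_Mb permute_list_transpose_0 Let_def)

lemma hecke_Suc [simp]: "hecke_op (Suc (Suc j)) (cons a v) = cons a (hecke_op (Suc j) v)"
  by (rule lin_eqI[of _ _ v]) (auto simp: lin_def vec_norm hecke_Mb permute_list_transpose_Suc Let_def)

lemma list_two: "Suc 0 < length f \<Longrightarrow> \<exists>a b g. Mb f = cons a (cons b (Mb g)) \<and> f = a # b # g"
  by (cases f rule: remdups_adj.cases) auto

lemma list_three: "Suc (Suc 0) < length f \<Longrightarrow> \<exists>a b c g. Mb f = cons a (cons b (cons c (Mb g)))"
  by (cases f; cases "tl f"; cases "tl (tl f)") auto

lemma list_one: "Suc n < length f \<Longrightarrow> \<exists>a g. Mb f = cons a (Mb g) \<and> n < length g \<and> f = a # g"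
  by (cases f) auto

lemmas vec_left = vec.scale_left_distrib vec.scale_left_diff_distrib

text \<open>The relation (T + q)(T - q^-1) = 0, solved for T^2.\<close>

lemma hecke_quad: "Suc i < length f \<Longrightarrow>
    hecke_op (Suc i) (hecke_op (Suc i) (Mb f)) = Mb f + smul (inverse qq - qq) (hecke_op (Suc i) (Mb f))"
proof (induction i arbitrary: f)
  case 0
  with list_two obtain a b g where f: "Mb f = cons a (cons b (Mb g))" by blast
  show ?case
    by (cases a b rule: linorder_cases; simp add: f vec_norm q_cancel vec_left algebra_simps del: cons_Mb)
next
  case (Suc i)
  with list_one obtain a g where f: "Mb f = cons a (Mb g)" "Suc i < length g" by blast
  with Suc.IH[of g] show ?case by (simp add: f(1) del: cons_Mb)
qed

text \<open>Once the leading factors are stripped, everything is decided by the relative order of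
  three entries.\<close>

lemma hecke_braid: "Suc (Suc i) < length f \<Longrightarrow>
    hecke_op (Suc i) (hecke_op (Suc (Suc i)) (hecke_op (Suc i) (Mb f))) =
    hecke_op (Suc (Suc i)) (hecke_op (Suc i) (hecke_op (Suc (Suc i)) (Mb f)))"
proof (induction i arbitrary: f)
  case 0
  with list_three obtain a b c g where f: "Mb f = cons a (cons b (cons c (Mb g)))" by blast
  show ?case
    by (cases a b rule: linorder_cases; cases b c rule: linorder_cases; cases a c rule: linorder_cases;
        simp add: f vec_norm q_cancel vec_left algebra_simps del: cons_Mb)
next
  case (Suc i)
  with list_one obtain a g where f: "Mb f = cons a (Mb g)" "Suc (Suc i) < length g" by blast
  with Suc.IH[of g] show ?case by (simp add: f(1) del: cons_Mb)
qed

lemma hecke_far: "Suc i < j \<Longrightarrow> Suc j < length f \<Longrightarrow>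
    hecke_op (Suc i) (hecke_op (Suc j) (Mb f)) = hecke_op (Suc j) (hecke_op (Suc i) (Mb f))"
proof (induction i arbitrary: f j)
  case 0
  then obtain j' where j: "j = Suc (Suc j')" by (metis less_imp_Suc_add add_Suc add_0)
  from 0 obtain a b g where f: "Mb f = cons a (cons b (Mb g))" using list_two[of f] by auto
  show ?case by (simp add: f j vec_norm del: cons_Mb)
next
  case (Suc i)
  then obtain j' where j: "j = Suc j'" by (cases j) auto
  with Suc list_one[of "Suc j'" f] obtain a g where f: "Mb f = cons a (Mb g)" "Suc j' < length g" by auto
  with Suc.IH[of j' g] Suc.prems show ?case by (simp add: f(1) j del: cons_Mb)
qed

lemma hecke_hop: "Suc i < length f \<Longrightarrow> hecke_op (Suc i) (hop a (Mb f)) = hop a (hecke_op (Suc i) (Mb f))"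
  and hecke_hiop: "Suc i < length f \<Longrightarrow> hecke_op (Suc i) (hiop a (Mb f)) = hiop a (hecke_op (Suc i) (Mb f))"
proof (induction i arbitrary: f)
  case 0
  {
    case 1
    with list_two obtain c b g where f: "Mb f = cons c (cons b (Mb g))" by blast
    show ?case by (simp add: f vec_norm mult_ac del: cons_Mb)
  next
    case 2
    with list_two obtain c b g where f: "Mb f = cons c (cons b (Mb g))" by blast
    show ?case by (simp add: f vec_norm mult_ac del: cons_Mb)
  }
next
  case (Suc i)
  {
    case 1
    with list_one obtain c g where f: "Mb f = cons c (Mb g)" "Suc i < length g" by blast
    with Suc.IH(1)[of g] show ?case by (simp add: f(1) del: cons_Mb)
  next
    case 2
    with list_one obtain c g where f: "Mb f = cons c (Mb g)" "Suc i < length g" by blast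
    with Suc.IH(2)[of g] show ?case by (simp add: f(1) del: cons_Mb)
  }
qed

lemma hecke_kiop: "Suc i < length f \<Longrightarrow> hecke_op (Suc i) (kiop a (Mb f)) = kiop a (hecke_op (Suc i) (Mb f))"
  by (simp add: hiop_Mb hecke_hop) (simp flip: uops_lin hecke_lin add: hiop_Mb[symmetric] hecke_hiop)

text \<open>At the first two factors only the comparison of a and b with each other and with k and k
  + 1 matters. Further right, the summand E_k \<otimes> K_k^-1 asks T to commute with K_k^-1 on the
  remaining factors, which is \<open>hecke_kiop\<close>.\<close>

lemma hecke_eop: "Suc i < length f \<Longrightarrow> hecke_op (Suc i) (eop k (Mb f)) = eop k (hecke_op (Suc i) (Mb f))"
proof (induction i arbitrary: f)
  case 0
  with list_two obtain a b g where f: "Mb f = cons a (cons b (Mb g))" by blast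
  show ?case
    by (cases a b rule: linorder_cases; cases "a = Suc k"; cases "b = Suc k"; cases "a = k"; cases "b = k";
        simp add: f vec_norm q_cancel vec_left algebra_simps del: cons_Mb)
next
  case (Suc i)
  with list_one obtain a g where f: "Mb f = cons a (Mb g)" "Suc i < length g" by blast
  with Suc.IH[of g] show ?case by (simp add: f(1) hecke_kiop del: cons_Mb)
qed

lemma hecke_fop: "Suc i < length f \<Longrightarrow> hecke_op (Suc i) (fop k (Mb f)) = fop k (hecke_op (Suc i) (Mb f))"
proof (induction i arbitrary: f)
  case 0
  with list_two obtain a b g where f: "Mb f = cons a (cons b (Mb g))" by blast
  show ?case
    by (cases a b rule: linorder_cases; cases "a = Suc k"; cases "b = Suc k"; cases "a = k"; cases "b = k";
        simp add: f vec_norm q_cancel vec_left algebra_simps del: cons_Mb)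
next
  case (Suc i)
  with list_one obtain a g where f: "Mb f = cons a (Mb g)" "Suc i < length g" by blast
  with Suc.IH[of g] show ?case by (simp add: f(1) del: cons_Mb)
qed

section \<open>Hecke operators on a fixed tensor power\<close>

lemma hecke_tpow: 
  assumes "v \<in> tpow N m" "i \<in> {1..<m}" shows "hecke_op i v \<in> tpow N m"
proof (rule lin_tpow[of _ N m, OF _ _ assms(1)])
  fix f assume f: "f \<in> bas N m"
  have "transpose (i - 1) i permutes {..<length f}"
    using assms(2) f by (intro permutes_swap_id) (auto simp: bas_def)
  then have "permute_list (transpose (i - 1) i) f \<in> bas N m"
    using f by (simp add: bas_def)
  with f show "hecke_op i (Mb f) \<in> tpow N m"
    by (auto simp: hecke_op_def Let_def intro!: tpow_add tpow_smul)
qed simp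

lemma hecke_uop:
  assumes "v \<in> tpow N m" "i \<in> {1..<m}"
  shows "hecke_op i (uop g v) = uop g (hecke_op i v)"
proof (rule lin_eq_tpow[OF _ _ _ assms(1)])
  fix f assume "f \<in> bas N m"
  moreover obtain i' where "i = Suc i'" using assms(2) by (cases i) auto
  ultimately show "hecke_op i (uop g (Mb f)) = uop g (hecke_op i (Mb f))"
    using assms(2)
    by (cases g) (auto simp: bas_def hecke_eop hecke_fop hecke_hop hecke_hiop)
qed (auto intro: lin_comp)

lemma hecke_quad_tpow:
  assumes "v \<in> tpow N m" "i \<in> {1..<m}"
  shows "hecke_op i (hecke_op i v) = v + smul (inverse qq - qq) (hecke_op i v)"
proof (rule lin_eq_tpow[OF _ _ _ assms(1)])
  fix f assume "f \<in> bas N m"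
  then show "hecke_op i (hecke_op i (Mb f)) = Mb f + smul (inverse qq - qq) (hecke_op i (Mb f))"
    using assms(2) hecke_quad[of "i - 1" f] by (simp add: bas_def)
qed (auto simp: lin_def vec_norm mult_ac)

lemma hecke_braid_tpow:
  assumes "v \<in> tpow N m" "i \<in> {1..<m}" "Suc i \<in> {1..<m}"
  shows "hecke_op i (hecke_op (Suc i) (hecke_op i v)) = hecke_op (Suc i) (hecke_op i (hecke_op (Suc i) v))"
proof (rule lin_eq_tpow[OF _ _ _ assms(1)])
  fix f assume "f \<in> bas N m"
  then show "hecke_op i (hecke_op (Suc i) (hecke_op i (Mb f))) = hecke_op (Suc i) (hecke_op i (hecke_op (Suc i) (Mb f)))"
    using assms(2,3) hecke_braid[of "i - 1" f] by (simp add: bas_def)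
qed (auto simp: lin_def vec_norm mult_ac)

lemma hecke_far_tpow:
  assumes "v \<in> tpow N m" "i \<in> {1..<m}" "j \<in> {1..<m}" "Suc i < j \<or> Suc j < i"
  shows "hecke_op i (hecke_op j v) = hecke_op j (hecke_op i v)"
proof (rule lin_eq_tpow[OF _ _ _ assms(1)])
  fix f assume "f \<in> bas N m"
  then show "hecke_op i (hecke_op j (Mb f)) = hecke_op j (hecke_op i (Mb f))"
    using assms(2-4) hecke_far[of "i - 1" "j - 1" f] hecke_far[of "j - 1" "i - 1" f] by (auto simp: bas_def)
qed (auto simp: lin_def vec_norm mult_ac)

text \<open>Stated for arbitrary elements \<open>t i\<close>, so that it serves both the Hecke
  algebra (\<open>t = gen\<close>) and the Hecke generators inside the duplex Hecke algebra
  (\<open>t = tt\<close>).\<close>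

lemma hecke_rels_zero:
  assumes "\<And>g. lin (\<rho> g)" "\<And>i. frep \<rho> (t i) = hecke_op i" "p \<in> hecke_rels t m" "v \<in> tpow N m"
  shows "frep \<rho> p v = 0"
  using assms(3,4) unfolding hecke_rels_def
  by (auto simp: frep_add frep_diff frep_mult[OF assms(1)] assms(2) hecke_quad_tpow hecke_braid_tpow
      vec_norm vec_left abs_if hecke_far_tpow split: if_splits)

lemma hecke_rels_carrier: "(\<And>i. i \<in> {1..<m} \<Longrightarrow> t i \<in> carrier (free_alg S)) \<Longrightarrow> hecke_rels t m \<subseteq> carrier (free_alg S)"
  unfolding hecke_rels_def by (auto intro!: carrier_free_alg_intros)

lemma presented_Hecke: "presented_rep {1..<m} (hecke_rels gen m) N m hecke_op hecke_op"
proof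
  show "hecke_rels gen m \<subseteq> carrier (free_alg {1..<m})"
    by (intro hecke_rels_carrier carrier_free_alg_intros)
  show "frep hecke_op p v = 0" if "p \<in> hecke_rels gen m" "v \<in> tpow N m" for p v
    by (rule hecke_rels_zero[OF _ _ that]) (auto simp: fun_eq_iff)
qed (auto simp: hecke_tpow)

text \<open>Distinct basis tensors are linked by T only if they differ by the swap, with entry 1 in
  both directions. The symmetry is needed for closure under transposition.\<close>

lemma hecke_sym: "Suc i < length f \<Longrightarrow> length g = length f \<Longrightarrow>
  lookup (hecke_op (Suc i) (Mb g)) f = lookup (hecke_op (Suc i) (Mb f)) g"
proof (induction i arbitrary: f g)
  case 0
  with list_two obtain a b f' where f: "Mb f = cons a (cons b (Mb f'))" "f = a # b # f'" by blast
  from 0 list_two[of g] obtain c d g' where g: "Mb g = cons c (cons d (Mb g'))" "g = c # d # g'" by auto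
  show ?case unfolding f(1) g(1) hecke_1 unfolding f(2) g(2)
    by (simp add: lookup_add lookup_cons lookup_Mb del: cons_Mb)
next
  case (Suc i)
  with list_one obtain a f' where f: "Mb f = cons a (Mb f')" "Suc i < length f'" "f = a # f'" by blast
  from Suc.prems list_one[of "Suc i" g] obtain b g' where g: "Mb g = cons b (Mb g')" "g = b # g'" by auto
  have "length g' = length f'" using Suc.prems f g by simp
  with Suc.IH[OF f(2)] show ?case unfolding f(1) g(1) hecke_Suc unfolding f(3) g(2)
    by (simp add: lookup_cons del: cons_Mb)
qed

section \<open>Matsumoto's theorem for the symmetric group\<close>

definition invs :: "nat \<Rightarrow> (nat \<Rightarrow> nat) \<Rightarrow> (nat \<times> nat) set" where
  "invs l \<sigma> = {(a, b). 1 \<le> a \<and> a < b \<and> b \<le> l \<and> \<sigma> b < \<sigma> a}"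

definition ninv :: "nat \<Rightarrow> (nat \<Rightarrow> nat) \<Rightarrow> nat" where
  "ninv l \<sigma> = card (invs l \<sigma>)"

lemma s_gen_simps [simp]: "s_gen i i = Suc i" "s_gen i (Suc i) = i"
    "a \<noteq> i \<Longrightarrow> a \<noteq> Suc i \<Longrightarrow> s_gen i a = a" "s_gen i (s_gen i a) = a"
  by (auto simp: s_gen_def transpose_def)

lemma s_gen_comp' [simp]: "\<sigma> \<circ> s_gen i \<circ> s_gen i = \<sigma>" "s_gen i \<circ> (s_gen i \<circ> \<sigma>) = \<sigma>"
  by (auto simp: fun_eq_iff)

lemma s_gen_permutes: "i \<in> {1..<l} \<Longrightarrow> s_gen i permutes {1..l}"
  unfolding s_gen_def by (rule permutes_swap_id) auto

lemma s_gen_less: "a < b \<Longrightarrow> (a, b) \<noteq> (i, Suc i) \<Longrightarrow> s_gen i a < s_gen i b"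
  by (auto simp: s_gen_def transpose_def)

lemma s_gen_range: "i \<in> {1..<l} \<Longrightarrow> a \<in> {1..l} \<Longrightarrow> s_gen i a \<in> {1..l}"
  by (auto simp: s_gen_def transpose_def)

lemma finite_invs: "finite (invs l \<sigma>)"
  by (rule finite_subset[of _ "{1..l} \<times> {1..l}"]) (auto simp: invs_def)

text \<open>s_i keeps the order of every pair of positions except (i, i + 1). So it carries the
  inversions of \<sigma> bijectively onto those of \<sigma> s_i other than (i, i + 1), and that pair
  is the new one.\<close>

lemma ninv_up:
  assumes i: "i \<in> {1..<l}" and less: "\<sigma> i < \<sigma> (Suc i)"
  shows "ninv l (\<sigma> \<circ> s_gen i) = Suc (ninv l \<sigma>)"
proof -
  let ?t = "map_prod (s_gen i) (s_gen i)"
  have "invs l (\<sigma> \<circ> s_gen i) = insert (i, Suc i) (?t ` invs l \<sigma>)"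
  proof (intro equalityI subsetI)
    fix x assume x: "x \<in> invs l (\<sigma> \<circ> s_gen i)"
    obtain a b where ab: "x = (a, b)" by (cases x)
    show "x \<in> insert (i, Suc i) (?t ` invs l \<sigma>)"
    proof (cases "(a, b) = (i, Suc i)")
      case False
      have "(s_gen i a, s_gen i b) \<in> invs l \<sigma>"
        using x ab False s_gen_less[of a b i] s_gen_range[OF i, of a] s_gen_range[OF i, of b]
        by (auto simp: invs_def)
      then have "?t (s_gen i a, s_gen i b) \<in> ?t ` invs l \<sigma>" by (rule imageI)
      then show ?thesis by (simp add: ab)
    qed (simp add: ab)
  next
    fix x assume "x \<in> insert (i, Suc i) (?t ` invs l \<sigma>)"
    then show "x \<in> invs l (\<sigma> \<circ> s_gen i)"
    proof
      assume "x = (i, Suc i)"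
      with i less show ?thesis by (auto simp: invs_def)
    next
      assume "x \<in> ?t ` invs l \<sigma>"
      then obtain a b where ab: "x = (s_gen i a, s_gen i b)" "(a, b) \<in> invs l \<sigma>" by auto
      then have "(a, b) \<noteq> (i, Suc i)" using less by (auto simp: invs_def)
      with ab show ?thesis
        using s_gen_less[of a b i] s_gen_range[OF i, of a] s_gen_range[OF i, of b]
        by (auto simp: invs_def)
    qed
  qed
  moreover have "(i, Suc i) \<notin> ?t ` invs l \<sigma>"
  proof
    assume "(i, Suc i) \<in> ?t ` invs l \<sigma>"
    then obtain a b where "(a, b) \<in> invs l \<sigma>" "s_gen i a = i" "s_gen i b = Suc i" by auto
    then have "a = Suc i" "b = i" by (metis s_gen_simps(1,4), metis s_gen_simps(2,4))
    with \<open>(a, b) \<in> invs l \<sigma>\<close> show False by (simp add: invs_def)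
  qed
  moreover have "inj_on ?t (invs l \<sigma>)"
    by (rule inj_onI) (auto, (metis s_gen_simps(4))+)
  ultimately show ?thesis
    by (simp add: ninv_def finite_invs card_image)
qed

lemma ninv_down:
  assumes "i \<in> {1..<l}" "\<sigma> (Suc i) < \<sigma> i"
  shows "Suc (ninv l (\<sigma> \<circ> s_gen i)) = ninv l \<sigma>"
  using ninv_up[of i l "\<sigma> \<circ> s_gen i"] assms by simp

lemma permutes_neq: "\<sigma> permutes S \<Longrightarrow> \<sigma> i \<noteq> \<sigma> (Suc i)"
  by (metis n_not_Suc_n permutes_inj inj_eq)

lemma word_perm_simps: "word_perm [] = id" "word_perm (i # w) = s_gen i \<circ> word_perm w"
  by (simp_all add: word_perm_def)

lemma word_perm_append: "word_perm (u @ v) = word_perm u \<circ> word_perm v"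
  by (induction u) (simp_all only: append.simps word_perm_simps id_comp o_assoc)

lemma word_perm_snoc: "word_perm (w @ [i]) = word_perm w \<circ> s_gen i"
  by (simp only: word_perm_append word_perm_simps comp_id)

lemma word_permute_swap_involutiveutes: "set w \<subseteq> {1..<l} \<Longrightarrow> word_perm w permutes {1..l}"
proof (induction w)
  case (Cons i w)
  then show ?case
    unfolding word_perm_simps by (intro permutes_compose s_gen_permutes) auto
qed (simp only: word_perm_simps permutes_id)

lemma ninv_id [simp]: "ninv l id = 0"
proof -
  have "invs l id = {}" by (auto simp: invs_def)
  then show ?thesis by (simp add: ninv_def)
qed

lemma ninv_word_le: "set w \<subseteq> {1..<l} \<Longrightarrow> ninv l (word_perm w) \<le> length w"
proof (induction w rule: rev_induct)
  case (snoc i w)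
  let ?\<sigma> = "word_perm w"
  have "?\<sigma> i \<noteq> ?\<sigma> (Suc i)" using snoc.prems word_permute_swap_involutiveutes[of w l] permutes_neq by simp
  then consider "?\<sigma> i < ?\<sigma> (Suc i)" | "?\<sigma> (Suc i) < ?\<sigma> i" by linarith
  then have "ninv l (?\<sigma> \<circ> s_gen i) \<le> Suc (ninv l ?\<sigma>)"
    using snoc.prems ninv_up[of i l ?\<sigma>] ninv_down[of i l ?\<sigma>] by cases auto
  moreover have "ninv l ?\<sigma> \<le> length w" using snoc by simp
  ultimately have "ninv l (?\<sigma> \<circ> s_gen i) \<le> length (w @ [i])" by simp
  then show ?case by (simp only: word_perm_snoc)
qed (simp only: word_perm_simps ninv_id)

text \<open>Phrased by inversions instead of minimality, which makes prefixes easy to control;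
  \<open>perm_length_ninv\<close> shows that both notions agree.\<close>

definition reduced :: "nat \<Rightarrow> nat list \<Rightarrow> bool" where
  "reduced l w \<longleftrightarrow> set w \<subseteq> {1..<l} \<and> length w = ninv l (word_perm w)"

lemma reduced_snocI:
  "reduced l w \<Longrightarrow> i \<in> {1..<l} \<Longrightarrow> word_perm w i < word_perm w (Suc i) \<Longrightarrow> reduced l (w @ [i])"
  unfolding reduced_def word_perm_snoc by (simp add: ninv_up)

lemma reduced_snocD:
  assumes "reduced l (w @ [i])"
  shows "reduced l w" "i \<in> {1..<l}" "word_perm w i < word_perm w (Suc i)"
proof -
  have w: "set w \<subseteq> {1..<l}" "i \<in> {1..<l}" and len: "Suc (length w) = ninv l (word_perm w \<circ> s_gen i)"
    using assms unfolding reduced_def word_perm_snoc by auto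
  have "word_perm w i \<noteq> word_perm w (Suc i)" using w word_permute_swap_involutiveutes[of w l] permutes_neq by simp
  \<comment> \<open>A descent of \<open>word_perm w\<close> at \<open>i\<close> would give it
    \<open>length w + 2\<close> inversions, more than a word of length \<open>length w\<close> can
    produce.\<close>
  moreover have "\<not> word_perm w (Suc i) < word_perm w i"
    using ninv_down[OF w(2), of "word_perm w"] ninv_word_le[OF w(1)] len by auto
  ultimately show "word_perm w i < word_perm w (Suc i)" by linarith
  with ninv_up[OF w(2), of "word_perm w"] len w show "reduced l w" by (simp add: reduced_def)
  show "i \<in> {1..<l}" by fact
qed

text \<open>Without descents \<sigma> increases on 1, ..., l, so k \<le> \<sigma> k for all k, which
  leaves only the identity.\<close>

lemma exists_descent:
  assumes "\<sigma> permutes {1..l}" "\<sigma> \<noteq> id"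
  shows "\<exists>i\<in>{1..<l}. \<sigma> (Suc i) < \<sigma> i"
proof (rule ccontr)
  assume "\<not> ?thesis"
  then have up: "\<sigma> i < \<sigma> (Suc i)" if "i \<in> {1..<l}" for i
    using that permutes_neq[OF assms(1), of i] by (meson linorder_neqE_nat)
  have "k \<le> \<sigma> k" if "k \<in> {1..l}" for k
    using that
  proof (induction k)
    case (Suc k)
    show ?case
    proof (cases "k = 0")
      case True
      then show ?thesis using Suc.prems permutes_in_image[OF assms(1), of 1] by simp
    next
      case False
      then show ?thesis using Suc up[of k] by simp
    qed
  qed simp
  then show False using permutes_natset_ge[OF assms(1)] assms(2) by blast
qed

text \<open>Bubble sort: right multiplication by s_i at a descent removes one inversion; the letters
  used, read backwards, form the reduced word.\<close>

lemma exists_reduced: "\<sigma> permutes {1..l} \<Longrightarrow> \<exists>w. reduced l w \<and> word_perm w = \<sigma>"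
proof (induction "ninv l \<sigma>" arbitrary: \<sigma> rule: less_induct)
  case less
  show ?case
  proof (cases "\<sigma> = id")
    case True
    then show ?thesis by (intro exI[of _ "[]"]) (simp only: reduced_def word_perm_simps ninv_id list.size set_simps, simp)
  next
    case False
    then obtain i where i: "i \<in> {1..<l}" "\<sigma> (Suc i) < \<sigma> i"
      using exists_descent less.prems by blast
    have "\<sigma> \<circ> s_gen i permutes {1..l}"
      by (rule permutes_compose[OF s_gen_permutes[OF i(1)] less.prems])
    then obtain w where w: "reduced l w" "word_perm w = \<sigma> \<circ> s_gen i"
      using less.hyps[of "\<sigma> \<circ> s_gen i"] ninv_down[OF i] by auto
    then show ?thesis using i by (intro exI[of _ "w @ [i]"]) (auto intro!: reduced_snocI simp only: word_perm_snoc, simp_all)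
  qed
qed

lemma perm_length_ninv:
  assumes "\<sigma> permutes {1..l}"
  shows "perm_length l \<sigma> = ninv l \<sigma>"
  unfolding perm_length_def
proof (rule Least_equality)
  obtain w where "reduced l w" "word_perm w = \<sigma>" using exists_reduced[OF assms] by blast
  then show "\<exists>w\<in>expressions l \<sigma>. length w = ninv l \<sigma>"
    by (intro bexI[of _ w]) (auto simp: reduced_def expressions_def)
qed (auto simp: expressions_def ninv_word_le)

lemma reduced_expr:
  assumes "\<sigma> permutes {1..l}"
  shows "reduced l (reduced_expr l \<sigma>)" "word_perm (reduced_expr l \<sigma>) = \<sigma>"
    "set (reduced_expr l \<sigma>) \<subseteq> {1..<l}"
proof -
  obtain w where "reduced l w" "word_perm w = \<sigma>" using exists_reduced[OF assms] by blast
  then have "\<exists>w. w \<in> expressions l \<sigma> \<and> length w = perm_length l \<sigma>"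
    by (intro exI[of _ w]) (auto simp: reduced_def expressions_def perm_length_ninv[OF assms])
  then have "reduced_expr l \<sigma> \<in> expressions l \<sigma> \<and> length (reduced_expr l \<sigma>) = perm_length l \<sigma>"
    unfolding reduced_expr_def by (rule someI_ex)
  then show "reduced l (reduced_expr l \<sigma>)" "word_perm (reduced_expr l \<sigma>) = \<sigma>"
    "set (reduced_expr l \<sigma>) \<subseteq> {1..<l}"
    by (auto simp: reduced_def expressions_def perm_length_ninv[OF assms])
qed

text \<open>The setting of Matsumoto's theorem. \<open>reduced_expr\<close> picks an arbitrary
  reduced word, while the relations of the duplex Hecke algebra compare the words picked for
  different permutations, so independence of the choice is required.\<close>

locale braid_action =
  fixes l :: nat and Z :: "'v set" and \<rho> :: "nat \<Rightarrow> 'v \<Rightarrow> 'v"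
  assumes closed: "i \<in> {1..<l} \<Longrightarrow> v \<in> Z \<Longrightarrow> \<rho> i v \<in> Z"
    and braid: "i \<in> {1..<l} \<Longrightarrow> Suc i \<in> {1..<l} \<Longrightarrow> v \<in> Z \<Longrightarrow>
      \<rho> i (\<rho> (Suc i) (\<rho> i v)) = \<rho> (Suc i) (\<rho> i (\<rho> (Suc i) v))"
    and far: "i \<in> {1..<l} \<Longrightarrow> j \<in> {1..<l} \<Longrightarrow> Suc i < j \<Longrightarrow> v \<in> Z \<Longrightarrow> \<rho> i (\<rho> j v) = \<rho> j (\<rho> i v)"
begin

lemma foldr_closed: "set w \<subseteq> {1..<l} \<Longrightarrow> v \<in> Z \<Longrightarrow> foldr \<rho> w v \<in> Z"
  by (induction w) (auto simp: closed)

text \<open>Induction on the length, comparing the last letters i and j. Both are descents of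
  \<sigma>, so for i \<noteq> j there are reduced words of \<sigma> ending in the two sides of the
  relation between s_i and s_j; these connect the given words.\<close>

lemma reduced_words_agree:
  assumes "reduced l u" "reduced l u'" "word_perm u = word_perm u'" "v \<in> Z"
  shows "foldr \<rho> u v = foldr \<rho> u' v"
  using assms
proof (induction "length u" arbitrary: u u' v)
  case 0
  then have "u = []" "length u' = length u" by (simp_all add: reduced_def)
  then show ?case by simp
next
  case (Suc k)
  let ?\<sigma> = "word_perm u"
  have len: "length u = Suc k" "length u' = Suc k" using Suc by (simp_all add: reduced_def)
  obtain w i where u: "u = w @ [i]" using len(1) by (cases u rule: rev_cases) auto
  obtain w' j where u': "u' = w' @ [j]" using len(2) by (cases u' rule: rev_cases) auto
  note w = reduced_snocD[OF Suc.prems(1)[unfolded u]]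
  note w' = reduced_snocD[OF Suc.prems(2)[unfolded u']]
  have \<sigma>_per: "?\<sigma> permutes {1..l}" using Suc.prems(1) by (intro word_permute_swap_involutiveutes) (simp add: reduced_def)
  have pw: "word_perm w = ?\<sigma> \<circ> s_gen i" by (simp only: u word_perm_snoc s_gen_comp')
  have pw': "word_perm w' = ?\<sigma> \<circ> s_gen j" using Suc.prems(3) by (simp only: u' word_perm_snoc s_gen_comp')
  have di: "?\<sigma> (Suc i) < ?\<sigma> i" using w(3) by (simp add: u word_perm_snoc)
  have dj: "?\<sigma> (Suc j) < ?\<sigma> j" using w'(3) pw' by simp
  have IH: "foldr \<rho> y v = foldr \<rho> y' v"
    if "reduced l y" "length y = k" "reduced l y'" "word_perm y = word_perm y'" "v \<in> Z" for y y' v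
    using Suc.hyps(1)[of y y' v] that by simp
  have lw: "length w = k" "length w' = k" using len u u' by auto
  have adjacent: "foldr \<rho> (x @ [a]) v = foldr \<rho> (x' @ [Suc a]) v"
    if x: "reduced l x" "length x = k" "word_perm x = ?\<sigma> \<circ> s_gen a"
      and x': "reduced l x'" "length x' = k" "word_perm x' = ?\<sigma> \<circ> s_gen (Suc a)"
      and a: "a \<in> {1..<l}" "Suc a \<in> {1..<l}" "?\<sigma> (Suc a) < ?\<sigma> a" "?\<sigma> (Suc (Suc a)) < ?\<sigma> (Suc a)"
    for x x' a
  proof -
    \<comment> \<open>\<sigma> reverses the positions a, a + 1, a + 2, and \<open>?\<tau>\<close> is
      \<sigma> with these three values sorted. So a reduced word of \<open>?\<tau>\<close> stays
      reduced when either side of the braid relation is appended.\<close>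
    let ?\<tau> = "?\<sigma> \<circ> s_gen a \<circ> s_gen (Suc a) \<circ> s_gen a"
    have "?\<tau> permutes {1..l}"
      using \<sigma>_per a(1,2) by (intro permutes_compose s_gen_permutes) auto
    then obtain y where y: "reduced l y" "word_perm y = ?\<tau>" using exists_reduced by blast
    have br: "s_gen a \<circ> s_gen (Suc a) \<circ> s_gen a = s_gen (Suc a) \<circ> s_gen a \<circ> s_gen (Suc a)"
      by (auto simp: s_gen_def transpose_def fun_eq_iff)
    then have \<tau>': "?\<tau> = ?\<sigma> \<circ> s_gen (Suc a) \<circ> s_gen a \<circ> s_gen (Suc a)"
      by (metis comp_assoc)
    have \<tau>v: "?\<tau> a = ?\<sigma> (Suc (Suc a))" "?\<tau> (Suc a) = ?\<sigma> (Suc a)" "?\<tau> (Suc (Suc a)) = ?\<sigma> a"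
      by simp_all
    have "reduced l (y @ [a])"
      by (rule reduced_snocI) (use y a \<tau>v in auto)
    then have y1: "reduced l ((y @ [a]) @ [Suc a])"
      using reduced_snocI[of l "y @ [a]" "Suc a"] \<tau>v a by (simp add: word_perm_snoc y(2))
    have p1: "word_perm ((y @ [a]) @ [Suc a]) = ?\<sigma> \<circ> s_gen a"
      by (simp only: word_perm_snoc y(2) s_gen_comp')
    have "reduced l (y @ [Suc a])"
      by (rule reduced_snocI) (use y a \<tau>v in auto)
    then have y2: "reduced l ((y @ [Suc a]) @ [a])"
      using reduced_snocI[of l "y @ [Suc a]" "a"] \<tau>v a by (simp add: word_perm_snoc y(2))
    have p2: "word_perm ((y @ [Suc a]) @ [a]) = ?\<sigma> \<circ> s_gen (Suc a)"
      by (simp only: word_perm_snoc y(2) \<tau>' s_gen_comp')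
    \<comment> \<open>Both words are reduced for \<sigma> s_a and have length \<open>k\<close>; the
      induction hypothesis trades \<open>x\<close> for the one that exposes a side of the braid
      relation.\<close>
    have "foldr \<rho> x (\<rho> a v) = foldr \<rho> ((y @ [a]) @ [Suc a]) (\<rho> a v)"
      using x y1 p1 closed[OF a(1) Suc.prems(4)] by (intro IH) auto
    also have "\<dots> = foldr \<rho> y (\<rho> a (\<rho> (Suc a) (\<rho> a v)))" by simp
    also have "\<dots> = foldr \<rho> y (\<rho> (Suc a) (\<rho> a (\<rho> (Suc a) v)))"
      using braid[OF a(1,2) Suc.prems(4)] by simp
    also have "\<dots> = foldr \<rho> ((y @ [Suc a]) @ [a]) (\<rho> (Suc a) v)" by simp
    also have "\<dots> = foldr \<rho> x' (\<rho> (Suc a) v)"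
      using x' y2 p2 closed[OF a(2) Suc.prems(4)]
      by (intro IH[symmetric]) auto
    finally show ?thesis by simp
  qed
  have apart: "foldr \<rho> (x @ [a]) v = foldr \<rho> (x' @ [b]) v"
    if x: "reduced l x" "length x = k" "word_perm x = ?\<sigma> \<circ> s_gen a"
      and x': "reduced l x'" "length x' = k" "word_perm x' = ?\<sigma> \<circ> s_gen b"
      and a: "a \<in> {1..<l}" "b \<in> {1..<l}" "?\<sigma> (Suc a) < ?\<sigma> a" "?\<sigma> (Suc b) < ?\<sigma> b" "Suc a < b"
    for x x' a b
  proof -
    let ?\<tau> = "?\<sigma> \<circ> s_gen a \<circ> s_gen b"
    have "?\<tau> permutes {1..l}"
      using \<sigma>_per a(1,2) by (intro permutes_compose s_gen_permutes) auto
    then obtain y where y: "reduced l y" "word_perm y = ?\<tau>" using exists_reduced by blast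
    have "s_gen a \<circ> s_gen b = s_gen b \<circ> s_gen a"
      using a(5) by (auto simp: s_gen_def transpose_def fun_eq_iff)
    then have \<tau>': "?\<tau> = ?\<sigma> \<circ> s_gen b \<circ> s_gen a" by (metis comp_assoc)
    have \<tau>v: "?\<tau> a = ?\<sigma> (Suc a)" "?\<tau> (Suc a) = ?\<sigma> a" "?\<tau> b = ?\<sigma> (Suc b)" "?\<tau> (Suc b) = ?\<sigma> b"
      using a(5) by simp_all
    have y1: "reduced l (y @ [b])" and y2: "reduced l (y @ [a])"
      by (rule reduced_snocI; use y a \<tau>v in auto)+
    have p1: "word_perm (y @ [b]) = ?\<sigma> \<circ> s_gen a" by (simp only: word_perm_snoc y(2) s_gen_comp')
    have p2: "word_perm (y @ [a]) = ?\<sigma> \<circ> s_gen b" by (simp only: word_perm_snoc y(2) \<tau>' s_gen_comp')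
    have "foldr \<rho> x (\<rho> a v) = foldr \<rho> (y @ [b]) (\<rho> a v)"
      using x y1 p1 closed[OF a(1) Suc.prems(4)] by (intro IH) auto
    also have "\<dots> = foldr \<rho> (y @ [a]) (\<rho> b v)"
      using far[OF a(1,2,5) Suc.prems(4)] by simp
    also have "\<dots> = foldr \<rho> x' (\<rho> b v)"
      using x' y2 p2 closed[OF a(2) Suc.prems(4)] by (intro IH[symmetric]) auto
    finally show ?thesis by simp
  qed
  consider "i = j" | "j = Suc i" | "i = Suc j" | "Suc i < j" | "Suc j < i" by linarith
  then show ?case
  proof cases
    case 1
    then show ?thesis
      unfolding u u' using IH[OF w(1) lw(1) w'(1)] pw pw' closed[OF w(2) Suc.prems(4)] by simp
  next
    case 2
    show ?thesis using adjacent[OF w(1) lw(1) pw w'(1) lw(2), of] pw' w(2) w'(2) di dj 2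
      unfolding u u' by simp
  next
    case 3
    show ?thesis using adjacent[OF w'(1) lw(2) pw' w(1) lw(1)] pw w(2) w'(2) di dj 3
      unfolding u u' by simp
  next
    case 4
    show ?thesis using apart[OF w(1) lw(1) pw w'(1) lw(2) pw' w(2) w'(2) di dj 4]
      unfolding u u' by simp
  next
    case 5
    show ?thesis using apart[OF w'(1) lw(2) pw' w(1) lw(1) pw w'(2) w(2) dj di 5]
      unfolding u u' by simp
  qed
qed

end

section \<open>Lengths of inverses and of products with a simple reflection\<close>

lemma word_perm_rev: "word_perm (rev w) \<circ> word_perm w = id"
proof (induction w)
  case (Cons i w)
  have "word_perm (rev (i # w)) \<circ> word_perm (i # w) = word_perm (rev w) \<circ> (s_gen i \<circ> (s_gen i \<circ> word_perm w))"
    by (simp only: rev.simps word_perm_snoc word_perm_simps o_assoc)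
  with Cons show ?case by (simp only: s_gen_comp')
qed (simp only: rev.simps word_perm_simps id_comp)

lemma inv_word_perm: "inv_into UNIV (word_perm w) = word_perm (rev w)"
  using word_perm_rev[of w] word_perm_rev[of "rev w"] by (intro inv_unique_comp) auto

text \<open>A reduced word read backwards spells the inverse, which gives one inequality; applied to
  the inverse it gives the other.\<close>

lemma ninv_inv:
  assumes "\<sigma> permutes {1..l}"
  shows "ninv l (inv_into UNIV \<sigma>) = ninv l \<sigma>"
proof -
  have le: "ninv l (inv_into UNIV \<tau>) \<le> ninv l \<tau>" if \<tau>: "\<tau> permutes {1..l}" for \<tau>
  proof -
    obtain w where w: "reduced l w" "word_perm w = \<tau>" using exists_reduced[OF \<tau>] by blast
    then have "ninv l (word_perm (rev w)) \<le> length w"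
      using ninv_word_le[of "rev w" l] by (simp add: reduced_def)
    with w show ?thesis by (auto simp: reduced_def inv_word_perm[symmetric])
  qed
  from le[OF assms] le[OF permutes_inv[OF assms]] permutes_inv_inv[OF assms] show ?thesis by simp
qed

text \<open>The length changes by exactly one, so the second branch of \<open>x_right\<close> is the
  case of decreasing length.\<close>

lemma perm_length_right:
  assumes "\<sigma> permutes {1..l}" "i \<in> {1..<l}" "perm_length l (\<sigma> \<circ> s_gen i) \<noteq> perm_length l \<sigma> + 1"
  shows "perm_length l \<sigma> = perm_length l (\<sigma> \<circ> s_gen i) + 1"
proof -
  have p: "\<sigma> \<circ> s_gen i permutes {1..l}" by (intro permutes_compose s_gen_permutes assms)
  have "\<sigma> i \<noteq> \<sigma> (Suc i)" using permutes_neq assms(1) by blast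
  then show ?thesis
    using assms(3) ninv_up[OF assms(2), of \<sigma>] ninv_down[OF assms(2), of \<sigma>]
    unfolding perm_length_ninv[OF assms(1)] perm_length_ninv[OF p]
    by (cases "\<sigma> i < \<sigma> (Suc i)") auto
qed

text \<open>Inversion preserves the length and turns left multiplication into right
  multiplication.\<close>

lemma perm_length_left:
  assumes "\<sigma> permutes {1..l}" "i \<in> {1..<l}" "perm_length l (s_gen i \<circ> \<sigma>) \<noteq> perm_length l \<sigma> + 1"
  shows "perm_length l \<sigma> = perm_length l (s_gen i \<circ> \<sigma>) + 1"
proof -
  have p: "s_gen i \<circ> \<sigma> permutes {1..l}" by (intro permutes_compose s_gen_permutes assms)
  have q: "inv_into UNIV \<sigma> permutes {1..l}" by (rule permutes_inv[OF assms(1)])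
  have r: "inv_into UNIV \<sigma> \<circ> s_gen i permutes {1..l}" by (intro permutes_compose s_gen_permutes assms q)
  have "inv_into UNIV (s_gen i \<circ> \<sigma>) = inv_into UNIV \<sigma> \<circ> s_gen i"
    using permutes_inv_o[OF assms(1)] by (intro inv_unique_comp) (auto simp: fun_eq_iff)
  then have "perm_length l (s_gen i \<circ> \<sigma>) = perm_length l (inv_into UNIV \<sigma> \<circ> s_gen i)"
    using ninv_inv[OF p] by (simp add: perm_length_ninv[OF p] perm_length_ninv[OF r])
  moreover have "perm_length l (inv_into UNIV \<sigma>) = perm_length l \<sigma>"
    using ninv_inv[OF assms(1)] by (simp only: perm_length_ninv[OF assms(1)] perm_length_ninv[OF q])
  ultimately show ?thesis using perm_length_right[OF q assms(2)] assms(3) by simp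
qed

context braid_action begin

abbreviation "Tw \<sigma> \<equiv> foldr \<rho> (reduced_expr l \<sigma>)"

lemma Tw_right:
  assumes "\<sigma> permutes {1..l}" "i \<in> {1..<l}" "perm_length l (\<sigma> \<circ> s_gen i) = perm_length l \<sigma> + 1" "v \<in> Z"
  shows "Tw \<sigma> (\<rho> i v) = Tw (\<sigma> \<circ> s_gen i) v"
proof -
  have p: "\<sigma> \<circ> s_gen i permutes {1..l}" by (intro permutes_compose s_gen_permutes assms)
  note r = reduced_expr[OF assms(1)] reduced_expr[OF p]
  have "foldr \<rho> (reduced_expr l \<sigma> @ [i]) v = Tw (\<sigma> \<circ> s_gen i) v"
    using r assms perm_length_ninv[OF assms(1)] perm_length_ninv[OF p]
    by (intro reduced_words_agree) (auto simp: reduced_def word_perm_snoc word_perm_simps(2))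
  then show ?thesis by simp
qed

lemma Tw_left:
  assumes "\<sigma> permutes {1..l}" "i \<in> {1..<l}" "perm_length l (s_gen i \<circ> \<sigma>) = perm_length l \<sigma> + 1" "v \<in> Z"
  shows "\<rho> i (Tw \<sigma> v) = Tw (s_gen i \<circ> \<sigma>) v"
proof -
  have p: "s_gen i \<circ> \<sigma> permutes {1..l}" by (intro permutes_compose s_gen_permutes assms)
  note r = reduced_expr[OF assms(1)] reduced_expr[OF p]
  have "foldr \<rho> (i # reduced_expr l \<sigma>) v = Tw (s_gen i \<circ> \<sigma>) v"
    using r assms perm_length_ninv[OF assms(1)] perm_length_ninv[OF p]
    by (intro reduced_words_agree) (auto simp: reduced_def word_perm_snoc word_perm_simps(2))
  then show ?thesis by simp
qed

lemma Tw_right_down: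
  assumes "\<sigma> permutes {1..l}" "i \<in> {1..<l}" "perm_length l (\<sigma> \<circ> s_gen i) \<noteq> perm_length l \<sigma> + 1" "v \<in> Z"
  shows "Tw \<sigma> v = Tw (\<sigma> \<circ> s_gen i) (\<rho> i v)"
proof -
  have p: "\<sigma> \<circ> s_gen i permutes {1..l}" by (intro permutes_compose s_gen_permutes assms)
  show ?thesis using Tw_right[OF p assms(2) _ assms(4)] perm_length_right[OF assms(1-3)] by simp
qed

lemma Tw_left_down:
  assumes "\<sigma> permutes {1..l}" "i \<in> {1..<l}" "perm_length l (s_gen i \<circ> \<sigma>) \<noteq> perm_length l \<sigma> + 1" "v \<in> Z"
  shows "Tw \<sigma> v = \<rho> i (Tw (s_gen i \<circ> \<sigma>) v)"
proof -
  have p: "s_gen i \<circ> \<sigma> permutes {1..l}" by (intro permutes_compose s_gen_permutes assms)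
  show ?thesis using Tw_left[OF p assms(2) _ assms(4)] perm_length_left[OF assms(1-3)] by simp
qed

lemma Tw_id: "v \<in> Z \<Longrightarrow> Tw id v = v"
  using reduced_words_agree[of "reduced_expr l id" "[]" v] reduced_expr[of id l]
  by (simp add: permutes_id reduced_def word_perm_simps)

lemma Tw_s_gen:
  assumes "i \<in> {1..<l}" "v \<in> Z"
  shows "Tw (s_gen i) v = \<rho> i v"
proof -
  have w: "word_perm [i] = s_gen i" by (simp only: word_perm_simps comp_id)
  have "ninv l (s_gen i) = 1" using ninv_up[OF assms(1), of id] by simp
  then have "reduced l [i]" using assms(1) by (simp only: reduced_def w) simp
  from reduced_words_agree[OF reduced_expr(1)[OF s_gen_permutes[OF assms(1)]] this _ assms(2)]
  show ?thesis by (simp add: reduced_expr(2)[OF s_gen_permutes[OF assms(1)]] w)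
qed

end

section \<open>The duplex Hecke algebra on tensor powers\<close>

text \<open>The projection onto the summand with I = {1, ..., l}; this is how x^(l) acts for the
  identity permutation.\<close>

definition block_proj :: "nat \<Rightarrow> nat \<Rightarrow> vec \<Rightarrow> vec" where
  "block_proj n l = lin_ext (\<lambda>f. if block n f = {1..l} then Mb f else 0)"

lemma lin_block_proj [simp]: "lin (block_proj n l)"
  by (simp add: block_proj_def)

lemma block_proj_Mb: "block_proj n l (Mb f) = (if block n f = {1..l} then Mb f else 0)"
  by (simp add: block_proj_def)

lemmas block_proj_lin [simp] = lin_block_proj[THEN lin_add] lin_block_proj[THEN lin_smul]
  lin_block_proj[THEN lin_zero] lin_block_proj[THEN lin_diff]

lemma block_proj_tpow: "v \<in> tpow N m \<Longrightarrow> block_proj n l v \<in> tpow N m"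
  by (rule lin_tpow[of _ N m]) (auto simp: block_proj_Mb)

lemma block_iff: "block n f = {1..l} \<longleftrightarrow> l \<le> length f \<and> (\<forall>k<length f. f ! k \<le> n \<longleftrightarrow> k < l)"
proof
  assume b: "block n f = {1..l}"
  have "block n f \<subseteq> {1..length f}" by (auto simp: block_def)
  then have "l \<le> length f" unfolding b by (cases l) simp_all
  moreover have "f ! k \<le> n \<longleftrightarrow> k < l" if k: "k < length f" for k
  proof -
    have "f ! k \<le> n \<longleftrightarrow> Suc k \<in> block n f" using k by (simp add: block_def)
    then show ?thesis unfolding b by auto
  qed
  ultimately show "l \<le> length f \<and> (\<forall>k<length f. f ! k \<le> n \<longleftrightarrow> k < l)" by blast
next
  assume a: "l \<le> length f \<and> (\<forall>k<length f. f ! k \<le> n \<longleftrightarrow> k < l)"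
  show "block n f = {1..l}"
  proof (rule Set.set_eqI)
    fix x
    show "x \<in> block n f \<longleftrightarrow> x \<in> {1..l}"
    proof (cases x)
      case (Suc k)
      then have "x \<in> block n f \<longleftrightarrow> k < length f \<and> f ! k \<le> n" by (simp add: block_def Suc_le_eq)
      also have "\<dots> \<longleftrightarrow> k < l"
        using a[THEN conjunct1] a[THEN conjunct2, rule_format, of k] by linarith
      finally show ?thesis using Suc by auto
    qed (simp add: block_def)
  qed
qed

lemma block_proj_idem [simp]: "block_proj n l (block_proj n k v) = (if l = k then block_proj n l v else 0)"
proof -
  have "{Suc 0..l} = {Suc 0..k} \<longleftrightarrow> l = k" using card_atLeastAtMost[of 1 l] card_atLeastAtMost[of 1 k] by auto
  then show ?thesis
    by (cases "l = k") (simp_all, (rule lin_eqI[of _ _ v]; auto simp: lin_def block_proj_Mb)+)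
qed

text \<open>The exchange of the neighbouring places i and i + 1 preserves the initial segment {1,
  ..., l} unless it straddles its end, that is, unless i = l.\<close>

lemma block_permute:
  assumes "i \<in> {1..<length f}" "i \<noteq> l"
  shows "block n (permute_list (transpose (i - 1) i) f) = {1..l} \<longleftrightarrow> block n f = {1..l}"
proof -
  let ?t = "transpose (i - 1) i"
  let ?f = "permute_list ?t f"
  have t: "?t k < length f \<longleftrightarrow> k < length f" "?t k < l \<longleftrightarrow> k < l" for k
    using assms by (auto simp: transpose_def)
  have nth: "?f ! k = f ! ?t k" if "k < length f" for k
    using that by (simp add: permute_list_def)
  have "(\<forall>k<length f. ?f ! k \<le> n \<longleftrightarrow> k < l) \<longleftrightarrow> (\<forall>k<length f. f ! ?t k \<le> n \<longleftrightarrow> ?t k < l)"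
    using nth t(2) by simp
  also have "\<dots> \<longleftrightarrow> (\<forall>k<length f. f ! k \<le> n \<longleftrightarrow> k < l)"
    by (metis t(1) transpose_involutory)
  finally show ?thesis unfolding block_iff by simp
qed

lemma hecke_Mb': "hecke_op i (Mb f) =
    (let f' = permute_list (transpose (i - 1) i) f in
     if f ! (i - 1) < f ! i then Mb f'
     else if f ! (i - 1) > f ! i then Mb f' + smul (inverse qq - qq) (Mb f)
     else smul (inverse qq) (Mb f))"
  by (simp add: hecke_op_def)

lemma hecke_block_proj:
  assumes "v \<in> tpow N m" "i \<in> {1..<m}" "i \<noteq> l"
  shows "hecke_op i (block_proj n l v) = block_proj n l (hecke_op i v)"
proof (rule lin_eq_tpow[OF _ _ _ assms(1)])
  fix f assume "f \<in> bas N m"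
  then have "block n (permute_list (transpose (i - 1) i) f) = {1..l} \<longleftrightarrow> block n f = {1..l}"
    using assms(2,3) by (intro block_permute) (auto simp: bas_def)
  then show "hecke_op i (block_proj n l (Mb f)) = block_proj n l (hecke_op i (Mb f))"
    by (cases "block n f = {1..l}") (simp_all add: block_proj_Mb hecke_Mb' Let_def)
qed (auto simp: lin_def)

text \<open>Behind the place l all factors are \<eta>_(n+1), so T_(s_i) meets equal entries and acts
  by q^-1.\<close>

lemma hecke_block_proj_tail:
  assumes "v \<in> tpow (n + 1) m" "i \<in> {l<..<m}"
  shows "hecke_op i (block_proj n l v) = smul (inverse qq) (block_proj n l v)"
proof (rule lin_eq_tpow[OF _ _ _ assms(1)])
  fix f assume f: "f \<in> bas (n + 1) m"
  have le: "f ! k \<le> n + 1" if "k < m" for k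
  proof -
    have "f ! k \<in> set f" using f that by (simp add: bas_def)
    then show ?thesis using f by (auto simp: bas_def)
  qed
  have "f ! k = n + 1" if b: "block n f = {1..l}" and k: "l \<le> k" "k < m" for k
  proof -
    have "k < length f" using f k by (simp add: bas_def)
    then have "\<not> f ! k \<le> n" using b k(1) unfolding block_iff by auto
    with le[OF k(2)] show ?thesis by simp
  qed
  from this[of "i - 1"] this[of i] have "f ! (i - 1) = f ! i" if "block n f = {1..l}"
    using that assms(2) by auto
  then show "hecke_op i (block_proj n l (Mb f)) = smul (inverse qq) (block_proj n l (Mb f))"
    by (cases "block n f = {1..l}") (simp_all add: block_proj_Mb hecke_Mb' Let_def)
qed (auto simp: lin_def vec_norm mult_ac)

text \<open>A globally linear form of \<open>duplex_op\<close>: project onto the block, then apply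
  T_\<sigma> through the Hecke operators on the whole tensor. The word for \<sigma> uses only
  letters below l, so only the first l places are touched.\<close>

primrec dop :: "nat \<Rightarrow> dgen \<Rightarrow> vec \<Rightarrow> vec" where
  "dop n (TT i) = hecke_op i"
| "dop n (XX l \<sigma>) = (\<lambda>v. foldr hecke_op (reduced_expr l \<sigma>) (block_proj n l v))"

lemma lin_dop [simp]: "lin (dop n g)"
  by (cases g) (auto intro: lin_comp[OF lin_foldr])

lemma foldr_hecke_lin:
  "foldr hecke_op w (u + v) = foldr hecke_op w u + foldr hecke_op w v"
  "foldr hecke_op w (smul c v) = smul c (foldr hecke_op w v)"
  "foldr hecke_op w 0 = 0"
  by (simp_all add: lin_simps[OF lin_foldr])

lemma braid_action_tpow: "l \<le> m \<Longrightarrow> braid_action l (tpow N m) hecke_op"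
  by unfold_locales (auto intro!: hecke_tpow hecke_braid_tpow[of _ N m] hecke_far_tpow[of _ N m])

lemma foldr_hecke_tpow: "set w \<subseteq> {1..<m} \<Longrightarrow> v \<in> tpow N m \<Longrightarrow> foldr hecke_op w v \<in> tpow N m"
  by (rule braid_action.foldr_closed[OF braid_action_tpow[of m m]]) auto

lemma foldr_hecke_block_proj:
  "set w \<subseteq> {1..<l} \<Longrightarrow> l \<le> m \<Longrightarrow> v \<in> tpow N m \<Longrightarrow>
     block_proj n l (foldr hecke_op w v) = foldr hecke_op w (block_proj n l v)"
proof (induction w)
  case (Cons i w)
  have "foldr hecke_op w v \<in> tpow N m" using Cons by (intro foldr_hecke_tpow) auto
  then have "block_proj n l (hecke_op i (foldr hecke_op w v)) = hecke_op i (block_proj n l (foldr hecke_op w v))"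
    using Cons.prems by (intro hecke_block_proj[symmetric, of _ N m]) auto
  with Cons show ?case by simp
qed simp

section \<open>Identification with the given action of the duplex Hecke algebra\<close>

lemma lin_tensor_Mb: "lin (tensor (Mb f))"
  by (simp add: tensor_Mb[abs_def])

lemma tensor_cons: "tensor (cons a v) w = cons a (tensor v w)"
proof (rule lin_eqI[of _ _ v])
  show "tensor (cons a (Mb f)) w = cons a (tensor (Mb f) w)" for f
    by (rule lin_eqI[of "tensor (cons a (Mb f))" "\<lambda>w. cons a (tensor (Mb f) w)"])
       (simp_all add: lin_tensor_Mb lin_comp[OF lin_cons] tensor_Mb_Mb)
qed (use lin_add[OF tensor_lin] lin_smul[OF tensor_lin] in \<open>auto simp: lin_def\<close>)

lemma tensor_hecke_Mb: "Suc i < length f \<Longrightarrow> tensor (hecke_op (Suc i) (Mb f)) w = hecke_op (Suc i) (tensor (Mb f) w)"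
proof (induction i arbitrary: f)
  case 0
  with list_two obtain a b g where f: "Mb f = cons a (cons b (Mb g))" by blast
  show ?case by (simp add: f lin_add[OF tensor_lin] lin_smul[OF tensor_lin] tensor_cons del: cons_Mb)
next
  case (Suc i)
  with list_one obtain a g where f: "Mb f = cons a (Mb g)" "Suc i < length g" by blast
  with Suc.IH[of g] show ?case by (simp add: f(1) tensor_cons del: cons_Mb)
qed

lemma tensor_hecke:
  assumes "v \<in> tpow N l" "i \<in> {1..<l}"
  shows "tensor (hecke_op i v) w = hecke_op i (tensor v w)"
proof (rule lin_eq_tpow[OF _ _ _ assms(1)])
  show "tensor (hecke_op i (Mb f)) w = hecke_op i (tensor (Mb f) w)" if "f \<in> bas N l" for f
    using tensor_hecke_Mb[of "i - 1" f w] that assms(2) by (auto simp: bas_def)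
qed (use lin_add[OF tensor_lin] lin_smul[OF tensor_lin] in \<open>auto simp: lin_def\<close>)

lemma tensor_foldr_hecke:
  "v \<in> tpow N l \<Longrightarrow> set w \<subseteq> {1..<l} \<Longrightarrow> tensor (foldr hecke_op w v) u = foldr hecke_op w (tensor v u)"
proof (induction w)
  case (Cons i w)
  have "foldr hecke_op w v \<in> tpow N l" using Cons by (intro foldr_hecke_tpow) auto
  with Cons show ?case using tensor_hecke[of "foldr hecke_op w v" N l i] by simp
qed simp

lemma Psi_gen: "i \<in> {1..<m} \<Longrightarrow> v \<in> tpow N m \<Longrightarrow> Psi N m (Hecke_class m (gen i)) v = hecke_op i v"
  using presented_rep.pres_rep_class[OF presented_Hecke, of "gen i" m N]
  by (simp add: Psi_def Hecke_class_def carrier_free_alg_intros)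

lemma frep_word: "(\<And>g. lin (\<rho> g)) \<Longrightarrow> frep \<rho> (prod_list (map gen w)) v = foldr \<rho> w v"
  by (induction w arbitrary: v) (auto simp: frep_mult)

lemma word_carrier: "set w \<subseteq> S \<Longrightarrow> prod_list (map gen w) \<in> carrier (free_alg S)"
  by (induction w) (auto intro!: carrier_free_alg_intros)

lemma Psi_T_perm:
  assumes "\<sigma> permutes {1..l}" "v \<in> tpow N l"
  shows "Psi N l (T_perm l \<sigma>) v = foldr hecke_op (reduced_expr l \<sigma>) v"
  using presented_rep.pres_rep_class[OF presented_Hecke word_carrier[OF reduced_expr(3)[OF assms(1)]], of N] assms(2)
  by (simp add: Psi_def T_perm_def Hecke_class_def frep_word)

lemma duplex_op_XX:
  assumes "\<sigma> permutes {1..l}" "f \<in> bas (n + 1) r"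
  shows "duplex_op n r (XX l \<sigma>) (Mb f) = dop n (XX l \<sigma>) (Mb f)"
proof (cases "block n f = {1..l}")
  case True
  have len: "l \<le> length f" and le: "\<forall>k<length f. f ! k \<le> n \<longleftrightarrow> k < l"
    using True unfolding block_iff by blast+
  \<comment> \<open>\<open>Psi n l\<close> is determined only on tensors in \<eta>_1, ..., \<eta>_n,
    so the first \<open>l\<close> entries must avoid n + 1.\<close>
  have "set (take l f) \<subseteq> {1..n}"
  proof
    fix x assume x: "x \<in> set (take l f)"
    then obtain k where "k < l" "k < length f" "x = f ! k" by (auto simp: in_set_conv_nth)
    with le have "x \<le> n" by blast
    moreover have "x \<in> {1..n + 1}" using x assms(2) in_set_takeD[of x l f] by (auto simp: bas_def)
    ultimately show "x \<in> {1..n}" by auto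
  qed
  then have t: "Mb (take l f) \<in> tpow n l" using len by (simp add: bas_def)
  show ?thesis using True
    by (simp add: tensor_op_Mb Psi_T_perm[OF assms(1) t] tensor_foldr_hecke[OF t reduced_expr(3)[OF assms(1)]]
        tensor_Mb_Mb block_proj_Mb)
next
  case False
  then show ?thesis by (simp add: block_proj_Mb foldr_hecke_lin)
qed

lemma dgens_carrier:
  "i \<in> {1..<r} \<Longrightarrow> tt i \<in> carrier (free_alg (dgens r))"
  "l \<in> {1..r} \<Longrightarrow> \<sigma> permutes {1..l} \<Longrightarrow> xx l \<sigma> \<in> carrier (free_alg (dgens r))"
  by (auto intro!: carrier_free_alg_intros simp: dgens_def)

lemma s_gen_comp_permutes:
  assumes "\<sigma> permutes {1..l}" "i \<in> {1..<l}"
  shows "s_gen i \<circ> \<sigma> permutes {1..l}" "\<sigma> \<circ> s_gen i permutes {1..l}"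
  by (intro permutes_compose s_gen_permutes assms)+

lemma x_carrier:
  assumes "l \<in> {1..r}" "\<sigma> permutes {1..l}" "i \<in> {1..<l}"
  shows "x_right l \<sigma> i \<in> carrier (free_alg (dgens r))" "x_left l i \<sigma> \<in> carrier (free_alg (dgens r))"
  unfolding x_right_def x_left_def using s_gen_comp_permutes[OF assms(2,3)] assms(1,2)
  by (auto simp del: One_nat_def intro!: carrier_free_alg_intros(3,5,7,8) dgens_carrier)

lemma drels_carrier: "drels r \<subseteq> carrier (free_alg (dgens r))"
proof -
  have "hecke_rels tt r \<subseteq> carrier (free_alg (dgens r))"
    by (rule hecke_rels_carrier) (rule dgens_carrier)
  then show ?thesis
    unfolding drels_def
    by (intro Un_least UN_least)
       (auto simp del: One_nat_def intro!: carrier_free_alg_intros(3,5,7,8) dgens_carrier x_carrier s_gen_permutes)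
qed

lemma dop_tpow: 
  assumes "g \<in> dgens r" "v \<in> tpow N r" shows "dop n g v \<in> tpow N r"
proof (cases g)
  case (XX l \<sigma>)
  with assms(1) have "l \<in> {1..r}" "\<sigma> permutes {1..l}" by (auto simp: dgens_def)
  then show ?thesis
    using reduced_expr(3)[of \<sigma> l] by (auto simp: XX intro!: foldr_hecke_tpow block_proj_tpow assms(2))
qed (use assms in \<open>auto simp: dgens_def intro!: hecke_tpow\<close>)

text \<open>x^(l)_\<sigma> acts as T_\<sigma> P with a projection P that commutes with T_(s_i) for i
  < l. So both products x_\<sigma> x_(s_i) and x_\<sigma> T_(s_i) become T_\<sigma> T_(s_i) P, and
  the relations reduce to multiplication in the Hecke algebra.\<close>

lemma drels_zero:
  assumes "p \<in> drels r" and v: "v \<in> tpow (n + 1) r"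
  shows "frep (dop n) p v = 0"
proof -
  note fs = frep_add frep_diff frep_mult[OF lin_dop]
  {
    fix l \<sigma> assume l: "l \<in> {1..r}" and \<sigma>: "\<sigma> permutes {1..l}"
    have "l \<le> r" using l by simp
    interpret braid_action l "tpow (n + 1) r" hecke_op by (rule braid_action_tpow[OF \<open>l \<le> r\<close>])
    let ?P = "block_proj n l"
    have Pv: "?P v \<in> tpow (n + 1) r" by (rule block_proj_tpow[OF v])
    have Tw_P: "?P (Tw \<tau> u) = Tw \<tau> (?P u)" if "\<tau> permutes {1..l}" "u \<in> tpow (n + 1) r" for \<tau> u
      using foldr_hecke_block_proj[OF reduced_expr(3)[OF that(1)] \<open>l \<le> r\<close> that(2)] .
    have Tw_W: "Tw \<tau> u \<in> tpow (n + 1) r" if "\<tau> permutes {1..l}" "u \<in> tpow (n + 1) r" for \<tau> u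
      using foldr_closed[OF reduced_expr(3)[OF that(1)] that(2)] .
    {
      fix i assume i: "i \<in> {1..<l}"
      then have i': "i \<in> {1..<r}" "i \<noteq> l" using \<open>l \<le> r\<close> by auto
      note perms = s_gen_permutes[OF i] s_gen_comp_permutes[OF \<sigma> i]
      have comm: "?P (hecke_op i u) = hecke_op i (?P u)" if "u \<in> tpow (n + 1) r" for u
        using hecke_block_proj[OF that i'] by simp
      have right: "Tw \<sigma> (hecke_op i (?P v)) = frep (dop n) (x_right l \<sigma> i) v"
      proof (cases "perm_length l (\<sigma> \<circ> s_gen i) = perm_length l \<sigma> + 1")
        case True
        then show ?thesis using Tw_right[OF \<sigma> i True Pv] by (simp add: x_right_def)
      next
        case False
        note down = Tw_right_down[OF \<sigma> i False]
        \<comment> \<open>When the length drops, T_\<sigma> = T_(\<sigma> s_i) T_i, and the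
          quadratic relation applies to the two adjacent T_i.\<close>
        have "Tw \<sigma> (hecke_op i (?P v)) = Tw (\<sigma> \<circ> s_gen i) (?P v + smul (inverse qq - qq) (hecke_op i (?P v)))"
          using down[OF hecke_tpow[OF Pv i'(1)]] hecke_quad_tpow[OF Pv i'(1)] by simp
        then show ?thesis using False down[OF Pv] by (simp add: x_right_def fs foldr_hecke_lin)
      qed
      have left: "hecke_op i (Tw \<sigma> (?P v)) = frep (dop n) (x_left l i \<sigma>) v"
      proof (cases "perm_length l (s_gen i \<circ> \<sigma>) = perm_length l \<sigma> + 1")
        case True
        then show ?thesis using Tw_left[OF \<sigma> i True Pv] by (simp add: x_left_def)
      next
        case False
        note down = Tw_left_down[OF \<sigma> i False Pv]
        have "hecke_op i (Tw \<sigma> (?P v)) = hecke_op i (hecke_op i (Tw (s_gen i \<circ> \<sigma>) (?P v)))"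
          using down by simp
        also have "\<dots> = Tw (s_gen i \<circ> \<sigma>) (?P v) + smul (inverse qq - qq) (Tw \<sigma> (?P v))"
          using hecke_quad_tpow[OF Tw_W[OF perms(2) Pv] i'(1)] down by simp
        finally show ?thesis using False by (simp add: x_left_def fs)
      qed
      have "Tw \<sigma> (?P (Tw (s_gen i) (?P v))) = Tw \<sigma> (hecke_op i (?P v))"
        using Tw_s_gen[OF i Pv] comm[OF Pv] by simp
      moreover have "Tw \<sigma> (?P (hecke_op i v)) = Tw \<sigma> (hecke_op i (?P v))" using comm[OF v] by simp
      moreover have "Tw (s_gen i) (?P (Tw \<sigma> (?P v))) = hecke_op i (Tw \<sigma> (?P v))"
        using Tw_P[OF \<sigma> Pv] Tw_s_gen[OF i Tw_W[OF \<sigma> Pv]] by simp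
      moreover assume "p \<in> {xx l \<sigma> * xx l (s_gen i) - x_right l \<sigma> i, xx l \<sigma> * tt i - x_right l \<sigma> i,
            xx l (s_gen i) * xx l \<sigma> - x_left l i \<sigma>, tt i * xx l \<sigma> - x_left l i \<sigma>}"
      ultimately have ?thesis using left right by (auto simp: fs)
    } moreover {
      fix i assume i: "i \<in> {l<..<r}"
      then have i': "i \<in> {1..<r}" "i \<noteq> l" using l by auto
      have "?P (hecke_op i v) = smul (inverse qq) (?P v)"
        using hecke_block_proj[OF v i'] hecke_block_proj_tail[OF v i] by simp
      moreover have "hecke_op i (Tw \<sigma> (?P v)) = smul (inverse qq) (Tw \<sigma> (?P v))"
        using Tw_P[OF \<sigma> v] hecke_block_proj_tail[OF Tw_W[OF \<sigma> v] i] by simp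
      moreover assume "p \<in> {tt i * xx l \<sigma> - scal (inverse qq) * xx l \<sigma>, xx l \<sigma> * tt i - scal (inverse qq) * xx l \<sigma>}"
      ultimately have ?thesis by (auto simp: fs foldr_hecke_lin)
    } moreover {
      fix k \<gamma> assume k: "k \<in> {1..r}" "k \<noteq> l" "\<gamma> permutes {1..k}" "p = xx l \<sigma> * xx k \<gamma>"
      \<comment> \<open>Once the projection for \<open>k\<close> is moved to the outside it meets
        the one for \<open>l\<close>, and their product is zero.\<close>
      have "block_proj n k (foldr hecke_op (reduced_expr k \<gamma>) v) = foldr hecke_op (reduced_expr k \<gamma>) (block_proj n k v)"
        using foldr_hecke_block_proj[OF reduced_expr(3)[OF k(3)] _ v] k(1) by simp
      then have "?P (foldr hecke_op (reduced_expr k \<gamma>) (block_proj n k v)) = ?P (block_proj n k (foldr hecke_op (reduced_expr k \<gamma>) v))"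
        by (rule arg_cong[OF sym])
      then have ?thesis using k(2,4) by (simp add: fs foldr_hecke_lin)
    }
    moreover note calculation
  } note 1 = this
  from assms(1) consider (a) "p \<in> hecke_rels tt r"
    | (b) l \<sigma> i where "l \<in> {1..r}" "\<sigma> permutes {1..l}" "i \<in> {1..<l}"
        "p \<in> {xx l \<sigma> * xx l (s_gen i) - x_right l \<sigma> i, xx l \<sigma> * tt i - x_right l \<sigma> i,
            xx l (s_gen i) * xx l \<sigma> - x_left l i \<sigma>, tt i * xx l \<sigma> - x_left l i \<sigma>}"
    | (c) l \<sigma> i where "l \<in> {1..r}" "\<sigma> permutes {1..l}" "i \<in> {l<..<r}"
        "p \<in> {tt i * xx l \<sigma> - scal (inverse qq) * xx l \<sigma>, xx l \<sigma> * tt i - scal (inverse qq) * xx l \<sigma>}"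
    | (d) l \<sigma> k \<gamma> where "l \<in> {1..r}" "\<sigma> permutes {1..l}" "k \<in> {1..r}" "k \<noteq> l" "\<gamma> permutes {1..k}"
        "p = xx l \<sigma> * xx k \<gamma>"
    unfolding drels_def by blast
  then show ?thesis
  proof cases
    case a
    then show ?thesis using v by (rule hecke_rels_zero[OF lin_dop, rotated]) (auto simp: fun_eq_iff)
  next
    case b
    then show ?thesis using 1(1) by blast
  next
    case c
    then show ?thesis using 1(2) by blast
  next
    case d
    then show ?thesis using 1(3) by blast
  qed
qed

lemma presented_HH: "presented_rep (dgens r) (drels r) (n + 1) r (duplex_op n r) (dop n)"
proof
  fix g v assume g: "g \<in> dgens r" and v: "v \<in> tpow (n + 1) r"
  show "duplex_op n r g v = dop n g v"
  proof (cases g)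
    case (TT i)
    then show ?thesis using g v by (auto simp: dgens_def Psi_gen simp del: One_nat_def)
  next
    case (XX l \<sigma>)
    then have \<sigma>: "\<sigma> permutes {1..l}" using g by (auto simp: dgens_def)
    have "lin (duplex_op n r (XX l \<sigma>))" by simp
    from lin_eq_tpow[OF this lin_dop duplex_op_XX[OF \<sigma>] v] show ?thesis unfolding XX .
  qed
qed (auto simp: dop_tpow drels_zero simp del: One_nat_def intro: subsetD[OF drels_carrier])

section \<open>Orthogonal projections and the double commutant\<close>

definition dot :: "'j set \<Rightarrow> ('j \<Rightarrow> 'a) \<Rightarrow> ('j \<Rightarrow> 'a) \<Rightarrow> 'a::linordered_field" where
  "dot J u v = (\<Sum>j\<in>J. u j * v j)"

text \<open>Vectors are functions on the whole index type, while \<open>dot J\<close> sees only the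
  coordinates in \<open>J\<close>; the other coordinates are left free.\<close>

definition is_subspace :: "('j \<Rightarrow> 'a::linordered_field) set \<Rightarrow> bool" where
  "is_subspace C \<longleftrightarrow> (\<lambda>j. 0) \<in> C \<and> (\<forall>u\<in>C. \<forall>v\<in>C. (\<lambda>j. u j + v j) \<in> C) \<and> (\<forall>a. \<forall>u\<in>C. (\<lambda>j. a * u j) \<in> C)"

lemma is_subspaceD:
  assumes "is_subspace C"
  shows "(\<lambda>j. 0) \<in> C" "u \<in> C \<Longrightarrow> v \<in> C \<Longrightarrow> (\<lambda>j. u j + v j) \<in> C" "u \<in> C \<Longrightarrow> (\<lambda>j. a * u j) \<in> C"
  using assms by (auto simp: is_subspace_def)

lemma is_subspace_diff:
  assumes "is_subspace C" "u \<in> C" "v \<in> C"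
  shows "(\<lambda>j. u j - v j) \<in> C"
  using is_subspaceD(2)[OF assms(1,2) is_subspaceD(3)[OF assms(1,3), of "-1"]] by simp

lemma is_subspace_sum:
  assumes "is_subspace C" "\<And>i. i \<in> I \<Longrightarrow> u i \<in> C"
  shows "(\<lambda>j. \<Sum>i\<in>I. a i * u i j) \<in> C"
  using assms(2)
proof (induction I rule: infinite_finite_induct)
  case (insert i I)
  then show ?case
    using is_subspaceD(2)[OF assms(1) is_subspaceD(3)[OF assms(1), of "u i" "a i"], of "\<lambda>j. \<Sum>i\<in>I. a i * u i j"] by simp
qed (use is_subspaceD(1)[OF assms(1)] in auto)

lemma dot_add: "dot J (\<lambda>j. u j + v j) w = dot J u w + dot J v w"
  and dot_diff: "dot J (\<lambda>j. u j - v j) w = dot J u w - dot J v w"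
  and dot_scale: "dot J (\<lambda>j. a * u j) w = a * dot J u w"
  and dot_add': "dot J w (\<lambda>j. u j + v j) = dot J w u + dot J w v"
  and dot_scale': "dot J w (\<lambda>j. a * u j) = a * dot J w u"
  by (simp_all add: dot_def algebra_simps sum.distrib sum_subtractf sum_distrib_left)

lemma dot_commute: "dot J u v = dot J v u"
  by (simp add: dot_def mult.commute)

lemma dot_sum: "dot J (\<lambda>j. \<Sum>i\<in>I. a i * u i j) w = (\<Sum>i\<in>I. a i * dot J (u i) w)"
  unfolding dot_def sum_distrib_left sum_distrib_right
  by (subst sum.swap) (simp add: mult.assoc)

lemma dot_self_zero: "finite J \<Longrightarrow> dot J u u = 0 \<Longrightarrow> j \<in> J \<Longrightarrow> u j = 0"
  unfolding dot_def by (subst (asm) sum_nonneg_eq_0_iff) auto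

text \<open>Induction on the coordinates instead of a choice of basis: either all of
  \<open>C\<close> vanishes at the new coordinate, or one further vector completes the part
  vanishing there. Positivity enters in the division by \<open>dot e e\<close>.\<close>

lemma orthogonal_projection:
  assumes "finite J" "is_subspace C"
  shows "\<exists>c\<in>C. \<forall>d\<in>C. dot J (\<lambda>j. v j - c j) d = 0"
  using assms
proof (induction J arbitrary: C v rule: finite_induct)
  case empty
  then show ?case by (intro bexI[of _ "\<lambda>j. 0"]) (auto simp: dot_def is_subspace_def)
next
  case (insert i J)
  let ?C0 = "{d \<in> C. d i = 0}"
  note C = \<open>is_subspace C\<close>
  have "is_subspace ?C0" using C by (auto simp: is_subspace_def)
  then have IH: "\<exists>c\<in>?C0. \<forall>d\<in>?C0. dot J (\<lambda>j. w j - c j) d = 0" for w by (rule insert.IH)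
  have ip0: "dot (insert i J) w d = dot J w d" if "d \<in> ?C0" for w d
    using insert.hyps that by (simp add: dot_def)
  show ?case
  proof (cases "C = ?C0")
    case True
    with IH[of v] ip0 show ?thesis by (metis (no_types, lifting))
  next
    case False
    then obtain e0 where "e0 \<in> C" "e0 i \<noteq> 0" by auto
    define e1 where "e1 = (\<lambda>j. inverse (e0 i) * e0 j)"
    have e1: "e1 \<in> C" "e1 i = 1"
      using is_subspaceD(3)[OF C \<open>e0 \<in> C\<close>] \<open>e0 i \<noteq> 0\<close> by (auto simp: e1_def)
    obtain c1 where c1: "c1 \<in> ?C0" "\<forall>d\<in>?C0. dot J (\<lambda>j. e1 j - c1 j) d = 0" using IH by blast
    \<comment> \<open>\<open>e\<close> still has coordinate 1 at \<open>i\<close> and is orthogonal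
      to \<open>?C0\<close>, so \<open>C\<close> is the orthogonal sum of \<open>?C0\<close> and the
      line through \<open>e\<close>.\<close>
    define e where "e = (\<lambda>j. e1 j - c1 j)"
    have e: "e \<in> C" "e i = 1" using is_subspace_diff[OF C] e1 c1(1) by (auto simp: e_def)
    have e_orth: "dot (insert i J) e d = 0" if "d \<in> ?C0" for d
      using that c1(2) ip0 by (simp add: e_def)
    have "dot (insert i J) e e \<noteq> 0"
      using dot_self_zero[of "insert i J" e i] insert.hyps e(2) by auto
    obtain c0 where c0: "c0 \<in> ?C0" "\<forall>d\<in>?C0. dot J (\<lambda>j. v j - c0 j) d = 0" using IH by blast
    define t where "t = dot (insert i J) v e / dot (insert i J) e e"
    have t: "t * dot (insert i J) e e = dot (insert i J) v e"
      using \<open>dot (insert i J) e e \<noteq> 0\<close> by (simp add: t_def)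
    define c where "c = (\<lambda>j. c0 j + t * e j)"
    have "c \<in> C" unfolding c_def using c0(1) e(1) by (intro is_subspaceD(2,3)[OF C]) auto
    moreover have "dot (insert i J) (\<lambda>j. v j - c j) d = 0" if "d \<in> C" for d
    proof -
      let ?d0 = "\<lambda>j. d j - d i * e j"
      have d0: "?d0 \<in> ?C0" using is_subspace_diff[OF C that is_subspaceD(3)[OF C e(1)]] e(2) by simp
      have "dot (insert i J) (\<lambda>j. v j - c0 j) ?d0 = 0" using c0(2) d0 ip0 by auto
      then have 1: "dot (insert i J) (\<lambda>j. v j - c j) ?d0 = 0"
        using e_orth[OF d0] by (simp add: c_def dot_diff dot_add dot_scale)
      have "dot (insert i J) c0 e = 0" using e_orth[OF c0(1)] by (simp add: dot_commute)
      then have 2: "dot (insert i J) (\<lambda>j. v j - c j) e = 0"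
        using t by (simp add: c_def dot_diff dot_add dot_scale)
      have "dot (insert i J) (\<lambda>j. v j - c j) d = dot (insert i J) (\<lambda>j. v j - c j) (\<lambda>j. ?d0 j + d i * e j)"
        by simp
      also have "\<dots> = 0" unfolding dot_add' dot_scale' using 1 2 by simp
      finally show ?thesis .
    qed
    ultimately show ?thesis by blast
  qed
qed

section \<open>Matrices, the trace form and the double commutant theorem\<close>

definition mat_prod :: "'i set \<Rightarrow> ('i \<times> 'i \<Rightarrow> 'a) \<Rightarrow> ('i \<times> 'i \<Rightarrow> 'a) \<Rightarrow> ('i \<times> 'i \<Rightarrow> 'a::comm_ring_1)" where
  "mat_prod B X Y = (\<lambda>(f, g). \<Sum>h\<in>B. X (f, h) * Y (h, g))"

lemma mat_prod_apply: "mat_prod B X Y (f, g) = (\<Sum>h\<in>B. X (f, h) * Y (h, g))"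
  by (simp add: mat_prod_def)

lemma dot_prod: "dot (A \<times> B) u v = (\<Sum>f\<in>A. \<Sum>g\<in>B. u (f, g) * v (f, g))"
  by (simp add: dot_def sum.cartesian_product case_prod_unfold)

lemma dot_mm_adjoint:
  "dot (B \<times> B) (mat_prod B X Y) Z = dot (B \<times> B) Y (mat_prod B (\<lambda>(f, g). X (g, f)) Z)"
proof -
  have "dot (B \<times> B) (mat_prod B X Y) Z = (\<Sum>f\<in>B. \<Sum>g\<in>B. \<Sum>h\<in>B. X (f, h) * Y (h, g) * Z (f, g))"
    by (simp add: dot_prod mat_prod_apply sum_distrib_right)
  also have "\<dots> = (\<Sum>f\<in>B. \<Sum>h\<in>B. \<Sum>g\<in>B. X (f, h) * Y (h, g) * Z (f, g))"
    by (intro sum.cong refl sum.swap)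
  also have "\<dots> = (\<Sum>h\<in>B. \<Sum>f\<in>B. \<Sum>g\<in>B. X (f, h) * Y (h, g) * Z (f, g))"
    by (rule sum.swap)
  also have "\<dots> = (\<Sum>h\<in>B. \<Sum>g\<in>B. \<Sum>f\<in>B. X (f, h) * Y (h, g) * Z (f, g))"
    by (intro sum.cong refl sum.swap)
  also have "\<dots> = dot (B \<times> B) Y (mat_prod B (\<lambda>(f, g). X (g, f)) Z)"
    by (simp add: dot_prod mat_prod_apply sum_distrib_left mult_ac)
  finally show ?thesis .
qed

text \<open>Let \<open>p y\<close> be the element of \<open>C\<close> that represents the coordinate
  functional at \<open>y\<close> under the trace form. The entries of the \<open>p y\<close> form
  matrices \<open>?Q\<close> that commute with \<open>C\<close>, hence with \<open>A\<close>. Write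
  A = A 1, where 1 is the sum of the \<open>p (f', f')\<close>; the commutation moves the entries of
  \<open>A\<close> from the argument of \<open>p\<close> to its index and exhibits \<open>A\<close>
  as the combination of the \<open>p y\<close> with coefficients \<open>A y\<close>.\<close>

lemma double_commutant:
  fixes C :: "('i \<times> 'i \<Rightarrow> 'a::linordered_field) set"
  assumes B: "finite B" and C: "is_subspace C"
    and mult: "\<And>X Y. X \<in> C \<Longrightarrow> Y \<in> C \<Longrightarrow> mat_prod B X Y \<in> C"
    and transp: "\<And>X. X \<in> C \<Longrightarrow> (\<lambda>(f, g). X (g, f)) \<in> C"
    and one: "(\<lambda>(f, g). if f = g then 1 else 0) \<in> C"
    and comm: "\<And>Q. (\<And>X f g. X \<in> C \<Longrightarrow> f \<in> B \<Longrightarrow> g \<in> B \<Longrightarrow> mat_prod B X Q (f, g) = mat_prod B Q X (f, g)) \<Longrightarrow>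
      (\<And>f g. f \<in> B \<Longrightarrow> g \<in> B \<Longrightarrow> mat_prod B A Q (f, g) = mat_prod B Q A (f, g))"
  shows "\<exists>c\<in>C. \<forall>f\<in>B. \<forall>g\<in>B. A (f, g) = c (f, g)"
proof -
  let ?J = "B \<times> B"
  have fin: "finite ?J" using B by simp
  have uniq: "c x = c' x" if "c \<in> C" "c' \<in> C" "\<And>d. d \<in> C \<Longrightarrow> dot ?J c d = dot ?J c' d" "x \<in> ?J" for c c' x
  proof -
    have "(\<lambda>j. c j - c' j) \<in> C" by (rule is_subspace_diff[OF C that(1,2)])
    then have "dot ?J (\<lambda>j. c j - c' j) (\<lambda>j. c j - c' j) = 0" using that(3) by (simp add: dot_diff)
    then show ?thesis using dot_self_zero[OF fin _ that(4)] by fastforce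
  qed
  \<comment> \<open>The representing element is the orthogonal projection of the matrix unit at
    \<open>y\<close>.\<close>
  have "\<exists>c\<in>C. \<forall>d\<in>C. dot ?J c d = d y" if y: "y \<in> ?J" for y
  proof -
    obtain c where c: "c \<in> C" "\<forall>d\<in>C. dot ?J (\<lambda>j. (if j = y then 1 else 0) - c j) d = 0"
      using orthogonal_projection[OF fin C, of "\<lambda>j. if j = y then 1 else 0"] by blast
    have eq: "dot ?J (\<lambda>j. if j = y then 1 else 0) d = d y" for d
      using y fin by (simp add: dot_def if_distrib[of "\<lambda>x. x * _"] cong: if_cong)
    have "dot ?J c d = d y" if "d \<in> C" for d
    proof -
      have "dot ?J (\<lambda>j. (if j = y then 1 else 0) - c j) d = 0" using c(2) that by blast
      then show ?thesis unfolding dot_diff eq by simp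
    qed
    with c(1) show ?thesis by blast
  qed
  then obtain p where p: "\<And>y. y \<in> ?J \<Longrightarrow> p y \<in> C" and rep: "\<And>y d. y \<in> ?J \<Longrightarrow> d \<in> C \<Longrightarrow> dot ?J (p y) d = d y"
    by metis
  have key: "(\<Sum>h\<in>B. A (f, h) * p (f', g') (h, g)) = (\<Sum>h\<in>B. A (h, f') * p (h, g') (f, g))"
    if idx: "f \<in> B" "g \<in> B" "f' \<in> B" "g' \<in> B" for f g f' g'
  proof -
    \<comment> \<open>X times \<open>p (b, g')\<close> and the combination of the
      \<open>p (h, g')\<close> with coefficients \<open>X (h, b)\<close> have equal inner products
      with \<open>C\<close>, so they agree. Read at \<open>(a, g)\<close>, this says that
      \<open>X\<close> commutes with \<open>?Q\<close>.\<close>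
    let ?Q = "\<lambda>(f, f'). p (f', g') (f, g)"
    have "mat_prod B X ?Q (a, b) = mat_prod B ?Q X (a, b)" if X: "X \<in> C" and ab: "a \<in> B" "b \<in> B" for X a b
    proof -
      have l: "mat_prod B X (p (b, g')) \<in> C" using X p ab idx by (intro mult) auto
      have r: "(\<lambda>j. \<Sum>h\<in>B. X (h, b) * p (h, g') j) \<in> C"
        using p idx by (intro is_subspace_sum[OF C]) auto
      have "dot ?J (mat_prod B X (p (b, g'))) d = dot ?J (\<lambda>j. \<Sum>h\<in>B. X (h, b) * p (h, g') j) d" if d: "d \<in> C" for d
      proof -
        have "dot ?J (mat_prod B X (p (b, g'))) d = mat_prod B (\<lambda>(f, g). X (g, f)) d (b, g')"
          unfolding dot_mm_adjoint using ab idx by (intro rep mult transp X d) auto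
        also have "\<dots> = (\<Sum>h\<in>B. X (h, b) * d (h, g'))" by (simp add: mat_prod_apply)
        also have "\<dots> = dot ?J (\<lambda>j. \<Sum>h\<in>B. X (h, b) * p (h, g') j) d"
          unfolding dot_sum using rep[OF _ d] idx by (intro sum.cong) auto
        finally show ?thesis .
      qed
      from uniq[OF l r this, of "(a, g)"] show ?thesis
        using ab idx by (simp add: mat_prod_apply mult.commute)
    qed
    from comm[OF this idx(1,3)] show ?thesis by (simp add: mat_prod_apply mult.commute)
  qed
  define c where "c = (\<lambda>j. \<Sum>y\<in>?J. A y * p y j)"
  have "c \<in> C" unfolding c_def using p by (intro is_subspace_sum[OF C]) auto
  moreover have "A (f, g) = c (f, g)" if fg: "f \<in> B" "g \<in> B" for f g
  proof -
    \<comment> \<open>The sum of the \<open>p (f', f')\<close> and the identity matrix both lie in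
      \<open>C\<close> and both represent the trace.\<close>
    have tr: "(\<Sum>f'\<in>B. 1 * p (f', f') (h, g)) = (if h = g then 1 else 0)" if h: "h \<in> B" for h
    proof -
      have "(\<lambda>j. \<Sum>f'\<in>B. 1 * p (f', f') j) \<in> C" using p by (intro is_subspace_sum[OF C]) auto
      moreover have "dot ?J (\<lambda>j. \<Sum>f'\<in>B. 1 * p (f', f') j) d = dot ?J (\<lambda>(f, g). if f = g then 1 else 0) d"
        if d: "d \<in> C" for d
      proof -
        have "dot ?J (\<lambda>j. \<Sum>f'\<in>B. 1 * p (f', f') j) d = (\<Sum>f'\<in>B. d (f', f'))"
          unfolding dot_sum using rep[OF _ d] by (intro sum.cong) auto
        also have "\<dots> = (\<Sum>f\<in>B. \<Sum>g\<in>B. if f = g then d (f, g) else 0)"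
          using B by (intro sum.cong) auto
        also have "\<dots> = dot ?J (\<lambda>(f, g). if f = g then 1 else 0) d"
          unfolding dot_prod by (intro sum.cong) auto
        finally show ?thesis .
      qed
      ultimately have "(\<Sum>f'\<in>B. 1 * p (f', f') (h, g)) = (\<lambda>(f, g). if f = g then 1 else 0) (h, g)"
        using h fg one by (intro uniq[of "\<lambda>j. \<Sum>f'\<in>B. 1 * p (f', f') j"]) auto
      then show ?thesis by simp
    qed
    have "A (f, g) = (\<Sum>h\<in>B. A (f, h) * (\<Sum>f'\<in>B. 1 * p (f', f') (h, g)))"
      using B fg by (simp only: tr cong: sum.cong) (simp add: if_distrib cong: if_cong)
    also have "\<dots> = (\<Sum>f'\<in>B. \<Sum>h\<in>B. A (f, h) * p (f', f') (h, g))"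
      unfolding sum_distrib_left by (subst sum.swap) simp
    also have "\<dots> = (\<Sum>f'\<in>B. \<Sum>h\<in>B. A (h, f') * p (h, f') (f, g))"
      using fg by (intro sum.cong refl key) auto
    also have "\<dots> = c (f, g)"
      unfolding c_def by (subst sum.swap) (simp add: sum.cartesian_product)
    finally show ?thesis .
  qed
  ultimately show ?thesis by blast
qed

section \<open>Specialization of rational functions\<close>

text \<open>A relation rather than a function, so that one statement carries both regularity at q =
  1 and the value there. Uniqueness is invoked only for the value of 0, if necessary after taking a
  difference.\<close>

definition specializes :: "Qq \<Rightarrow> rat \<Rightarrow> bool" where
  "specializes x a \<longleftrightarrow> (\<exists>p s. poly s 1 \<noteq> 0 \<and> x = Fract p s \<and> a = poly p 1 / poly s 1)"

lemma specializesI: "poly s 1 \<noteq> 0 \<Longrightarrow> specializes (Fract p s) (poly p 1 / poly s 1)"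
  by (auto simp: specializes_def)

lemma specializes_poly: "specializes (Fract p 1) (poly p 1)"
  using specializesI[of 1 p] by simp

lemma specializes_const: "specializes (Fract [:c:] 1) c"
  using specializes_poly[of "[:c:]"] by simp

lemma specializes_0: "specializes 0 0" and specializes_1: "specializes 1 1" and specializes_qq: "specializes qq 1"
  using specializes_poly[of 0] specializes_poly[of 1] specializes_poly[of "[:0, 1:]"]
  by (simp_all add: Zero_fract_def One_fract_def qq_def)

lemma specializes_inverse_qq: "specializes (inverse qq) 1"
  using specializesI[of "[:0, 1:]" 1] by (simp add: qq_def)

lemma specializes_add: assumes "specializes x a" "specializes y b" shows "specializes (x + y) (a + b)"
proof -
  obtain p s p' s' where 1: "poly s 1 \<noteq> 0" "x = Fract p s" "a = poly p 1 / poly s 1"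
    "poly s' 1 \<noteq> 0" "y = Fract p' s'" "b = poly p' 1 / poly s' 1"
    using assms by (auto simp: specializes_def)
  then have "s \<noteq> 0" "s' \<noteq> 0" by auto
  with 1 show ?thesis using specializesI[of "s * s'" "p * s' + p' * s"] by (simp add: add_frac_eq)
qed

lemma specializes_mult: assumes "specializes x a" "specializes y b" shows "specializes (x * y) (a * b)"
proof -
  obtain p s p' s' where 1: "poly s 1 \<noteq> 0" "x = Fract p s" "a = poly p 1 / poly s 1"
    "poly s' 1 \<noteq> 0" "y = Fract p' s'" "b = poly p' 1 / poly s' 1"
    using assms by (auto simp: specializes_def)
  with 1 show ?thesis using specializesI[of "s * s'" "p * p'"] by simp
qed

lemma specializes_uminus: assumes "specializes x a" shows "specializes (- x) (- a)"
proof -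
  obtain p s where "poly s 1 \<noteq> 0" "x = Fract p s" "a = poly p 1 / poly s 1"
    using assms by (auto simp: specializes_def)
  then show ?thesis using specializesI[of s "- p"] by simp
qed

lemma specializes_diff: "specializes x a \<Longrightarrow> specializes y b \<Longrightarrow> specializes (x - y) (a - b)"
  using specializes_add[of x a "- y" "- b"] specializes_uminus[of y b] by simp

lemma specializes_sum: "(\<And>i. i \<in> I \<Longrightarrow> specializes (x i) (a i)) \<Longrightarrow> specializes (sum x I) (sum a I)"
  by (induction I rule: infinite_finite_induct) (auto simp: specializes_0 specializes_add)

lemma specializes_power: "specializes x a \<Longrightarrow> specializes (x ^ k) (a ^ k)"
  by (induction k) (auto simp: specializes_1 specializes_mult)

lemma specializes_zero_unique: "specializes 0 a \<Longrightarrow> a = 0"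
proof -
  assume "specializes 0 a"
  then obtain p s where ps: "poly s 1 \<noteq> 0" "Fract 0 1 = Fract p s" "a = poly p 1 / poly s 1"
    by (auto simp: specializes_def Zero_fract_def)
  then have "s \<noteq> 0" by auto
  with ps(2) have "p = 0" by (simp add: eq_fract)
  with ps(3) show ?thesis by simp
qed

lemma qq_neq_1: "qq \<noteq> 1"
  by (simp add: qq_def One_fract_def eq_fract one_pCons)

text \<open>An eigenvalue of (H_a - 1) / (q - 1): the quotient is 1 + q + ... + q^(k-1).\<close>

lemma specializes_qq_number: "specializes ((qq ^ k - 1) / (qq - 1)) (of_nat k)"
proof -
  have "(qq ^ k - 1) / (qq - 1) = (\<Sum>j<k. qq ^ j)"
    using geometric_sum[OF qq_neq_1, of k] by simp
  moreover have "specializes (\<Sum>j<k. qq ^ j) (\<Sum>j<k. 1 ^ j)"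
    by (intro specializes_sum specializes_power specializes_qq)
  ultimately show ?thesis by simp
qed

lemma common_denominator:
  fixes x :: "'j \<Rightarrow> Qq"
  assumes "finite J"
  shows "\<exists>d p. d \<noteq> 0 \<and> (\<forall>j\<in>J. x j * d = Fract (p j) 1)"
  using assms
proof (induction J rule: finite_induct)
  case empty
  show ?case by (intro exI[of _ 1]) simp
next
  case (insert i J)
  then obtain d p where d: "d \<noteq> 0" "\<forall>j\<in>J. x j * d = Fract (p j) 1" by blast
  let ?d = "d"
  obtain a s where as: "x i * d = Fract a s" "s \<noteq> 0" by (cases "x i * d") auto
  show ?case
  proof (intro exI conjI ballI)
    have "Fract s 1 \<noteq> 0" using as(2) by (simp add: Zero_fract_def eq_fract)
    then show "d * Fract s 1 \<noteq> 0" using d(1) by simp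
    fix j assume j: "j \<in> insert i J"
    show "x j * (d * Fract s 1) = Fract ((if j = i then a else p j * s)) 1"
      using j insert.hyps d(2) as by (auto simp: mult.assoc[symmetric] eq_fract)
  qed
qed

text \<open>Divide the whole family by q - 1 as long as all its members vanish at 1. This lowers the
  degree of the nonzero \<open>P i\<close>, so it comes to an end.\<close>

lemma poly_specialize:
  fixes P :: "'j \<Rightarrow> rat poly"
  assumes "i \<in> J" "P i \<noteq> 0"
  shows "\<exists>c y. (\<forall>j\<in>J. specializes (Fract (P j) 1 * c) (y j)) \<and> (\<exists>j\<in>J. y j \<noteq> 0)"
  using assms(2)
proof (induction "degree (P i)" arbitrary: P rule: less_induct)
  case less
  show ?case
  proof (cases "\<exists>j\<in>J. poly (P j) 1 \<noteq> 0")
    case True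
    then show ?thesis
      by (intro exI[of _ 1] exI[of _ "\<lambda>j. poly (P j) 1"]) (auto simp: specializes_poly)
  next
    case False
    then have "\<forall>j\<in>J. \<exists>R. P j = [:-1, 1:] * R" by (auto simp: poly_eq_0_iff_dvd dvd_def)
    then obtain R where R: "\<And>j. j \<in> J \<Longrightarrow> P j = [:-1, 1:] * R j" by metis
    have "R i \<noteq> 0" using R[OF assms(1)] less.prems by auto
    moreover have "degree (R i) < degree (P i)"
      using R[OF assms(1)] \<open>R i \<noteq> 0\<close> by (simp add: degree_mult_eq del: mult_pCons_left)
    ultimately obtain c y where cy: "\<forall>j\<in>J. specializes (Fract (R j) 1 * c) (y j)" "\<exists>j\<in>J. y j \<noteq> 0"
      using less.hyps[of R] by blast
    have "Fract (P j) 1 * (Fract 1 [:-1, 1:] * c) = Fract (R j) 1 * c" if "j \<in> J" for j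
    proof -
      have "Fract (P j) 1 * Fract 1 [:-1, 1:] = Fract (R j) 1"
      proof -
        have "[:-1, 1:] \<noteq> (0 :: rat poly)" by simp
        then have "Fract ([:-1, 1:] * R j) ([:-1, 1:] * 1) = Fract (R j) 1" by (rule mult_fract_cancel)
        then show ?thesis by (simp only: R[OF that] mult_fract mult_1_left mult_1_right)
      qed
      then show ?thesis by (simp add: mult.assoc[symmetric])
    qed
    note e = this
    have "specializes (Fract (P j) 1 * (Fract 1 [:-1, 1:] * c)) (y j)" if "j \<in> J" for j
      unfolding e[OF that] using cy(1) that by blast
    with cy(2) show ?thesis by blast
  qed
qed

lemma specialize_nonzero:
  fixes x :: "'j \<Rightarrow> Qq"
  assumes "finite J" "i \<in> J" "x i \<noteq> 0"
  shows "\<exists>c y. (\<forall>j\<in>J. specializes (x j * c) (y j)) \<and> (\<exists>j\<in>J. y j \<noteq> 0)"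
proof -
  obtain d p where d: "d \<noteq> 0" "\<forall>j\<in>J. x j * d = Fract (p j) 1"
    using common_denominator[OF assms(1)] by blast
  have "p i \<noteq> 0" using d assms by (metis Zero_fract_def no_zero_divisors)
  then obtain c y where "\<forall>j\<in>J. specializes (Fract (p j) 1 * c) (y j)" "\<exists>j\<in>J. y j \<noteq> 0"
    using poly_specialize[OF assms(2)] by blast
  with d(2) show ?thesis by (intro exI[of _ "d * c"] exI[of _ y]) (auto simp: mult.assoc[symmetric])
qed

section \<open>Symmetrized matrix units\<close>

text \<open>\<open>sym_unit M\<close> is the matrix of the sum, over all injective placements of the pairs of \<open>M\<close>
  in tensor positions, of the corresponding tensor products of matrix units, with
  identities in the remaining positions.\<close>

fun sym_unit :: "(nat \<times> nat) multiset \<Rightarrow> nat list \<Rightarrow> nat list \<Rightarrow> rat" where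
  "sym_unit M [] [] = (if M = {#} then 1 else 0)"
| "sym_unit M (a # f) (b # g) = (if a = b then sym_unit M f g else 0) +
     of_nat (count M (a, b)) * sym_unit (M - {#(a, b)#}) f g"
| "sym_unit M _ _ = 0"

lemma sym_unit_empty: "sym_unit {#} f g = (if f = g then 1 else 0)"
  by (induction "{#} :: (nat \<times> nat) multiset" f g rule: sym_unit.induct) auto

lemma sym_unit_single_Cons:
  "sym_unit {#x#} (a # f) (b # g) = (if a = b then sym_unit {#x#} f g else 0) +
     (if x = (a, b) \<and> f = g then 1 else 0)"
  by (auto simp: sym_unit_empty)

lemma sym_unit_single_Nil: "sym_unit {#x#} [] g = 0" "sym_unit {#x#} g [] = 0"
  by (cases g; simp)+

lemma sym_unit_large: "length f < size M \<Longrightarrow> sym_unit M f g = 0"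
proof (induction M f g rule: sym_unit.induct)
  case (2 M a f b g)
  have "sym_unit (M - {#(a, b)#}) f g = 0" if "count M (a, b) > 0"
    using that 2 by (intro 2(2)) (auto simp: size_Diff_singleton)
  with 2 show ?case by (cases "count M (a, b) = 0") auto
qed auto

text \<open>With as many pairs as positions no identity factor is left, so the entry counts the
  placements of \<open>M\<close> that produce the list of pairs \<open>zip f g\<close>.\<close>

lemma sym_unit_full:
  assumes "length f = size M" "length g = size M"
  shows "sym_unit M f g \<ge> 0" "sym_unit M f g \<noteq> 0 \<longleftrightarrow> mset (zip f g) = M"
  using assms
proof (induction M f g rule: sym_unit.induct)
  case (2 M a f b g)
  {
    case 1
    have "sym_unit M f g = 0" using 1 by (intro sym_unit_large) auto
    then show ?case
      using 2(3)[of ] 1 by (cases "(a, b) \<in># M") (auto simp: size_Diff_singleton not_in_iff)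
  next
    case 2
    have z: "sym_unit M f g = 0" using 2 by (intro sym_unit_large) auto
    show ?case
    proof (cases "(a, b) \<in># M")
      case True
      have "sym_unit M (a # f) (b # g) = of_nat (count M (a, b)) * sym_unit (M - {#(a, b)#}) f g"
        by (simp add: z)
      then have "sym_unit M (a # f) (b # g) \<noteq> 0 \<longleftrightarrow> sym_unit (M - {#(a, b)#}) f g \<noteq> 0"
        using True by simp
      also have "\<dots> \<longleftrightarrow> mset (zip f g) = M - {#(a, b)#}"
        using True "2.IH"(4) 2 by (simp add: size_Diff_singleton)
      also have "\<dots> \<longleftrightarrow> mset (zip (a # f) (b # g)) = M"
        using True by auto
      finally show ?thesis .
    next
      case False
      then have "mset (zip (a # f) (b # g)) \<noteq> M" by auto
      with z False show ?thesis by (simp add: not_in_iff)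
    qed
  }
qed auto

text \<open>The contribution to a product with the sum of all E_pq in which E_pq hits a pair (q, s)
  of \<open>M\<close>, where E_pq E_qs = E_ps. The set \<open>Z\<close> bounds the pairs of
  \<open>M\<close>, so that the range of summation stays the same when pairs are removed in an
  induction.\<close>

definition shifted :: "(nat \<times> nat) set \<Rightarrow> nat \<Rightarrow> nat \<Rightarrow> (nat \<times> nat) multiset \<Rightarrow> nat list \<Rightarrow> nat list \<Rightarrow> rat" where
  "shifted Z p q M f g = (\<Sum>s\<in>{s. (q, s) \<in> Z}. of_nat (count M (q, s)) *
     sym_unit (add_mset (p, s) (M - {#(q, s)#})) f g)"

lemma shifted_Cons:
  assumes Z: "finite Z" "set_mset M \<subseteq> Z"
  shows "shifted Z p q M (a # f) (b # g) = (if a = b then shifted Z p q M f g else 0) +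
    of_nat (count M (a, b)) * shifted Z p q (M - {#(a, b)#}) f g +
    (if a = p then of_nat (count M (q, b)) * sym_unit (M - {#(q, b)#}) f g else 0)"
proof -
  let ?K = "{s. (q, s) \<in> Z}"
  have fin: "finite ?K" using finite_imageI[OF Z(1), of snd] by (rule finite_subset[rotated]) force
  let ?c = "\<lambda>s. of_nat (count M (q, s)) :: rat"
  \<comment> \<open>What stands at the first position: the identity in \<open>?A\<close>, an
    unshifted pair of \<open>M\<close> in \<open>?B\<close>, the shifted pair \<open>(p, s)\<close>
    in \<open>?C\<close>, which forces s = b.\<close>
  let ?A = "\<lambda>s. if a = b then ?c s * sym_unit (add_mset (p, s) (M - {#(q, s)#})) f g else 0"
  let ?B = "\<lambda>s. of_nat (count M (a, b)) * (of_nat (count (M - {#(a, b)#}) (q, s)) *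
      sym_unit (add_mset (p, s) (M - {#(a, b)#} - {#(q, s)#})) f g)"
  let ?C = "\<lambda>s. if s = b then (if a = p then ?c b * sym_unit (M - {#(q, b)#}) f g else 0) else 0"
  have "?c s * sym_unit (add_mset (p, s) (M - {#(q, s)#})) (a # f) (b # g) = ?A s + ?B s + ?C s" for s
  proof (cases "(q, s) \<in># M")
    case False
    then have "count M (q, s) = 0" by (simp add: not_in_iff)
    then show ?thesis by auto
  next
    case qs: True
    define M' where "M' = M - {#(q, s)#}"
    have M: "M = add_mset (q, s) M'" using qs by (simp add: M'_def)
    \<comment> \<open>Taking \<open>(a, b)\<close> and \<open>(q, s)\<close> out of \<open>M\<close>
      in either order gives the same product of multiplicities, also if they coincide.\<close>
    have B: "?B s = ?c s * of_nat (count M' (a, b)) * sym_unit (add_mset (p, s) (M' - {#(a, b)#})) f g"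
    proof (cases "(a, b) \<in># M'")
      case True
      then obtain M'' where M'': "M' = add_mset (a, b) M''" by (metis mset_add)
      show ?thesis
        by (cases "(a, b) = (q, s)") (auto simp: M M'' algebra_simps add_mset_commute)
    next
      case False
      then show ?thesis
        by (cases "(a, b) = (q, s)") (auto simp: M not_in_iff)
    qed
    have "sym_unit (add_mset (p, s) M') (a # f) (b # g) =
        (if a = b then sym_unit (add_mset (p, s) M') f g else 0) +
        of_nat (count M' (a, b)) * sym_unit (add_mset (p, s) (M' - {#(a, b)#})) f g +
        (if s = b \<and> a = p then sym_unit M' f g else 0)"
    proof (cases "(a, b) \<in># M'")
      case True
      then obtain M'' where M'': "M' = add_mset (a, b) M''" by (metis mset_add)
      show ?thesis by (auto simp: M'' algebra_simps add_mset_commute)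
    next
      case False
      then show ?thesis by (auto simp: not_in_iff)
    qed
    moreover have "?C s = (if s = b \<and> a = p then ?c s * sym_unit M' f g else 0)"
      by (auto simp: M'_def)
    ultimately show ?thesis unfolding B M'_def[symmetric] by (simp only: ring_distribs if_distrib[of "(*) (?c s)"] mult_zero_right mult.assoc)
  qed
  then have "shifted Z p q M (a # f) (b # g) = (\<Sum>s\<in>?K. ?A s + ?B s + ?C s)"
    by (simp only: shifted_def)
  also have "\<dots> = (\<Sum>s\<in>?K. ?A s) + (\<Sum>s\<in>?K. ?B s) + (\<Sum>s\<in>?K. ?C s)"
    by (simp only: sum.distrib)
  also have "(\<Sum>s\<in>?K. ?A s) = (if a = b then shifted Z p q M f g else 0)"
    by (simp add: shifted_def)
  also have "(\<Sum>s\<in>?K. ?B s) = of_nat (count M (a, b)) * shifted Z p q (M - {#(a, b)#}) f g"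
    by (simp add: shifted_def sum_distrib_left)
  also have "(\<Sum>s\<in>?K. ?C s) = (if a = p then ?c b * sym_unit (M - {#(q, b)#}) f g else 0)"
  proof (cases "b \<in> ?K")
    case True
    then show ?thesis using fin by simp
  next
    case False
    then have "count M (q, b) = 0" using Z(2) by (auto simp: not_in_iff[symmetric])
    with False show ?thesis using fin by simp
  qed
  finally show ?thesis .
qed

text \<open>At its position E_pq meets either the identity, which adds a pair to \<open>M\<close>,
  or a pair (q, s) of \<open>M\<close>, which gives \<open>shifted\<close>; with all other pairs its
  product is zero.\<close>

lemma sym_unit_single_mult:
  assumes Z: "finite Z" "set_mset M \<subseteq> Z" and q: "q \<in> {1..N}"
    and fg: "f \<in> bas N m" "g \<in> bas N m"
  shows "(\<Sum>h\<in>bas N m. sym_unit {#(p, q)#} f h * sym_unit M h g) =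
    sym_unit (add_mset (p, q) M) f g + shifted Z p q M f g"
  using Z(2) fg
proof (induction m arbitrary: f g M)
  case 0
  then show ?case by (auto simp: bas_0 shifted_def)
next
  case (Suc m)
  obtain a f' b g' where f: "f = a # f'" and g: "g = b # g'"
    using Suc.prems by (cases f; cases g) (auto simp: bas_def)
  have ab: "a \<in> {1..N}" "b \<in> {1..N}" "f' \<in> bas N m" "g' \<in> bas N m"
    using Suc.prems by (auto simp: f g)
  let ?S = "\<lambda>M. \<Sum>h\<in>bas N m. sym_unit {#(p, q)#} f' h * sym_unit M h g'"
  \<comment> \<open>In \<open>?D\<close> the single pair sits behind the first position, in
    \<open>?E\<close> at it; in \<open>?F\<close> the matrix of \<open>M\<close> has the identity at
    the first position, in \<open>?G\<close> a pair.\<close>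
  let ?D = "\<lambda>c h. if a = c then sym_unit {#(p, q)#} f' h else 0"
  let ?E = "\<lambda>c h. if a = p \<and> q = c \<and> f' = h then 1 else (0::rat)"
  let ?F = "\<lambda>c h. if c = b then sym_unit M h g' else 0"
  let ?G = "\<lambda>c h. of_nat (count M (c, b)) * sym_unit (M - {#(c, b)#}) h g'"
  have "(\<Sum>h\<in>bas N (Suc m). sym_unit {#(p, q)#} f h * sym_unit M h g) =
      (\<Sum>c\<in>{1..N}. \<Sum>h\<in>bas N m. (?D c h + ?E c h) * (?F c h + ?G c h))"
    unfolding sum_bas_Suc f g
    by (intro sum.cong refl) (simp only: sym_unit_single_Cons sym_unit.simps(2)[of M] prod.inject, auto)
  also have "\<dots> = (\<Sum>c\<in>{1..N}. (\<Sum>h\<in>bas N m. ?D c h * ?F c h) + (\<Sum>h\<in>bas N m. ?D c h * ?G c h) +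
      (\<Sum>h\<in>bas N m. ?E c h * ?F c h) + (\<Sum>h\<in>bas N m. ?E c h * ?G c h))"
    by (simp only: ring_distribs sum.distrib add_ac)
  also have "\<dots> = (\<Sum>c\<in>{1..N}. (if a = c then if a = b then ?S M else 0 else 0) +
      (if a = c then of_nat (count M (a, b)) * ?S (M - {#(a, b)#}) else 0) +
      (if q = c then if a = p \<and> q = b then sym_unit M f' g' else 0 else 0) +
      (if q = c then if a = p then of_nat (count M (q, b)) * sym_unit (M - {#(q, b)#}) f' g' else 0 else 0))"
  proof (intro sum.cong refl arg_cong2[of _ _ _ _ "(+)"])
    fix c
    show "(\<Sum>h\<in>bas N m. ?D c h * ?F c h) = (if a = c then if a = b then ?S M else 0 else 0)" by auto
    show "(\<Sum>h\<in>bas N m. ?D c h * ?G c h) = (if a = c then of_nat (count M (a, b)) * ?S (M - {#(a, b)#}) else 0)"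
      by (auto simp: sum_distrib_left mult_ac)
    have e: "(\<Sum>h\<in>bas N m. ?E c h * t h) = (if a = p \<and> q = c then t f' else 0)" for t
      using ab(3) by (auto simp: if_distrib[of "\<lambda>x. x * _"] cong: if_cong)
    show "(\<Sum>h\<in>bas N m. ?E c h * ?F c h) = (if q = c then if a = p \<and> q = b then sym_unit M f' g' else 0 else 0)"
      unfolding e by auto
    show "(\<Sum>h\<in>bas N m. ?E c h * ?G c h) =
        (if q = c then if a = p then of_nat (count M (q, b)) * sym_unit (M - {#(q, b)#}) f' g' else 0 else 0)"
      unfolding e by auto
  qed
  also have "\<dots> = (if a = b then ?S M else 0) + of_nat (count M (a, b)) * ?S (M - {#(a, b)#}) +
      (if a = p \<and> q = b then sym_unit M f' g' else 0) +
      (if a = p then of_nat (count M (q, b)) * sym_unit (M - {#(q, b)#}) f' g' else 0)"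
    using ab q by (simp only: sum.distrib sum.delta' finite_atLeastAtMost if_True)
  finally have L: "(\<Sum>h\<in>bas N (Suc m). sym_unit {#(p, q)#} f h * sym_unit M h g) = \<dots>" .
  have I1: "?S M = sym_unit (add_mset (p, q) M) f' g' + shifted Z p q M f' g'"
    by (rule Suc.IH) (use Suc.prems ab in auto)
  have I2: "?S (M - {#(a, b)#}) = sym_unit (add_mset (p, q) (M - {#(a, b)#})) f' g' + shifted Z p q (M - {#(a, b)#}) f' g'"
    by (rule Suc.IH) (use Suc.prems ab in \<open>auto dest: in_diffD\<close>)
  have R: "sym_unit (add_mset (p, q) M) (a # f') (b # g') =
      (if a = b then sym_unit (add_mset (p, q) M) f' g' else 0) +
      of_nat (count M (a, b)) * sym_unit (add_mset (p, q) (M - {#(a, b)#})) f' g' +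
      (if a = p \<and> q = b then sym_unit M f' g' else 0)"
  proof (cases "(a, b) \<in># M")
    case True
    then obtain M'' where M'': "M = add_mset (a, b) M''" by (metis mset_add)
    show ?thesis by (auto simp: M'' algebra_simps add_mset_commute)
  next
    case False
    then show ?thesis by (auto simp: not_in_iff)
  qed
  show ?case unfolding L I1 I2 unfolding f g R shifted_Cons[OF Z(1) Suc.prems(1)]
    by (simp add: algebra_simps)
qed

text \<open>Adjacent swaps generate all rearrangements. The prefix \<open>us\<close> is carried
  along so that the head can be fixed and the tail rearranged by induction.\<close>

lemma adjacent_swaps_mset:
  assumes swap: "\<And>us x y vs. length us + length vs + 2 = r \<Longrightarrow> h (us @ [x, y] @ vs) = h (us @ [y, x] @ vs)"
    and "mset xs = mset ys" "length us + length xs = r"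
  shows "h (us @ xs) = h (us @ ys)"
  using assms(2,3)
proof (induction xs arbitrary: us ys)
  case (Cons x xs)
  then have "x \<in> set ys" by (metis list.set_intros(1) set_mset_mset)
  then obtain ys1 ys2 where ys: "ys = ys1 @ x # ys2" by (meson split_list)
  have len: "length xs = length ys1 + length ys2"
    using Cons.prems(1) unfolding ys by (metis add_diff_cancel_left' length_Cons length_append mset_eq_length plus_1_eq_Suc add.left_commute)
  have bubble: "h (us @ zs @ x # ws) = h (us @ x # zs @ ws)" if "length us + length zs + length ws + 1 = r" for zs ws
    using that
  proof (induction zs arbitrary: ws rule: rev_induct)
    case (snoc z zs)
    have "h ((us @ zs) @ [z, x] @ ws) = h ((us @ zs) @ [x, z] @ ws)"
      using snoc.prems by (intro swap) auto
    also have "\<dots> = h (us @ x # zs @ z # ws)" using snoc by simp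
    finally show ?case by simp
  qed simp
  have "h (us @ x # xs) = h ((us @ [x]) @ xs)" by simp
  also have "\<dots> = h ((us @ [x]) @ (ys1 @ ys2))"
    using Cons.prems unfolding ys by (intro Cons.IH) auto
  also have "\<dots> = h (us @ ys)"
    unfolding ys using bubble[of ys1 ys2] Cons.prems(2) len by simp
  finally show ?case .
qed simp

lemma permute_adjacent: "permute_list (transpose (length us) (Suc (length us))) (us @ [x, y] @ vs) = us @ [y, x] @ vs"
proof (induction us)
  case Nil
  then show ?case using permute_list_transpose_0[of x y vs] by simp
next
  case (Cons u us)
  then show ?case using permute_list_transpose_Suc[of "length us" u "us @ [x, y] @ vs"] by simp
qed

text \<open>The index pairs of the matrix units of gl_n \<times> gl_1, embedded block
  diagonally.\<close>

definition levi_pairs :: "nat \<Rightarrow> (nat \<times> nat) set" where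
  "levi_pairs n = {(a, b). a \<in> {1..n + 1} \<and> b \<in> {1..n + 1} \<and> (a \<le> n \<longleftrightarrow> b \<le> n)}"

text \<open>The argument at q = 1, over the rationals. \<open>good X\<close> will mean that
  \<open>X\<close> is the value at q = 1 of a matrix in the image of the Levi quantum group.\<close>

locale levi_algebra =
  fixes n r :: nat and good :: "(nat list \<Rightarrow> nat list \<Rightarrow> rat) \<Rightarrow> bool"
  assumes good_cong: "good X \<Longrightarrow> (\<And>f g. f \<in> bas (n + 1) r \<Longrightarrow> g \<in> bas (n + 1) r \<Longrightarrow> X f g = Y f g) \<Longrightarrow> good Y"
    and good_add: "good X \<Longrightarrow> good Y \<Longrightarrow> good (\<lambda>f g. X f g + Y f g)"
    and good_scale: "good X \<Longrightarrow> good (\<lambda>f g. c * X f g)"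
    and good_mult: "good X \<Longrightarrow> good Y \<Longrightarrow> good (\<lambda>f g. \<Sum>h\<in>bas (n + 1) r. X f h * Y h g)"
    and good_one: "good (\<lambda>f g. if f = g then 1 else 0)"
    and good_raise: "i \<in> {1..<n} \<Longrightarrow> good (sym_unit {#(i, Suc i)#})"
    and good_lower: "i \<in> {1..<n} \<Longrightarrow> good (sym_unit {#(Suc i, i)#})"
    and good_diag: "a \<in> {1..n + 1} \<Longrightarrow> good (sym_unit {#(a, a)#})"
begin

abbreviation "B \<equiv> bas (n + 1) r"

lemma good_diff: "good X \<Longrightarrow> good Y \<Longrightarrow> good (\<lambda>f g. X f g - Y f g)"
  using good_add[of X "\<lambda>f g. - 1 * Y f g"] good_scale[of Y "-1"] by simp

lemma good_zero: "good (\<lambda>f g. 0)"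
  using good_scale[OF good_one, of 0] by simp

lemma good_sum: "(\<And>i. i \<in> I \<Longrightarrow> good (X i)) \<Longrightarrow> good (\<lambda>f g. \<Sum>i\<in>I. c i * X i f g)"
proof (induction I rule: infinite_finite_induct)
  case (insert i I)
  have "good (\<lambda>f g. c i * X i f g + (\<Sum>i\<in>I. c i * X i f g))"
    using insert by (intro good_add good_scale) auto
  then show ?case using insert by simp
qed (auto simp: good_zero)

text \<open>[E_ab, E_bc] = E_ac because a \<noteq> c; terms with the two units at different
  positions cancel in the commutator.\<close>

lemma good_bracket:
  assumes "a \<noteq> c" "b \<in> {1..n + 1}" "c \<in> {1..n + 1}" "good (sym_unit {#(a, b)#})" "good (sym_unit {#(b, c)#})"
  shows "good (sym_unit {#(a, c)#})"
proof -
  have "good (\<lambda>f g. (\<Sum>h\<in>B. sym_unit {#(a, b)#} f h * sym_unit {#(b, c)#} h g) -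
      (\<Sum>h\<in>B. sym_unit {#(b, c)#} f h * sym_unit {#(a, b)#} h g))"
    using assms by (intro good_diff good_mult)
  then show ?thesis
  proof (rule good_cong)
    fix f g assume fg: "f \<in> B" "g \<in> B"
    have "{s. (b, s) \<in> {(b, c)}} = {c}" "{s. (c, s) \<in> {(a, b)}} = {}" using assms(1) by auto
    then have "shifted {(b, c)} a b {#(b, c)#} f g = sym_unit {#(a, c)#} f g" "shifted {(a, b)} b c {#(a, b)#} f g = 0"
      by (simp_all add: shifted_def)
    then show "(\<Sum>h\<in>B. sym_unit {#(a, b)#} f h * sym_unit {#(b, c)#} h g) -
      (\<Sum>h\<in>B. sym_unit {#(b, c)#} f h * sym_unit {#(a, b)#} h g) = sym_unit {#(a, c)#} f g"
      using sym_unit_single_mult[of "{(b, c)}" "{#(b, c)#}" b "n + 1" f r g a]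
        sym_unit_single_mult[of "{(a, b)}" "{#(a, b)#}" c "n + 1" f r g b] fg assms(2,3)
      by (simp add: add_mset_commute)
  qed
qed

lemma good_upper: "Suc a \<le> b \<Longrightarrow> 1 \<le> a \<Longrightarrow> b \<le> n \<Longrightarrow> good (sym_unit {#(a, b)#})"
proof (induction b rule: dec_induct)
  case base
  then show ?case by (intro good_raise) auto
next
  case (step b)
  then show ?case by (intro good_bracket[of a "Suc b" b] good_raise) auto
qed

lemma good_below: "Suc a \<le> b \<Longrightarrow> 1 \<le> a \<Longrightarrow> b \<le> n \<Longrightarrow> good (sym_unit {#(b, a)#})"
proof (induction b rule: dec_induct)
  case base
  then show ?case by (intro good_lower) auto
next
  case (step b)
  then show ?case by (intro good_bracket[of "Suc b" a b] good_lower) auto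
qed

lemma good_single: "(a, b) \<in> levi_pairs n \<Longrightarrow> good (sym_unit {#(a, b)#})"
  using good_upper[of a b] good_below[of b a] good_diag[of a]
  by (cases a b rule: linorder_cases) (auto simp: levi_pairs_def)

lemma finite_levi_pairs: "finite (levi_pairs n)"
  by (rule finite_subset[of _ "{1..n + 1} \<times> {1..n + 1}"]) (auto simp: levi_pairs_def)

text \<open>The product formula is solved for its leading term: the corrections in
  \<open>shifted\<close> belong to multisets of the size of \<open>M'\<close>, one less than that of
  \<open>M\<close>.\<close>

lemma good_sym_unit: "set_mset M \<subseteq> levi_pairs n \<Longrightarrow> good (sym_unit M)"
proof (induction "size M" arbitrary: M rule: less_induct)
  case less
  show ?case
  proof (cases M)
    case empty
    show ?thesis unfolding empty using good_one by (rule good_cong) (simp add: sym_unit_empty)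
  next
    case (add x M')
    obtain p q where x: "x = (p, q)" by (cases x)
    have pq: "(p, q) \<in> levi_pairs n" and M': "set_mset M' \<subseteq> levi_pairs n"
      using less.prems by (auto simp: add x)
    \<comment> \<open>Only pairs that occur in \<open>M'\<close>: removing an absent pair would
      leave \<open>M'\<close> unchanged, and the size of the correction would not be
      smaller.\<close>
    let ?K = "{s. (q, s) \<in> levi_pairs n \<and> (q, s) \<in># M'}"
    have "good (\<lambda>f g. \<Sum>s\<in>?K. of_nat (count M' (q, s)) * sym_unit (add_mset (p, s) (M' - {#(q, s)#})) f g)"
    proof (rule good_sum)
      fix s assume s: "s \<in> ?K"
      have "(p, s) \<in> levi_pairs n" using s pq by (auto simp: levi_pairs_def)
      moreover have "size (M' - {#(q, s)#}) < size M'" using s by (simp add: size_Diff1_less)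
      ultimately show "good (sym_unit (add_mset (p, s) (M' - {#(q, s)#})))"
        using M' by (intro less.hyps) (auto simp: add dest: in_diffD)
    qed
    then have "good (\<lambda>f g. (\<Sum>h\<in>B. sym_unit {#(p, q)#} f h * sym_unit M' h g) -
        (\<Sum>s\<in>?K. of_nat (count M' (q, s)) * sym_unit (add_mset (p, s) (M' - {#(q, s)#})) f g))"
      using M' by (intro good_diff good_mult good_single[OF pq] less.hyps) (auto simp: add)
    then show ?thesis
    proof (rule good_cong)
      fix f g assume fg: "f \<in> B" "g \<in> B"
      have "{s. (q, s) \<in> levi_pairs n} \<subseteq> {1..n + 1}" by (auto simp: levi_pairs_def)
      then have "finite {s. (q, s) \<in> levi_pairs n}" by (rule finite_subset) simp
      then have "shifted (levi_pairs n) p q M' f g =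
          (\<Sum>s\<in>?K. of_nat (count M' (q, s)) * sym_unit (add_mset (p, s) (M' - {#(q, s)#})) f g)"
        unfolding shifted_def by (intro sum.mono_neutral_right) (auto simp: not_in_iff)
      then show "(\<Sum>h\<in>B. sym_unit {#(p, q)#} f h * sym_unit M' h g) -
        (\<Sum>s\<in>?K. of_nat (count M' (q, s)) * sym_unit (add_mset (p, s) (M' - {#(q, s)#})) f g) = sym_unit M f g"
        using sym_unit_single_mult[OF finite_levi_pairs M' _ fg, of q p] pq
        by (simp add: add x levi_pairs_def)
    qed
  qed
qed

text \<open>If all pairs of (f, g) lie in gl_n \<times> gl_1, \<open>X\<close> is paired with the
  symmetrized unit of these pairs: it is nonnegative and supported exactly on the orbit of (f, g),
  where \<open>X\<close> is constant. Otherwise the pairs are sorted until the hypothesis on blocks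
  applies.\<close>

lemma orthogonal_symmetric_zero:
  assumes orth: "\<And>Y. good Y \<Longrightarrow> (\<Sum>f\<in>B. \<Sum>g\<in>B. X f g * Y f g) = 0"
    and swap: "\<And>i f g. i \<in> {1..<r} \<Longrightarrow> f \<in> B \<Longrightarrow> g \<in> B \<Longrightarrow>
      X (permute_list (transpose (i - 1) i) f) (permute_list (transpose (i - 1) i) g) = X f g"
    and blocks: "\<And>l f g. l \<in> {1..r} \<Longrightarrow> f \<in> B \<Longrightarrow> g \<in> B \<Longrightarrow>
      (block n f = {1..l}) \<noteq> (block n g = {1..l}) \<Longrightarrow> X f g = 0"
    and fg: "f \<in> B" "g \<in> B"
  shows "X f g = 0"
proof -
  let ?B2 = "{zs. length zs = r \<and> set zs \<subseteq> {1..n + 1} \<times> {1..n + 1}}"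
  \<comment> \<open>\<open>X\<close> as a function of the list of index pairs, extended by 0 so that
    invariance under swaps holds for all lists of length \<open>r\<close>.\<close>
  define h where "h zs = (if zs \<in> ?B2 then X (map fst zs) (map snd zs) else 0)" for zs
  have bas: "map fst zs \<in> B" "map snd zs \<in> B" if "zs \<in> ?B2" for zs
    using that by (force simp: bas_def)+
  have h_swap: "h (us @ [x, y] @ vs) = h (us @ [y, x] @ vs)" if len: "length us + length vs + 2 = r" for us x y vs
  proof (cases "us @ [x, y] @ vs \<in> ?B2")
    case True
    then have *: "us @ [y, x] @ vs \<in> ?B2" by auto
    let ?t = "transpose (Suc (length us) - 1) (Suc (length us))"
    have "map p (us @ [y, x] @ vs) = permute_list ?t (map p (us @ [x, y] @ vs))" for p :: "nat \<times> nat \<Rightarrow> nat"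
      using permute_adjacent[of "map p us" "p x" "p y" "map p vs"] by simp
    then show ?thesis
      using swap[OF _ bas[OF True], of "Suc (length us)"] True * len by (simp only: h_def if_True) simp
  next
    case False
    then have "us @ [y, x] @ vs \<notin> ?B2" by auto
    with False show ?thesis by (simp only: h_def if_False)
  qed
  have h_mset: "h xs = h ys" if "mset xs = mset ys" "length xs = r" for xs ys
    using adjacent_swaps_mset[of r h xs ys "[]"] h_swap that by simp
  have zip: "zip f g \<in> ?B2" and len: "length f = r" "length g = r"
    using fg by (auto simp: bas_def dest: set_zip_leftD set_zip_rightD)
  have X_h: "X f' g' = h (zip f' g')" if "f' \<in> B" "g' \<in> B" for f' g'
  proof -
    have "length f' = length g'" "zip f' g' \<in> ?B2" using that by (auto simp: bas_def dest: set_zip_leftD set_zip_rightD)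
    then show ?thesis by (simp add: h_def)
  qed
  show ?thesis
  proof (cases "set (zip f g) \<subseteq> levi_pairs n")
    case True
    let ?M = "mset (zip f g)"
    have "good (sym_unit ?M)" using True by (intro good_sym_unit) simp
    from orth[OF this] have 0: "(\<Sum>f'\<in>B. \<Sum>g'\<in>B. X f' g' * sym_unit ?M f' g') = 0" .
    have full: "sym_unit ?M f' g' \<ge> 0" "sym_unit ?M f' g' \<noteq> 0 \<longleftrightarrow> mset (zip f' g') = ?M" if "f' \<in> B" "g' \<in> B" for f' g'
      using that len by (intro sym_unit_full; simp add: bas_def)+
    have "X f' g' * sym_unit ?M f' g' = X f g * sym_unit ?M f' g'" if "f' \<in> B" "g' \<in> B" for f' g'
    proof (cases "mset (zip f' g') = ?M")
      case True
      then have "X f' g' = X f g" using X_h that fg h_mset[OF True] by (simp add: bas_def)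
      then show ?thesis by simp
    next
      case False
      then show ?thesis using full(2)[OF that] by simp
    qed
    then have "(\<Sum>f'\<in>B. \<Sum>g'\<in>B. X f' g' * sym_unit ?M f' g') = (\<Sum>f'\<in>B. \<Sum>g'\<in>B. X f g * sym_unit ?M f' g')"
      by (intro sum.cong refl)
    then have "X f g * (\<Sum>f'\<in>B. \<Sum>g'\<in>B. sym_unit ?M f' g') = 0"
      using 0 unfolding sum_distrib_left by simp
    moreover have "(\<Sum>f'\<in>B. \<Sum>g'\<in>B. sym_unit ?M f' g') > 0"
    proof -
      have "sym_unit ?M f g > 0" using full[OF fg] by simp
      also have "sym_unit ?M f g \<le> (\<Sum>g'\<in>B. sym_unit ?M f g')"
        using full(1) fg by (intro member_le_sum) auto
      also have "\<dots> \<le> (\<Sum>f'\<in>B. \<Sum>g'\<in>B. sym_unit ?M f' g')"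
        using full(1) fg by (intro member_le_sum[of f B "\<lambda>f'. \<Sum>g'\<in>B. sym_unit ?M f' g'"] sum_nonneg) auto
      finally show ?thesis .
    qed
    ultimately show ?thesis by simp
  next
    case False
    then obtain a b where ab: "(a, b) \<in> set (zip f g)" "(a \<le> n) \<noteq> (b \<le> n)"
      using zip by (auto simp: levi_pairs_def)
    \<comment> \<open>\<open>p\<close> is the component in which \<open>(a, b)\<close> is \<le> n
      and \<open>p'\<close> the other one, so one argument covers both orientations. After sorting
      by \<open>Q\<close> the side \<open>p\<close> has block {1..?l}, while \<open>(a, b)\<close>
      prevents this for the side \<open>p'\<close>.\<close>
    have sorted_zero: "h zs = 0"
      if Q: "zs = filter Q (zip f g) @ filter (\<lambda>z. \<not> Q z) (zip f g)" "Q = (\<lambda>z. p z \<le> n)"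
        and p: "(p, p') = (fst, snd) \<or> (p, p') = (snd, fst)" and z: "p (a, b) \<le> n" "\<not> p' (a, b) \<le> n"
      for zs Q and p p' :: "nat \<times> nat \<Rightarrow> nat"
    proof -
      let ?l = "length (filter Q (zip f g))"
      have mem: "zs \<in> ?B2" using zip unfolding Q(1) by (auto simp: sum_length_filter_compl)
      have inF: "(a, b) \<in> set (filter Q (zip f g))" using ab z(1) Q(2) by simp
      \<comment> \<open>There is no generator x^(0); \<open>(a, b)\<close> satisfies
        \<open>Q\<close>, so \<open>?l\<close> is at least 1.\<close>
      then have l: "?l \<in> {1..r}" using len length_filter_le[of Q "zip f g"]
        by (cases "filter Q (zip f g)") auto
      have b1: "block n (map p zs) = {1..?l}"
        unfolding block_iff
      proof (intro conjI allI impI)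
        fix k assume k: "k < length (map p zs)"
        show "map p zs ! k \<le> n \<longleftrightarrow> k < ?l"
        proof (cases "k < ?l")
          case True
          then have "zs ! k \<in> set (filter Q (zip f g))" by (simp add: Q(1) nth_append del: set_filter)
          then show ?thesis using True k Q(2) by simp
        next
          case False
          then have "zs ! k \<in> set (filter (\<lambda>z. \<not> Q z) (zip f g))"
            using k by (simp add: Q(1) nth_append del: set_filter)
          then show ?thesis using False k Q(2) by simp
        qed
      qed (simp add: Q(1))
      have b2: "block n (map p' zs) \<noteq> {1..?l}"
      proof
        assume bl: "block n (map p' zs) = {1..?l}"
        obtain k where k: "k < ?l" "filter Q (zip f g) ! k = (a, b)"
          using inF by (metis in_set_conv_nth)
        then have "k < length (map p' zs)" "map p' zs ! k = p' (a, b)" by (simp_all add: Q(1) nth_append)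
        with bl k(1) z(2) show False unfolding block_iff by metis
      qed
      have "X (map fst zs) (map snd zs) = 0"
        using p
      proof
        assume "(p, p') = (fst, snd)"
        with b1 b2 show ?thesis by (intro blocks[OF l bas[OF mem]]) (metis prod.inject)
      next
        assume "(p, p') = (snd, fst)"
        with b1 b2 show ?thesis by (intro blocks[OF l bas[OF mem]]) (metis prod.inject)
      qed
      then show ?thesis by (simp add: h_def)
    qed
    have "h (zip f g) = 0"
    proof (cases "a \<le> n")
      case True
      let ?Q = "\<lambda>z :: nat \<times> nat. fst z \<le> n"
      have "h (zip f g) = h (filter ?Q (zip f g) @ filter (\<lambda>z. \<not> ?Q z) (zip f g))"
        using len by (intro h_mset) (simp_all add: multiset_partition[symmetric])
      also have "\<dots> = 0" using True ab(2) by (intro sorted_zero[OF refl refl, of fst snd]) auto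
      finally show ?thesis .
    next
      case False
      let ?Q = "\<lambda>z :: nat \<times> nat. snd z \<le> n"
      have "h (zip f g) = h (filter ?Q (zip f g) @ filter (\<lambda>z. \<not> ?Q z) (zip f g))"
        using len by (intro h_mset) (simp_all add: multiset_partition[symmetric])
      also have "\<dots> = 0" using False ab(2) by (intro sorted_zero[OF refl refl, of snd fst]) auto
      finally show ?thesis .
    qed
    then show ?thesis using X_h[OF fg] by simp
  qed
qed

end

section \<open>Endomorphisms and their matrices\<close>

definition entries :: "(vec \<Rightarrow> vec) \<Rightarrow> nat list \<times> nat list \<Rightarrow> Qq" where
  "entries A = (\<lambda>(f, g). lookup (A (Mb g)) f)"

definition op_of :: "nat \<Rightarrow> nat \<Rightarrow> (nat list \<times> nat list \<Rightarrow> Qq) \<Rightarrow> vec \<Rightarrow> vec" where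
  "op_of N m X = restrict (lin_ext (\<lambda>g. \<Sum>f\<in>bas N m. smul (X (f, g)) (Mb f))) (tpow N m)"

lemma entries_apply: "entries A (f, g) = lookup (A (Mb g)) f"
  by (simp add: entries_def)

lemma lookup_lin:
  assumes "lin L" "v \<in> tpow N m"
  shows "lookup (L v) f = (\<Sum>h\<in>bas N m. lookup v h * lookup (L (Mb h)) f)"
proof -
  let ?v = "\<Sum>f\<in>bas N m. smul (lookup v f) (Mb f)"
  have v: "v = ?v" using assms(2) by (intro vec_expand) (simp_all add: tpow_bas)
  have "lookup (L ?v) f = (\<Sum>h\<in>bas N m. lookup v h * lookup (L (Mb h)) f)"
    by (simp add: lin_sum[OF assms(1)] lin_smul[OF assms(1)] lookup_sum)
  then show ?thesis by (simp only: v[symmetric])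
qed

lemma restrict_End:
  assumes "lin L" "\<And>v. v \<in> tpow N m \<Longrightarrow> L v \<in> tpow N m"
  shows "restrict L (tpow N m) \<in> End (tpow N m)"
  using assms(2) by (auto simp: End_def lin_add[OF assms(1)] lin_smul[OF assms(1)] tpow_add tpow_smul)

lemma EndD:
  assumes "A \<in> End (tpow N m)"
  shows "v \<in> tpow N m \<Longrightarrow> A v \<in> tpow N m"
    and "u \<in> tpow N m \<Longrightarrow> v \<in> tpow N m \<Longrightarrow> A (u + v) = A u + A v"
    and "v \<in> tpow N m \<Longrightarrow> A (smul c v) = smul c (A v)"
    and "A 0 = 0"
proof -
  show s: "A (smul c v) = smul c (A v)" if "v \<in> tpow N m" for c v using assms that by (auto simp: End_def)
  show "A 0 = 0" using s[of 0 0] by simp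
qed (use assms in \<open>auto simp: End_def\<close>)

lemma End_sum:
  assumes "A \<in> End (tpow N m)" "\<And>i. i \<in> I \<Longrightarrow> v i \<in> tpow N m"
  shows "A (\<Sum>i\<in>I. smul (c i) (v i)) = (\<Sum>i\<in>I. smul (c i) (A (v i)))"
  using assms(2)
proof (induction I rule: infinite_finite_induct)
  case (insert i I)
  then show ?case by (simp add: EndD[OF assms(1)] tpow_smul tpow_sum)
qed (simp_all add: EndD(4)[OF assms(1)])

lemma End_eq_lin_ext:
  assumes "A \<in> End (tpow N m)" "v \<in> tpow N m"
  shows "A v = lin_ext (\<lambda>g. A (Mb g)) v"
proof -
  let ?v = "\<Sum>f\<in>bas N m. smul (lookup v f) (Mb f)"
  have v: "v = ?v" using assms(2) by (intro vec_expand) (simp_all add: tpow_bas)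
  have "A ?v = (\<Sum>f\<in>bas N m. smul (lookup v f) (A (Mb f)))"
    by (intro End_sum[OF assms(1)]) simp
  also have "\<dots> = lin_ext (\<lambda>g. A (Mb g)) v"
    using assms(2) by (intro lin_ext_superset[symmetric]) (simp_all add: tpow_bas)
  finally show ?thesis by (simp only: v[symmetric])
qed

lemma lookup_End:
  assumes "A \<in> End (tpow N m)" "v \<in> tpow N m"
  shows "lookup (A v) f = (\<Sum>h\<in>bas N m. lookup v h * lookup (A (Mb h)) f)"
  using lookup_lin[OF lin_lin_ext assms(2), of "\<lambda>g. A (Mb g)" f] End_eq_lin_ext[OF assms] by simp

lemma op_of_End: "op_of N m X \<in> End (tpow N m)"
  unfolding op_of_def
proof (rule restrict_End)
  show "lin_ext (\<lambda>g. \<Sum>f\<in>bas N m. smul (X (f, g)) (Mb f)) v \<in> tpow N m" if "v \<in> tpow N m" for v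
    by (rule lin_tpow[OF _ _ that]) (auto intro!: tpow_sum tpow_smul)
qed simp

lemma entries_op_of: "f \<in> bas N m \<Longrightarrow> g \<in> bas N m \<Longrightarrow> entries (op_of N m X) (f, g) = X (f, g)"
  by (simp add: entries_apply op_of_def lookup_sum lookup_Mb if_distrib cong: if_cong)

lemma End_eqI:
  assumes "A \<in> End (tpow N m)" "A' \<in> End (tpow N m)"
    and "\<And>f g. f \<in> bas N m \<Longrightarrow> g \<in> bas N m \<Longrightarrow> entries A (f, g) = entries A' (f, g)"
  shows "A = A'"
proof
  fix v
  show "A v = A' v"
  proof (cases "v \<in> tpow N m")
    case True
    show ?thesis
    proof (rule poly_mapping_eqI)
      fix f
      show "lookup (A v) f = lookup (A' v) f"
      proof (cases "f \<in> bas N m")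
        case f: True
        show ?thesis unfolding lookup_End[OF assms(1) True] lookup_End[OF assms(2) True]
          using assms(3)[OF f] by (intro sum.cong) (auto simp: entries_apply)
      next
        case False
        then have "lookup (A v) f = 0" "lookup (A' v) f = 0"
          using EndD(1)[OF assms(1) True] EndD(1)[OF assms(2) True] by (auto simp: tpow_bas in_keys_iff)
        then show ?thesis by simp
      qed
    qed
  next
    case False
    then show ?thesis using assms(1,2) by (auto simp: End_def PiE_def extensional_def)
  qed
qed

lemma op_of_eq_iff:
  "A \<in> End (tpow N m) \<Longrightarrow> op_of N m X = A \<longleftrightarrow> (\<forall>f\<in>bas N m. \<forall>g\<in>bas N m. X (f, g) = entries A (f, g))"
  using End_eqI[OF op_of_End, of A N m X] entries_op_of[of _ N m _ X] by metis

lemma entries_comp: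
  assumes "A \<in> End (tpow N m)" "A' \<in> End (tpow N m)" "g \<in> bas N m"
  shows "lookup (A (A' (Mb g))) f = mat_prod (bas N m) (entries A) (entries A') (f, g)"
  using lookup_End[OF assms(1) EndD(1)[OF assms(2)], of "Mb g" f] assms(3)
  by (simp add: mat_prod_apply entries_apply mult.commute)

lemma End_commute_iff:
  assumes "A \<in> End (tpow N m)" "A' \<in> End (tpow N m)"
  shows "(\<forall>v\<in>tpow N m. A (A' v) = A' (A v)) \<longleftrightarrow>
    (\<forall>f\<in>bas N m. \<forall>g\<in>bas N m. mat_prod (bas N m) (entries A) (entries A') (f, g) = mat_prod (bas N m) (entries A') (entries A) (f, g))"
proof
  assume "\<forall>v\<in>tpow N m. A (A' v) = A' (A v)"
  then show "\<forall>f\<in>bas N m. \<forall>g\<in>bas N m. mat_prod (bas N m) (entries A) (entries A') (f, g) = mat_prod (bas N m) (entries A') (entries A) (f, g)"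
    by (metis Mb_tpow assms entries_comp)
next
  assume m: "\<forall>f\<in>bas N m. \<forall>g\<in>bas N m. mat_prod (bas N m) (entries A) (entries A') (f, g) = mat_prod (bas N m) (entries A') (entries A) (f, g)"
  have E: "restrict (\<lambda>v. A (A' v)) (tpow N m) \<in> End (tpow N m)"
    if "A \<in> End (tpow N m)" "A' \<in> End (tpow N m)" for A A'
    using EndD[OF that(1)] EndD[OF that(2)] by (auto simp: End_def tpow_add tpow_smul)
  have "restrict (\<lambda>v. A (A' v)) (tpow N m) = restrict (\<lambda>v. A' (A v)) (tpow N m)"
    by (rule End_eqI[OF E[OF assms] E[OF assms(2,1)]])
       (use m assms in \<open>simp add: entries_apply[of "restrict _ _"] entries_comp\<close>)
  then show "\<forall>v\<in>tpow N m. A (A' v) = A' (A v)" by (metis restrict_apply')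
qed

locale endo_algebra =
  fixes N m :: nat and G :: "(vec \<Rightarrow> vec) set"
  assumes End: "A \<in> G \<Longrightarrow> A \<in> End (tpow N m)"
    and one: "restrict (\<lambda>v. v) (tpow N m) \<in> G"
    and add: "A \<in> G \<Longrightarrow> A' \<in> G \<Longrightarrow> restrict (\<lambda>v. A v + A' v) (tpow N m) \<in> G"
    and scale: "A \<in> G \<Longrightarrow> restrict (\<lambda>v. smul c (A v)) (tpow N m) \<in> G"
    and comp: "A \<in> G \<Longrightarrow> A' \<in> G \<Longrightarrow> restrict (\<lambda>v. A (A' v)) (tpow N m) \<in> G"
begin

abbreviation "B \<equiv> bas N m"
abbreviation "W \<equiv> tpow N m"

text \<open>Matrices are functions on all pairs of lists; \<open>op_of\<close> reads only their
  entries on \<open>B \<times> B\<close>, so the others are arbitrary.\<close>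

definition mats :: "(nat list \<times> nat list \<Rightarrow> Qq) set" where
  "mats = {X. op_of N m X \<in> G}"

lemma matsI: "A \<in> G \<Longrightarrow> (\<And>f g. f \<in> B \<Longrightarrow> g \<in> B \<Longrightarrow> X (f, g) = entries A (f, g)) \<Longrightarrow> X \<in> mats"
  using op_of_eq_iff[of A N m X] End[of A] unfolding mats_def by (metis mem_Collect_eq)

lemma mats_cong: "X \<in> mats \<Longrightarrow> (\<And>f g. f \<in> B \<Longrightarrow> g \<in> B \<Longrightarrow> Y (f, g) = X (f, g)) \<Longrightarrow> Y \<in> mats"
  by (rule matsI[of "op_of N m X"]) (auto simp: mats_def entries_op_of)

lemma mats_zero: "(\<lambda>j. 0) \<in> mats"
  by (rule matsI[OF scale[OF one, of 0]]) (simp add: entries_apply)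

lemma mats_one: "(\<lambda>(f, g). if f = g then 1 else 0) \<in> mats"
  by (rule matsI[OF one]) (simp add: entries_apply lookup_Mb)

lemma mats_add: "X \<in> mats \<Longrightarrow> Y \<in> mats \<Longrightarrow> (\<lambda>j. X j + Y j) \<in> mats"
  by (rule matsI[OF add[of "op_of N m X" "op_of N m Y"]])
     (auto simp: mats_def entries_apply[of "restrict _ _"] lookup_add entries_op_of[unfolded entries_apply])

lemma mats_scale: "X \<in> mats \<Longrightarrow> (\<lambda>j. c * X j) \<in> mats"
  by (rule matsI[OF scale[of "op_of N m X" c]])
     (auto simp: mats_def entries_apply[of "restrict _ _"] entries_op_of[unfolded entries_apply])

lemma mats_mult: "X \<in> mats \<Longrightarrow> Y \<in> mats \<Longrightarrow> mat_prod B X Y \<in> mats"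
proof (rule matsI[OF comp[of "op_of N m X" "op_of N m Y"]])
  fix f g assume fg: "f \<in> B" "g \<in> B"
  have "entries (restrict (\<lambda>v. op_of N m X (op_of N m Y v)) W) (f, g) =
      lookup (op_of N m X (op_of N m Y (Mb g))) f"
    using fg by (simp add: entries_apply)
  also have "\<dots> = mat_prod B X Y (f, g)"
    unfolding entries_comp[OF op_of_End op_of_End fg(2)] using fg by (simp add: mat_prod_apply entries_op_of)
  finally show "mat_prod B X Y (f, g) = entries (restrict (\<lambda>v. op_of N m X (op_of N m Y v)) W) (f, g)" ..
qed (auto simp: mats_def)

lemma is_subspace_mats: "is_subspace mats"
  by (simp add: is_subspace_def mats_zero mats_add mats_scale)

lemma mats_restrict: "restrict L W \<in> G \<Longrightarrow> (\<lambda>(f, g). lookup (L (Mb g)) f) \<in> mats"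
  by (rule matsI[of "restrict L W"]) (simp_all add: entries_apply)

end

context presented_rep begin

lemma commute_frep:
  assumes A: "A \<in> End (tpow N m)" and comm: "\<And>g v. g \<in> S \<Longrightarrow> v \<in> tpow N m \<Longrightarrow> A (\<rho>' g v) = \<rho>' g (A v)"
    and p: "p \<in> carrier (free_alg S)" and v: "v \<in> tpow N m"
  shows "A (frep \<rho>' p v) = frep \<rho>' p (A v)"
proof -
  have w: "A (foldr \<rho>' w v) = foldr \<rho>' w (A v)" if "set w \<subseteq> S" for w
    using that by (induction w) (auto simp: comm foldr_agree v)
  have "A (frep \<rho>' p v) = (\<Sum>w\<in>keys p. smul (lookup p w) (A (foldr \<rho>' (letters w) v)))"
    unfolding frep_def using p foldr_agree[OF _ v] by (intro End_sum[OF A]) (auto simp: carrier_free_alg)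
  also have "\<dots> = frep \<rho>' p (A v)"
    unfolding frep_def using p by (intro sum.cong) (auto simp: w carrier_free_alg)
  finally show ?thesis .
qed

lemma frep_End: "p \<in> carrier (free_alg S) \<Longrightarrow> restrict (frep \<rho>' p) (tpow N m) \<in> End (tpow N m)"
  by (intro restrict_End frep_lin lin frep_closed)

lemma frep_endo_algebra: "endo_algebra N m ((\<lambda>p. restrict (frep \<rho>' p) (tpow N m)) ` carrier (free_alg S))"
proof
  let ?W = "tpow N m" and ?G = "(\<lambda>p. restrict (frep \<rho>' p) (tpow N m)) ` carrier (free_alg S)"
  show "restrict (\<lambda>v. v) ?W \<in> ?G"
    by (rule image_eqI[of _ _ 1]) (auto simp: carrier_free_alg_intros)
  fix A A' c assume "A \<in> ?G"
  then obtain p where p: "p \<in> carrier (free_alg S)" "A = restrict (frep \<rho>' p) ?W" by auto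
  show "restrict (\<lambda>v. smul c (A v)) ?W \<in> ?G"
    by (rule image_eqI[of _ _ "scal c * p"])
       (auto simp: carrier_free_alg_intros p frep_mult[OF lin] fun_eq_iff restrict_def)
  assume "A' \<in> ?G"
  then obtain p' where p': "p' \<in> carrier (free_alg S)" "A' = restrict (frep \<rho>' p') ?W" by auto
  show "restrict (\<lambda>v. A v + A' v) ?W \<in> ?G"
    by (rule image_eqI[of _ _ "p + p'"])
       (auto simp: carrier_free_alg_intros p p' frep_add fun_eq_iff restrict_def)
  show "restrict (\<lambda>v. A (A' v)) ?W \<in> ?G"
    by (rule image_eqI[of _ _ "p * p'"])
       (auto simp: carrier_free_alg_intros p p' frep_mult[OF lin] fun_eq_iff restrict_def frep_closed)
qed (auto simp: frep_End)

end

section \<open>Reduction of the operators at \<open>q = 1\<close>\<close>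

lemma specializes_kiop: "specializes (lookup (kiop i (Mb g)) f) (if f = g then 1 else 0)"
proof -
  have "specializes (qq ^ count_list g (Suc i) * inverse qq ^ count_list g i) (1 ^ count_list g (Suc i) * 1 ^ count_list g i)"
    by (intro specializes_mult specializes_power specializes_qq specializes_inverse_qq)
  then show ?thesis by (auto simp: hiop_Mb hop_Mb lookup_Mb specializes_0 mult.commute)
qed

text \<open>At q = 1 the operator K_i^-1 becomes the identity and E_i acts as a primitive element:
  as the sum over all positions of the matrix unit with index pair (i, i + 1).\<close>

lemma specializes_eop: "length f = length g \<Longrightarrow> specializes (lookup (eop i (Mb g)) f) (sym_unit {#(i, Suc i)#} f g)"
proof (induction f g rule: list_induct2)
  case (Cons a f b g)
  have "lookup (eop i (Mb (b # g))) (a # f) =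
      (if b = a then lookup (eop i (Mb g)) f else 0) +
      (if b = Suc i \<and> i = a then lookup (kiop i (Mb g)) f else 0)"
    by (simp add: lookup_add lookup_cons flip: cons_Mb del: hop_hiop)
  moreover have "specializes \<dots> ((if b = a then sym_unit {#(i, Suc i)#} f g else 0) +
      (if b = Suc i \<and> i = a then if f = g then 1 else 0 else 0))"
    using Cons.IH specializes_kiop[of i g f] by (intro specializes_add) (auto simp: specializes_0)
  ultimately show ?case unfolding sym_unit_single_Cons by (simp add: if_distrib eq_commute conj_commute cong: if_cong) (auto split: if_splits)
qed (simp add: specializes_0 sym_unit_single_Nil)

lemma specializes_fop: "length f = length g \<Longrightarrow> specializes (lookup (fop i (Mb g)) f) (sym_unit {#(Suc i, i)#} f g)"
proof (induction f g rule: list_induct2)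
  case (Cons a f b g)
  let ?k = "if b = i then qq else if b = Suc i then inverse qq else 1"
  have "lookup (fop i (Mb (b # g))) (a # f) =
      ?k * (if b = a then lookup (fop i (Mb g)) f else 0) +
      (if b = i \<and> Suc i = a then if f = g then 1 else 0 else 0)"
    by (auto simp: lookup_add lookup_cons lookup_Mb fop_Mb simp del: cons_Mb)
  moreover have "specializes \<dots> (1 * (if b = a then sym_unit {#(Suc i, i)#} f g else 0) +
      (if b = i \<and> Suc i = a then if f = g then 1 else 0 else 0))"
    using Cons.IH by (intro specializes_add specializes_mult) (auto simp: specializes_0 specializes_1 specializes_qq specializes_inverse_qq)
  ultimately show ?case unfolding sym_unit_single_Cons by (auto split: if_splits)
qed (simp add: specializes_0 sym_unit_single_Nil)

lemma sym_unit_diagonal: "length f = length g \<Longrightarrow>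
  sym_unit {#(a, a)#} f g = (if f = g then of_nat (count_list g a) else 0)"
proof (induction f g rule: list_induct2)
  case (Cons b f c g)
  then show ?case unfolding sym_unit_single_Cons by auto
qed (simp add: sym_unit_single_Nil)

text \<open>H_a tends to the identity, but its difference quotient keeps the number of factors
  \<eta>_a, which is the sum over all positions of E_aa.\<close>

lemma specializes_hop: "length f = length g \<Longrightarrow>
  specializes (inverse (qq - 1) * lookup (hop a (Mb g) - Mb g) f) (sym_unit {#(a, a)#} f g)"
  using specializes_qq_number[of "count_list g a"]
  by (simp add: sym_unit_diagonal hop_Mb lookup_minus lookup_Mb specializes_0 field_simps)

text \<open>The coefficient q^-1 - q vanishes at q = 1, which leaves the place permutation; for
  equal neighbours this permutation fixes \<open>g\<close>, and q^-1 becomes 1.\<close>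

lemma specializes_hecke:
  assumes "i \<in> {1..<length g}"
  shows "specializes (lookup (hecke_op i (Mb g)) f) (if f = permute_list (transpose (i - 1) i) g then 1 else 0)"
proof -
  let ?t = "transpose (i - 1) i"
  let ?g = "permute_list ?t g"
  have M: "specializes (lookup (Mb h) f) (if f = h then 1 else 0)" for h
    by (auto simp: lookup_Mb specializes_0 specializes_1)
  consider "g ! (i - 1) < g ! i" | "g ! (i - 1) > g ! i" | "g ! (i - 1) = g ! i" by linarith
  then show ?thesis
  proof cases
    case 1
    then show ?thesis using M[of ?g] by (simp add: hecke_Mb' Let_def)
  next
    case 2
    have "specializes (lookup (Mb ?g) f + (inverse qq - qq) * lookup (Mb g) f)
        ((if f = ?g then 1 else 0) + (1 - 1) * (if f = g then 1 else 0))"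
      by (intro specializes_add specializes_mult specializes_diff specializes_inverse_qq specializes_qq M)
    with 2 show ?thesis by (simp add: hecke_Mb' Let_def lookup_add)
  next
    case 3
    have "?g = g"
      using assms 3 by (intro nth_equalityI) (auto simp: permute_list_def transpose_def)
    moreover have "specializes (inverse qq * lookup (Mb g) f) (1 * (if f = g then 1 else 0))"
      by (intro specializes_mult specializes_inverse_qq M)
    ultimately show ?thesis using 3 by (simp add: hecke_Mb' Let_def)
  qed
qed

text \<open>In contrast to \<open>block_proj\<close>, this family of projections is closed under
  removal of the first factor (\<open>pat_proj_cons\<close>), as an induction over the factors
  requires.\<close>

definition pat_proj :: "nat \<Rightarrow> (bool list \<Rightarrow> bool) \<Rightarrow> vec \<Rightarrow> vec" where
  "pat_proj n Q = lin_ext (\<lambda>f. if Q (map (\<lambda>a. a \<le> n) f) then Mb f else 0)"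

lemma lin_pat_proj [simp]: "lin (pat_proj n Q)"
  by (simp add: pat_proj_def)

lemma pat_proj_Mb: "pat_proj n Q (Mb f) = (if Q (map (\<lambda>a. a \<le> n) f) then Mb f else 0)"
  by (simp add: pat_proj_def)

lemmas pat_proj_lin [simp] = lin_simps[OF lin_pat_proj]

lemma pat_proj_cons [simp]: "pat_proj n Q (cons a v) = cons a (pat_proj n (\<lambda>bs. Q ((a \<le> n) # bs)) v)"
  by (rule lin_eqI[of _ _ v]) (auto simp: lin_def vec_norm pat_proj_Mb)

lemma block_proj_pat:
  "block_proj n l = pat_proj n (\<lambda>bs. l \<le> length bs \<and> (\<forall>k<length bs. bs ! k \<longleftrightarrow> k < l))"
  unfolding block_proj_def pat_proj_def block_iff by (simp cong: conj_cong)

lemma pat_proj_hop: "hop a (pat_proj n Q v) = pat_proj n Q (hop a v)"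
  and pat_proj_hiop: "hiop a (pat_proj n Q v) = pat_proj n Q (hiop a v)"
  by (rule lin_eqI[of _ _ v]; auto simp: lin_def vec_norm pat_proj_Mb hop_Mb hiop_Mb)+

text \<open>E_i replaces an entry i + 1 by i; for i < n both are \<le> n, so the pattern is
  kept.\<close>

lemma pat_proj_eop: "i < n \<Longrightarrow> eop i (pat_proj n Q v) = pat_proj n Q (eop i v)"
proof (rule lin_eqI[of _ _ v])
  show "eop i (pat_proj n Q (Mb f)) = pat_proj n Q (eop i (Mb f))" if "i < n" for f
  proof (induction f arbitrary: Q)
    case (Cons a f)
    then show ?case using that
      by (simp flip: cons_Mb add: pat_proj_hop[symmetric] pat_proj_hiop[symmetric])
  qed (simp add: pat_proj_Mb)
qed (auto simp: lin_def vec_norm)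

lemma pat_proj_fop: "i < n \<Longrightarrow> fop i (pat_proj n Q v) = pat_proj n Q (fop i v)"
proof (rule lin_eqI[of _ _ v])
  show "fop i (pat_proj n Q (Mb f)) = pat_proj n Q (fop i (Mb f))" if "i < n" for f
  proof (induction f arbitrary: Q)
    case (Cons a f)
    then show ?case using that by (simp flip: cons_Mb)
  qed (simp add: pat_proj_Mb)
qed (auto simp: lin_def vec_norm mult_ac)

definition levi_gens :: "nat \<Rightarrow> ugen set" where
  "levi_gens n = E ` {1..<n} \<union> F ` {1..<n} \<union> H ` {1..n + 1} \<union> Hi ` {1..n + 1}"

lemma levi_gens_ugens: "levi_gens n \<subseteq> ugens (n + 1)"
  by (auto simp: levi_gens_def ugens_def)

lemma uop_block_proj: "g \<in> levi_gens n \<Longrightarrow> uop g (block_proj n l v) = block_proj n l (uop g v)"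
  unfolding block_proj_pat levi_gens_def
  by (auto simp: pat_proj_eop pat_proj_fop pat_proj_hop pat_proj_hiop)

lemma uop_dop:
  assumes "u \<in> levi_gens n" "g \<in> dgens r" "v \<in> tpow (n + 1) r"
  shows "uop u (dop n g v) = dop n g (uop u v)"
proof (cases g)
  case (TT i)
  then show ?thesis using assms hecke_uop[of v "n + 1" r i u] by (auto simp: dgens_def)
next
  case (XX l \<sigma>)
  with assms(2) have l: "l \<le> r" and \<sigma>: "\<sigma> permutes {1..l}" by (auto simp: dgens_def)
  have "uop u (foldr hecke_op w x) = foldr hecke_op w (uop u x)"
    if "set w \<subseteq> {1..<r}" "x \<in> tpow (n + 1) r" for w x
    using that(1)
  proof (induction w)
    case (Cons i w)
    then show ?case
      using hecke_uop[of "foldr hecke_op w x" "n + 1" r i u] foldr_hecke_tpow[of w r x "n + 1"] that(2) by simp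
  qed simp
  moreover have "set (reduced_expr l \<sigma>) \<subseteq> {1..<r}" using reduced_expr(3)[OF \<sigma>] l by auto
  ultimately show ?thesis
    using assms by (simp add: XX uop_block_proj block_proj_tpow)
qed

section \<open>Double centralizer property\<close>

locale duplex_duality =
  fixes n r :: nat
  assumes r: "1 \<le> r"
begin

declare One_nat_def [simp del]

abbreviation "W \<equiv> tpow (n + 1) r"
abbreviation "B \<equiv> bas (n + 1) r"
abbreviation "D \<equiv> duplex_image n r"
abbreviation "G \<equiv> Phi n r ` Levi n"
abbreviation "U_carrier \<equiv> carrier (free_alg (ugens (n + 1)))"
abbreviation "HH_carrier \<equiv> carrier (free_alg (dgens r))"

sublocale U: presented_rep "ugens (n + 1)" "urels (n + 1)" "n + 1" r "tensor_act (r - 1)" uop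
  by (rule presented_Uq[OF r])

sublocale HH: presented_rep "dgens r" "drels r" "n + 1" r "duplex_op n r" "dop n"
  by (rule presented_HH)

section \<open>The two images as algebras of endomorphisms, and the inclusions by
  commutation\<close>

lemma duplex_image_eq: "D = (\<lambda>p. restrict (frep (dop n) p) W) ` HH_carrier"
  unfolding duplex_image_def Xi_def HH_def HH.carrier_pres_alg image_image
  by (intro image_cong refl HH.pres_rep_class)

sublocale D: endo_algebra "n + 1" r D
  unfolding duplex_image_eq by (rule HH.frep_endo_algebra)

lemma dop_in_D: "g \<in> dgens r \<Longrightarrow> restrict (dop n g) W \<in> D"
  unfolding duplex_image_eq
  by (rule image_eqI[of _ _ "gen g"]) (auto simp: carrier_free_alg_intros fun_eq_iff restrict_def)

lemma Phi_class: "p \<in> U_carrier \<Longrightarrow> Phi n r (Uq_class (n + 1) p) = restrict (frep uop p) W"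
  unfolding Phi_def Uq_class_def by (rule U.pres_rep_class)

lemma Uq_class_ops:
  assumes "p \<in> U_carrier" "q \<in> U_carrier"
  shows "Uq_class (n + 1) p \<otimes>\<^bsub>Uq (n + 1)\<^esub> Uq_class (n + 1) q = Uq_class (n + 1) (p * q)"
    and "Uq_class (n + 1) p \<oplus>\<^bsub>Uq (n + 1)\<^esub> Uq_class (n + 1) q = Uq_class (n + 1) (p + q)"
    and "\<ominus>\<^bsub>Uq (n + 1)\<^esub> Uq_class (n + 1) p = Uq_class (n + 1) (- p)"
    and "\<one>\<^bsub>Uq (n + 1)\<^esub> = Uq_class (n + 1) 1"
  unfolding Uq_def Uq_class_def using U.pres_class_ops[OF assms] by blast+

lemma Levi_generators: "range scal \<union> eE ` {1..<n} \<union> eF ` {1..<n} \<union> eH ` {1..n + 1} \<union> eHi ` {1..n + 1}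
    = range scal \<union> gen ` levi_gens n"
  by (simp add: levi_gens_def image_Un image_image Un_assoc)

text \<open>Commutation with the duplex operators passes from the generators to sums, negatives and
  products, so a representative and its commutation are obtained in one induction over
  \<open>generate_ring\<close>.\<close>

lemma Levi_representative:
  assumes "y \<in> Levi n"
  shows "\<exists>p\<in>U_carrier. y = Uq_class (n + 1) p \<and>
    (\<forall>g\<in>dgens r. \<forall>v\<in>W. frep uop p (dop n g v) = dop n g (frep uop p v))"
  using assms unfolding Levi_def Levi_generators
proof (induction rule: generate_ring.induct)
  case one
  show ?case
    by (intro bexI[of _ 1]) (simp_all add: Uq_class_ops(4)[of 1 1] carrier_free_alg_intros)
next
  case (incl y)
  then consider c where "y = Uq_class (n + 1) (scal c)" | g where "g \<in> levi_gens n" "y = Uq_class (n + 1) (gen g)"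
    by auto
  then show ?case
  proof cases
    case 1
    then show ?thesis
      by (intro bexI[of _ "scal c"]) (auto simp: carrier_free_alg_intros lin_smul[OF lin_dop])
  next
    case 2
    then show ?thesis
      using levi_gens_ugens[of n]
      by (intro bexI[of _ "gen g"]) (auto simp: uop_dop intro!: carrier_free_alg_intros)
  qed
next
  case (a_inv y)
  then obtain p where "p \<in> U_carrier" "y = Uq_class (n + 1) p"
    "\<forall>g\<in>dgens r. \<forall>v\<in>W. frep uop p (dop n g v) = dop n g (frep uop p v)" by blast
  then show ?case
    by (intro bexI[of _ "- p"])
       (auto simp: Uq_class_ops(3)[of p p] carrier_free_alg_intros frep_uminus lin_minus[OF lin_dop])
next
  case (eng_add y z)
  then obtain p q where "p \<in> U_carrier" "y = Uq_class (n + 1) p"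
    "\<forall>g\<in>dgens r. \<forall>v\<in>W. frep uop p (dop n g v) = dop n g (frep uop p v)"
    "q \<in> U_carrier" "z = Uq_class (n + 1) q"
    "\<forall>g\<in>dgens r. \<forall>v\<in>W. frep uop q (dop n g v) = dop n g (frep uop q v)" by blast
  then show ?case
    by (intro bexI[of _ "p + q"])
       (auto simp: Uq_class_ops(2) carrier_free_alg_intros frep_add lin_add[OF lin_dop])
next
  case (eng_mult y z)
  then obtain p q where pq: "p \<in> U_carrier" "y = Uq_class (n + 1) p"
    "\<forall>g\<in>dgens r. \<forall>v\<in>W. frep uop p (dop n g v) = dop n g (frep uop p v)"
    "q \<in> U_carrier" "z = Uq_class (n + 1) q"
    "\<forall>g\<in>dgens r. \<forall>v\<in>W. frep uop q (dop n g v) = dop n g (frep uop q v)" by blast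
  then show ?case
    using U.frep_closed[OF pq(4)]
    by (intro bexI[of _ "p * q"])
       (auto simp: Uq_class_ops(1) carrier_free_alg_intros frep_mult[OF lin_uop])
qed

lemma Levi_End:
  assumes "y \<in> Levi n"
  shows "Phi n r y \<in> End W" and "d \<in> D \<Longrightarrow> v \<in> W \<Longrightarrow> Phi n r y (d v) = d (Phi n r y v)"
proof -
  obtain p where p: "p \<in> U_carrier" "y = Uq_class (n + 1) p"
    "\<forall>g\<in>dgens r. \<forall>v\<in>W. frep uop p (dop n g v) = dop n g (frep uop p v)"
    using Levi_representative[OF assms] by blast
  have y: "Phi n r y = restrict (frep uop p) W" using p Phi_class by simp
  show E: "Phi n r y \<in> End W" unfolding y by (rule U.frep_End[OF p(1)])
  show "Phi n r y (d v) = d (Phi n r y v)" if d: "d \<in> D" and v: "v \<in> W"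
  proof -
    obtain q where q: "q \<in> HH_carrier" "d = restrict (frep (dop n) q) W"
      using d unfolding duplex_image_eq by auto
    have "Phi n r y (frep (dop n) q v) = frep (dop n) q (Phi n r y v)"
      using p(3) by (intro HH.commute_frep[OF E _ q(1) v]) (simp add: y HH.closed U.frep_closed)
    then show ?thesis
      unfolding q(2) using v EndD(1)[OF E v] by simp
  qed
qed

lemma Levi_ring: "Levi n \<subseteq> Uq_class (n + 1) ` U_carrier"
  using Levi_representative by blast

sublocale G: endo_algebra "n + 1" r G
proof
  show "A \<in> End W" if "A \<in> G" for A using that Levi_End(1) by auto
  have one: "Uq_class (n + 1) 1 \<in> Levi n"
    using generate_ring.one[of "Uq (n + 1)"] unfolding Levi_def by (simp add: Uq_class_ops(4)[of 1 1] carrier_free_alg_intros)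
  show "restrict (\<lambda>v. v) W \<in> G"
    by (rule image_eqI[OF _ one]) (simp add: Phi_class carrier_free_alg_intros fun_eq_iff restrict_def)
  fix A A' c assume "A \<in> G"
  then obtain p where p: "p \<in> U_carrier" "Uq_class (n + 1) p \<in> Levi n" "A = Phi n r (Uq_class (n + 1) p)"
    using Levi_ring by blast
  have "Uq_class (n + 1) (scal c) \<in> Levi n"
    unfolding Levi_def by (rule generate_ring.incl) auto
  then have "Uq_class (n + 1) (scal c * p) \<in> Levi n"
    using generate_ring.eng_mult[of _ "Uq (n + 1)"] p unfolding Levi_def
    by (metis Uq_class_ops(1) carrier_free_alg_intros(3))
  then show "restrict (\<lambda>v. smul c (A v)) W \<in> G"
    by (rule image_eqI[rotated])
       (auto simp: p Phi_class carrier_free_alg_intros frep_mult[OF lin_uop] fun_eq_iff restrict_def)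
  assume "A' \<in> G"
  then obtain q where q: "q \<in> U_carrier" "Uq_class (n + 1) q \<in> Levi n" "A' = Phi n r (Uq_class (n + 1) q)"
    using Levi_ring by blast
  have pq: "Uq_class (n + 1) (p + q) \<in> Levi n" "Uq_class (n + 1) (p * q) \<in> Levi n"
    using generate_ring.eng_add[of "Uq_class (n + 1) p" "Uq (n + 1)" _ "Uq_class (n + 1) q"]
      generate_ring.eng_mult[of "Uq_class (n + 1) p" "Uq (n + 1)" _ "Uq_class (n + 1) q"] p q unfolding Levi_def
    by (simp_all add: Uq_class_ops(1,2))
  note simps = p(1,3) q(1,3) Phi_class carrier_free_alg_intros frep_mult[OF lin_uop] frep_add
    fun_eq_iff restrict_def U.frep_closed
  show "restrict (\<lambda>v. A v + A' v) W \<in> G"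
    by (rule image_eqI[OF _ pq(1)]) (simp add: simps)
  show "restrict (\<lambda>v. A (A' v)) W \<in> G"
    by (rule image_eqI[OF _ pq(2)]) (simp add: simps)
qed

lemma uop_in_G:
  assumes "g \<in> levi_gens n"
  shows "restrict (uop g) W \<in> G"
proof -
  have "Uq_class (n + 1) (gen g) \<in> Levi n"
    unfolding Levi_def Levi_generators using assms by (intro generate_ring.incl) auto
  moreover have "gen g \<in> U_carrier" using assms levi_gens_ugens by (auto intro: carrier_free_alg_intros)
  ultimately show ?thesis
    by (intro image_eqI[of _ _ "Uq_class (n + 1) (gen g)"]) (auto simp: Phi_class fun_eq_iff restrict_def)
qed

section \<open>Endomorphisms commuting with the duplex Hecke algebra\<close>

lemma permute_swap_bas: "i \<in> {1..<r} \<Longrightarrow> f \<in> B \<Longrightarrow> permute_list (transpose (i - 1) i) f \<in> B"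
  and permute_swap_involutive: "i \<in> {1..<r} \<Longrightarrow> f \<in> B \<Longrightarrow>
    permute_list (transpose (i - 1) i) (permute_list (transpose (i - 1) i) f) = f"
proof -
  assume i: "i \<in> {1..<r}" and f: "f \<in> B"
  then have t: "transpose (i - 1) i permutes {..<length f}"
    by (intro permutes_swap_id) (auto simp: bas_def)
  then show "permute_list (transpose (i - 1) i) f \<in> B"
    using f by (simp add: bas_def)
  show "permute_list (transpose (i - 1) i) (permute_list (transpose (i - 1) i) f) = f"
    using permute_list_compose[OF t, of "transpose (i - 1) i"] by simp
qed

text \<open>\<open>Y\<close> will be a commuting matrix minus its projection. Rescaling by
  \<open>c\<close> preserves commutation and orthogonality, so both can be evaluated at q =
  1.\<close>

lemma commuting_orthogonal_zero:
  assumes comm: "\<And>g f f'. g \<in> dgens r \<Longrightarrow> f \<in> B \<Longrightarrow> f' \<in> B \<Longrightarrow>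
      mat_prod B Y (entries (dop n g)) (f, f') = mat_prod B (entries (dop n g)) Y (f, f')"
    and orth: "\<And>c. c \<in> G.mats \<Longrightarrow> dot (B \<times> B) Y c = 0"
    and fg: "f \<in> B" "g \<in> B"
  shows "Y (f, g) = 0"
proof (rule ccontr)
  assume nz: "Y (f, g) \<noteq> 0"
  have "\<exists>c y. (\<forall>j\<in>B \<times> B. specializes (Y j * c) (y j)) \<and> (\<exists>j\<in>B \<times> B. y j \<noteq> 0)"
    by (rule specialize_nonzero[of _ "(f, g)"]) (use fg nz in auto)
  then obtain c y where y: "\<And>f g. f \<in> B \<Longrightarrow> g \<in> B \<Longrightarrow> specializes (Y (f, g) * c) (y (f, g))"
    and y_nz: "\<exists>j\<in>B \<times> B. y j \<noteq> 0" by blast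
  define X where "X = (\<lambda>f g. y (f, g))"
  define good where "good Z \<longleftrightarrow> (\<exists>d\<in>G.mats. \<forall>f\<in>B. \<forall>g\<in>B. specializes (d (f, g)) (Z f g))" for Z
  have goodI: "good Z" if "restrict L W \<in> G" "\<And>f g. f \<in> B \<Longrightarrow> g \<in> B \<Longrightarrow> specializes (lookup (L (Mb g)) f) (Z f g)" for L Z
    unfolding good_def using G.mats_restrict[OF that(1)] that(2) by (intro bexI) auto
  have len: "length f = length g" if "f \<in> B" "g \<in> B" for f g using that by (simp add: bas_def)
  interpret levi: levi_algebra n r good
  proof
    show "good Z'" if "good Z" "\<And>f g. f \<in> B \<Longrightarrow> g \<in> B \<Longrightarrow> Z f g = Z' f g" for Z Z'
      using that unfolding good_def by metis
    show "good (\<lambda>f g. Z f g + Z' f g)" if Z: "good Z" "good Z'" for Z Z'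
    proof -
      obtain d d' where "d \<in> G.mats" "\<forall>f\<in>B. \<forall>g\<in>B. specializes (d (f, g)) (Z f g)"
        "d' \<in> G.mats" "\<forall>f\<in>B. \<forall>g\<in>B. specializes (d' (f, g)) (Z' f g)" using Z unfolding good_def by blast
      then show ?thesis unfolding good_def by (intro bexI[OF _ G.mats_add[of d d']]) (auto intro: specializes_add)
    qed
    show "good (\<lambda>f g. \<Sum>h\<in>B. Z f h * Z' h g)" if Z: "good Z" "good Z'" for Z Z'
    proof -
      obtain d d' where "d \<in> G.mats" "\<forall>f\<in>B. \<forall>g\<in>B. specializes (d (f, g)) (Z f g)"
        "d' \<in> G.mats" "\<forall>f\<in>B. \<forall>g\<in>B. specializes (d' (f, g)) (Z' f g)" using Z unfolding good_def by blast
      then show ?thesis unfolding good_def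
        by (intro bexI[OF _ G.mats_mult[of d d']]) (auto simp: mat_prod_apply intro!: specializes_sum specializes_mult)
    qed
    show "good (\<lambda>f g. a * Z f g)" if Z: "good Z" for Z a
    proof -
      obtain d where "d \<in> G.mats" "\<forall>f\<in>B. \<forall>g\<in>B. specializes (d (f, g)) (Z f g)" using Z unfolding good_def by blast
      then show ?thesis unfolding good_def
        by (intro bexI[OF _ G.mats_scale[of d "Fract [:a:] 1"]]) (auto intro!: specializes_mult specializes_const)
    qed
    show "good (\<lambda>f g. if f = g then 1 else 0)"
      by (rule goodI[OF G.one]) (auto simp: lookup_Mb specializes_0 specializes_1)
    show "good (sym_unit {#(i, Suc i)#})" if "i \<in> {1..<n}" for i
      using uop_in_G[of "E i"] that by (intro goodI[of "eop i"] specializes_eop len) (auto simp: levi_gens_def)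
    show "good (sym_unit {#(Suc i, i)#})" if "i \<in> {1..<n}" for i
      using uop_in_G[of "F i"] that by (intro goodI[of "fop i"] specializes_fop len) (auto simp: levi_gens_def)
    show "good (sym_unit {#(a, a)#})" if "a \<in> {1..n + 1}" for a
    proof -
      have h: "restrict (hop a) W \<in> G" using uop_in_G[of "H a"] that by (auto simp: levi_gens_def)
      have "restrict (\<lambda>v. smul (inverse (qq - 1)) (hop a v - v)) W \<in> G"
        using G.scale[OF G.add[OF h G.scale[OF G.one, of "-1"]], of "inverse (qq - 1)"]
        by (simp cong: restrict_cong)
      then show ?thesis
      proof (rule goodI)
        fix f g assume "f \<in> B" "g \<in> B"
        from specializes_hop[OF len[OF this], of a]
        show "specializes (lookup (smul (inverse (qq - 1)) (hop a (Mb g) - Mb g)) f) (sym_unit {#(a, a)#} f g)"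
          unfolding lookup_smul .
      qed
    qed
  qed
  have "X f' g' = 0" if "f' \<in> B" "g' \<in> B" for f' g'
  proof (rule levi.orthogonal_symmetric_zero[OF _ _ _ that])
    show "(\<Sum>f\<in>B. \<Sum>g\<in>B. X f g * Z f g) = 0" if Z: "good Z" for Z
    proof -
      obtain d where d: "d \<in> G.mats" "\<forall>f\<in>B. \<forall>g\<in>B. specializes (d (f, g)) (Z f g)" using Z unfolding good_def by blast
      \<comment> \<open>The pairing of the values at q = 1 is the value of the pairing, which is
        \<open>c\<close> times a vanishing inner product.\<close>
      have "specializes (\<Sum>f\<in>B. \<Sum>g\<in>B. (Y (f, g) * c) * d (f, g)) (\<Sum>f\<in>B. \<Sum>g\<in>B. X f g * Z f g)"
        unfolding X_def using d y by (intro specializes_sum specializes_mult) auto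
      moreover have "(\<Sum>f\<in>B. \<Sum>g\<in>B. (Y (f, g) * c) * d (f, g)) = c * dot (B \<times> B) Y d"
        by (simp add: dot_prod sum_distrib_left mult_ac)
      ultimately show ?thesis using orth[OF d(1)] specializes_zero_unique by simp
    qed
    show "X (permute_list (transpose (i - 1) i) f) (permute_list (transpose (i - 1) i) g) = X f g"
      if i: "i \<in> {1..<r}" and f: "f \<in> B" and g: "g \<in> B" for i f g
    proof -
      let ?s = "permute_list (transpose (i - 1) i)"
      have T: "TT i \<in> dgens r" using i by (auto simp: dgens_def)
      \<comment> \<open>At q = 1 the operator T_(s_i) is the permutation matrix of the swap, and the
        commutation of \<open>Y\<close> with it specializes to this equation.\<close>
      have *: "X f (?s g) = X (?s f) g" if f: "f \<in> B" and g: "g \<in> B" for f g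
      proof -
        let ?T = "entries (hecke_op i)"
        have sT: "specializes (?T (a, b)) (if a = ?s b then 1 else 0)" if "b \<in> B" for a b
          using specializes_hecke[of i b a] i that by (simp add: entries_apply bas_def)
        have "specializes (\<Sum>h\<in>B. (Y (f, h) * c) * ?T (h, g)) (\<Sum>h\<in>B. X f h * (if h = ?s g then 1 else 0))"
          unfolding X_def using f g by (intro specializes_sum specializes_mult y sT) auto
        moreover have "specializes (\<Sum>h\<in>B. ?T (f, h) * (Y (h, g) * c)) (\<Sum>h\<in>B. (if f = ?s h then 1 else 0) * X h g)"
          unfolding X_def using f g by (intro specializes_sum specializes_mult y sT) auto
        moreover have "(\<Sum>h\<in>B. (Y (f, h) * c) * ?T (h, g)) = (\<Sum>h\<in>B. ?T (f, h) * (Y (h, g) * c))"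
        proof -
          have "(\<Sum>h\<in>B. (Y (f, h) * c) * ?T (h, g)) = c * mat_prod B Y ?T (f, g)"
            by (simp add: mat_prod_apply sum_distrib_left mult_ac)
          also have "\<dots> = c * mat_prod B ?T Y (f, g)" using comm[OF T f g] by simp
          also have "\<dots> = (\<Sum>h\<in>B. ?T (f, h) * (Y (h, g) * c))"
            by (simp add: mat_prod_apply sum_distrib_left mult_ac)
          finally show ?thesis .
        qed
        ultimately have "specializes 0 ((\<Sum>h\<in>B. X f h * (if h = ?s g then 1 else 0)) - (\<Sum>h\<in>B. (if f = ?s h then 1 else 0) * X h g))"
          using specializes_diff by fastforce
        then have "(\<Sum>h\<in>B. X f h * (if h = ?s g then 1 else 0)) = (\<Sum>h\<in>B. (if f = ?s h then 1 else 0) * X h g)"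
          using specializes_zero_unique by fastforce
        also have "\<dots> = (\<Sum>h\<in>B. if h = ?s f then X h g else 0)"
          using permute_swap_involutive[OF i] f by (intro sum.cong) auto
        finally show ?thesis
          using permute_swap_bas[OF i f] permute_swap_bas[OF i g] by (simp add: if_distrib cong: if_cong)
      qed
      show ?thesis using *[OF f permute_swap_bas[OF i g]] permute_swap_involutive[OF i g] by simp
    qed
    show "X f g = 0" if l: "l \<in> {1..r}" and f: "f \<in> B" and g: "g \<in> B"
      and ne: "(block n f = {1..l}) \<noteq> (block n g = {1..l})" for l f g
    proof -
      \<comment> \<open>The identity permutation gives a diagonal matrix of zeros and ones;
        commuting with it kills the entries of \<open>Y\<close> between its image and its kernel,
        already before specialization.\<close>
      have g': "XX l id \<in> dgens r" using l by (auto simp: dgens_def permutes_id)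
      have "dop n (XX l id) (Mb h) = block_proj n l (Mb h)" if "h \<in> B" for h
        using braid_action.Tw_id[OF braid_action_tpow[of l r "n + 1"], of "block_proj n l (Mb h)"] l that
        by (simp add: block_proj_tpow)
      moreover define T where "T = entries (dop n (XX l id))"
      ultimately have P: "T (a, b) = (if block n b = {1..l} \<and> a = b then 1 else 0)" if "b \<in> B" for a b
        using that by (simp add: entries_apply block_proj_Mb lookup_Mb)
      have "mat_prod B Y T (f, g) = (if block n g = {1..l} then Y (f, g) else 0)"
        unfolding mat_prod_apply using g by (simp add: P if_distrib cong: if_cong)
      moreover have "mat_prod B T Y (f, g) = (\<Sum>h\<in>B. if h = f then (if block n f = {1..l} then Y (f, g) else 0) else 0)"
        unfolding mat_prod_apply by (intro sum.cong refl) (auto simp: P)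
      ultimately have "Y (f, g) = 0" using comm[OF g' f g, folded T_def] ne f by (auto split: if_splits)
      then show ?thesis using y[OF f g] specializes_zero_unique by (simp add: X_def)
    qed
  qed
  with y_nz show False by (auto simp: X_def)
qed

text \<open>The projection of \<open>A\<close> onto the Levi image commutes with the duplex
  operators because it lies in that image. So the difference commutes as well, is orthogonal to the
  image, and vanishes.\<close>

lemma commutant_D_subset:
  assumes A: "A \<in> End W" and comm: "\<And>g v. g \<in> dgens r \<Longrightarrow> v \<in> W \<Longrightarrow> A (dop n g v) = dop n g (A v)"
  shows "A \<in> G"
proof -
  obtain c where c: "c \<in> G.mats" "\<forall>d\<in>G.mats. dot (B \<times> B) (\<lambda>j. entries A j - c j) d = 0"
    using orthogonal_projection[of "B \<times> B" G.mats "entries A"] G.is_subspace_mats by auto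
  define C where "C = op_of (n + 1) r c"
  have C: "C \<in> G" "C \<in> End W" using c(1) by (auto simp: C_def G.mats_def op_of_End)
  have mat_prod_commute: "mat_prod B (entries A') (entries (dop n g)) (f, f') = mat_prod B (entries (dop n g)) (entries A') (f, f')"
    if A': "A' \<in> End W" "\<And>v. v \<in> W \<Longrightarrow> A' (dop n g v) = dop n g (A' v)"
      and g: "g \<in> dgens r" and f: "f \<in> B" "f' \<in> B" for A' g f f'
  proof -
    let ?R = "restrict (dop n g) W"
    have R: "?R \<in> End W" by (intro restrict_End lin_dop HH.closed[OF g])
    have "\<forall>v\<in>W. A' (?R v) = ?R (A' v)" using A'(2) EndD(1)[OF A'(1)] by simp
    with End_commute_iff[OF A'(1) R] f have "mat_prod B (entries A') (entries ?R) (f, f') = mat_prod B (entries ?R) (entries A') (f, f')" by blast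
    then show ?thesis using f by (simp add: mat_prod_apply entries_apply)
  qed
  have C_comm: "C (dop n g v) = dop n g (C v)" if "g \<in> dgens r" "v \<in> W" for g v
    using Levi_End(2)[OF _ dop_in_D[OF that(1)] that(2)] C(1) that EndD(1)[OF C(2)] by (auto simp: HH.closed)
  have "entries A (f, g) - c (f, g) = 0" if fg: "f \<in> B" "g \<in> B" for f g
  proof (rule commuting_orthogonal_zero[OF _ _ fg])
    fix g f f' assume g: "g \<in> dgens r" and f: "f \<in> B" "f' \<in> B"
    have c_ent: "c (a, b) = entries C (a, b)" if "a \<in> B" "b \<in> B" for a b
      using that by (simp add: C_def entries_op_of)
    have "mat_prod B (\<lambda>j. entries A j - c j) (entries (dop n g)) (f, f') =
        mat_prod B (entries A) (entries (dop n g)) (f, f') - mat_prod B (entries C) (entries (dop n g)) (f, f')"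
      using f by (simp add: mat_prod_apply c_ent left_diff_distrib sum_subtractf)
    also have "\<dots> = mat_prod B (entries (dop n g)) (entries A) (f, f') - mat_prod B (entries (dop n g)) (entries C) (f, f')"
      using mat_prod_commute[OF A comm[OF g] g f] mat_prod_commute[OF C(2) C_comm[OF g] g f] by simp
    also have "\<dots> = mat_prod B (entries (dop n g)) (\<lambda>j. entries A j - c j) (f, f')"
      using f by (simp add: mat_prod_apply c_ent right_diff_distrib sum_subtractf)
    finally show "mat_prod B (\<lambda>j. entries A j - c j) (entries (dop n g)) (f, f') = mat_prod B (entries (dop n g)) (\<lambda>j. entries A j - c j) (f, f')" .
  qed (use c(2) in auto)
  then have "C = A" unfolding C_def using op_of_eq_iff[OF A] by auto
  with C(1) show ?thesis by simp
qed

text \<open>Every generator acts by a product of symmetric matrices, namely of Hecke operators and a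
  block projection. Transposition reverses products, so the transpose of a word is again a product
  of members of the image.\<close>

lemma D_transpose:
  assumes "X \<in> D.mats"
  shows "(\<lambda>(f, g). X (g, f)) \<in> D.mats"
proof -
  define tr where "tr L = (\<lambda>(f, g). lookup (L (Mb f)) g)" for L :: "vec \<Rightarrow> vec"
  have tr_comp: "tr (\<lambda>v. L (M v)) \<in> D.mats"
    if L: "lin L" "tr L \<in> D.mats" and M: "\<And>v. v \<in> W \<Longrightarrow> M v \<in> W" "tr M \<in> D.mats" for L M
  proof (rule D.mats_cong[OF D.mats_mult[OF M(2) L(2)]])
    show "tr (\<lambda>v. L (M v)) (f, g) = mat_prod B (tr M) (tr L) (f, g)" if "f \<in> B" "g \<in> B" for f g
      using lookup_lin[OF L(1) M(1), of "Mb f" g] that by (simp add: tr_def mat_prod_apply)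
  qed
  have tr_id: "tr (\<lambda>v. v) \<in> D.mats"
    by (rule D.mats_cong[OF D.mats_one]) (simp add: tr_def lookup_Mb)
  have tr_sym: "tr L \<in> D.mats"
    if "restrict L W \<in> D" "\<And>f g. f \<in> B \<Longrightarrow> g \<in> B \<Longrightarrow> lookup (L (Mb f)) g = lookup (L (Mb g)) f" for L
    by (rule D.mats_cong[OF D.mats_restrict[OF that(1)]]) (simp add: tr_def that(2))
  have tr_hecke: "tr (hecke_op i) \<in> D.mats" if "i \<in> {1..<r}" for i
  proof (rule tr_sym)
    show "restrict (hecke_op i) W \<in> D" using dop_in_D[of "TT i"] that by (auto simp: dgens_def)
    show "lookup (hecke_op i (Mb f)) g = lookup (hecke_op i (Mb g)) f"
      if "f \<in> B" "g \<in> B" for f g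
      using hecke_sym[of "i - 1" f g] that \<open>i \<in> {1..<r}\<close> by (simp add: bas_def One_nat_def)
  qed
  have tr_block: "tr (block_proj n l) \<in> D.mats" if l: "l \<in> {1..r}" for l
  proof (rule tr_sym)
    have "restrict (dop n (XX l id)) W \<in> D" using l by (intro dop_in_D) (auto simp: dgens_def permutes_id)
    moreover have "dop n (XX l id) v = block_proj n l v" if "v \<in> W" for v
      using braid_action.Tw_id[OF braid_action_tpow[of l r "n + 1"], of "block_proj n l v"] l that
      by (simp add: block_proj_tpow)
    ultimately show "restrict (block_proj n l) W \<in> D" by (simp cong: restrict_cong)
  qed (auto simp: block_proj_Mb lookup_Mb)
  have tr_foldr: "tr (foldr L w) \<in> D.mats"
    if "\<And>i. lin (L i)" "\<And>i v. i \<in> set w \<Longrightarrow> v \<in> W \<Longrightarrow> L i v \<in> W" "\<And>i. i \<in> set w \<Longrightarrow> tr (L i) \<in> D.mats"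
    for L and w :: "'b list"
    using that(2,3)
  proof (induction w)
    case Nil
    then show ?case using tr_id by (simp add: id_def)
  next
    case (Cons i w)
    have W: "foldr L w v \<in> W" if "v \<in> W" for v
      using Cons.prems(1) that by (induction w) auto
    then show ?case using tr_comp[OF that(1) _ W, of i] Cons by (simp add: comp_def)
  qed
  have tr_dop: "tr (dop n g) \<in> D.mats" if g: "g \<in> dgens r" for g
  proof (cases g)
    case (TT i)
    then show ?thesis using g tr_hecke by (auto simp: dgens_def)
  next
    case (XX l \<sigma>)
    then have l: "l \<in> {1..r}" and \<sigma>: "\<sigma> permutes {1..l}" using g by (auto simp: dgens_def)
    have w: "set (reduced_expr l \<sigma>) \<subseteq> {1..<r}" using reduced_expr(3)[OF \<sigma>] l by auto
    have "tr (foldr hecke_op (reduced_expr l \<sigma>)) \<in> D.mats"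
      using w by (intro tr_foldr) (auto intro: hecke_tpow tr_hecke)
    from tr_comp[OF lin_foldr[OF lin_hecke_op] this block_proj_tpow tr_block[OF l]]
    show ?thesis by (simp add: XX)
  qed
  have "op_of (n + 1) r X \<in> D" using assms by (simp add: D.mats_def)
  then obtain p where p: "p \<in> HH_carrier" "op_of (n + 1) r X = restrict (frep (dop n) p) W"
    unfolding duplex_image_eq by auto
  have "(\<lambda>j. \<Sum>w\<in>keys p. lookup p w * tr (foldr (dop n) (letters w)) j) \<in> D.mats"
  proof (intro is_subspace_sum[OF D.is_subspace_mats] tr_foldr lin_dop)
    fix w i v assume "w \<in> keys p" "i \<in> set (letters w)"
    then have i: "i \<in> dgens r" using p(1) by (auto simp: carrier_free_alg)
    show "tr (dop n i) \<in> D.mats" by (rule tr_dop[OF i])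
    show "v \<in> W \<Longrightarrow> dop n i v \<in> W" by (rule HH.closed[OF i])
  qed
  then show ?thesis
  proof (rule D.mats_cong)
    fix f g assume fg: "f \<in> B" "g \<in> B"
    have "X (g, f) = lookup (frep (dop n) p (Mb f)) g"
      using entries_op_of[OF fg(2,1), of X] fg by (simp add: p(2) entries_apply)
    then show "(case (f, g) of (f, g) \<Rightarrow> X (g, f)) =
        (\<Sum>w\<in>keys p. lookup p w * tr (foldr (dop n) (letters w)) (f, g))"
      by (simp add: frep_def lookup_sum tr_def)
  qed
qed

text \<open>A matrix that commutes with the duplex image lies in the Levi image by
  \<open>commutant_D_subset\<close>, so \<open>A\<close> commutes with it; this is the hypothesis of
  \<open>double_commutant\<close>.\<close>

lemma commutant_G_subset:
  assumes A: "A \<in> End W" and comm: "\<And>y v. y \<in> Levi n \<Longrightarrow> v \<in> W \<Longrightarrow> A (Phi n r y v) = Phi n r y (A v)"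
  shows "A \<in> D"
proof -
  have "\<exists>c\<in>D.mats. \<forall>f\<in>B. \<forall>g\<in>B. entries A (f, g) = c (f, g)"
  proof (rule double_commutant[OF finite_bas D.is_subspace_mats D.mats_mult D_transpose D.mats_one])
    fix Q f g
    assume Q: "\<And>X f g. X \<in> D.mats \<Longrightarrow> f \<in> B \<Longrightarrow> g \<in> B \<Longrightarrow> mat_prod B X Q (f, g) = mat_prod B Q X (f, g)"
      and fg: "f \<in> B" "g \<in> B"
    let ?Q = "op_of (n + 1) r Q"
    have entQ: "entries ?Q (a, b) = Q (a, b)" if "a \<in> B" "b \<in> B" for a b using that by (rule entries_op_of)
    have "?Q \<in> G"
    proof (rule commutant_D_subset[OF op_of_End])
      fix g v assume g: "g \<in> dgens r" and v: "v \<in> W"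
      let ?R = "restrict (dop n g) W"
      have R: "?R \<in> D" "?R \<in> End W" using dop_in_D[OF g] D.End by auto
      have "entries ?R \<in> D.mats" by (rule D.matsI[OF R(1)]) simp
      from Q[OF this] have "\<forall>f\<in>B. \<forall>g\<in>B. mat_prod B (entries ?Q) (entries ?R) (f, g) = mat_prod B (entries ?R) (entries ?Q) (f, g)"
        by (simp add: mat_prod_apply entQ)
      with End_commute_iff[OF op_of_End R(2)] have "?Q (?R v) = ?R (?Q v)" using v by blast
      then show "?Q (dop n g v) = dop n g (?Q v)" using v EndD(1)[OF op_of_End v] by simp
    qed
    then have "\<forall>v\<in>W. A (?Q v) = ?Q (A v)" using comm by auto
    with End_commute_iff[OF A op_of_End] have "mat_prod B (entries A) (entries ?Q) (f, g) = mat_prod B (entries ?Q) (entries A) (f, g)"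
      using fg by blast
    then show "mat_prod B (entries A) Q (f, g) = mat_prod B Q (entries A) (f, g)" using fg by (simp add: mat_prod_apply entQ)
  qed
  then obtain c where "c \<in> D.mats" "\<forall>f\<in>B. \<forall>g\<in>B. entries A (f, g) = c (f, g)" by blast
  moreover from this have "op_of (n + 1) r c = A" using op_of_eq_iff[OF A] by simp
  ultimately show ?thesis by (simp add: D.mats_def)
qed

lemma double_centralizer:
  "End_over W (\<lambda>A. A) D = G" "End_over W (Phi n r) (Levi n) = D"
proof -
  show "End_over W (\<lambda>A. A) D = G"
  proof (intro equalityI subsetI)
    fix A assume A: "A \<in> End_over W (\<lambda>A. A) D"
    then have E: "A \<in> End W" and c: "\<And>d v. d \<in> D \<Longrightarrow> v \<in> W \<Longrightarrow> A (d v) = d (A v)" by (auto simp: End_over_def)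
    show "A \<in> G"
    proof (rule commutant_D_subset[OF E])
      show "A (dop n g v) = dop n g (A v)" if "g \<in> dgens r" "v \<in> W" for g v
        using c[OF dop_in_D[OF that(1)] that(2)] that EndD(1)[OF E] by simp
    qed
  qed (auto simp: End_over_def Levi_End)
  show "End_over W (Phi n r) (Levi n) = D"
  proof (intro equalityI subsetI)
    fix A assume "A \<in> End_over W (Phi n r) (Levi n)"
    then show "A \<in> D" by (intro commutant_G_subset) (auto simp: End_over_def)
  qed (auto simp: End_over_def Levi_End D.End)
qed

end

theorem theorem4p5:
  fixes n r :: nat
  assumes "n \<ge> 1" and "r \<ge> 1"
  shows "End_over (tpow (n + 1) r) (\<lambda>A. A) (duplex_image n r) = Phi n r ` Levi n \<and>
    End_over (tpow (n + 1) r) (Phi n r) (Levi n) = duplex_image n r"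
proof -
  interpret duplex_duality n r by unfold_locales (rule assms(2))
  show ?thesis using double_centralizer by blast
qed

end
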